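(* Let $r\ge2$ be an integer and assume $f\in C^r_{\rm b}(J;L^2(\Omega))$. Let $\rho>0$ with $\rho\tau\le1$. Assume the CFL condition, and assume that the mesh is graded so that the $L^2$-orthogonal projection $\pi_h:L^2(\Omega)\to V_h$ satisfies, for all $\phi\in V$, $$\|\phi-\pi_h(\phi)\|_\Omega\lesssim h\|\nabla\phi\|_\Omega,\qquad \|\nabla\pi_h(\phi)\|_\Omega\lesssim\|\nabla\phi\|_\Omega .$$ Let $e:=u-w_{h\tau}$. Then $$\int_0^{+\infty}\|\mathcal R(t)\|_{V'}^2e^{-2\rho t}\,dt\lesssim\int_0^{+\infty}\Big\{\|\dot e(t)\|_\Omega^2+\|\nabla e(t)\|_\Omega^2\Big\}e^{-2\rho t}\,dt+\int_0^{+\infty}\|\nabla\delta_{h\tau}(t)\|_\Omega^2e^{-2\rho t}\,dt+h^2\int_0^{+\infty}\|\eta_f(t)\|_\Omega^2e^{-2\rho t}\,dt+\frac{h^{2r}}{\rho^2}\int_0^{+\infty}\|f^{(r)}(t)\|_\Omega^2e^{-2\rho t}\,dt .$$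
   Context: $A\lesssim B$ means $A\le CB$ with a constant $C$ independent of the time step $\tau$, the mesh size $h$, the damping parameter $\rho$, and of any function involved in the bound (it may depend on fixed quantities such as the constants in the assumed bounds on $\pi_h$, the CFL parameter $\mu_0$, the mesh shape-regularity, $k$, $d$). Continuous problem. $\Omega\subset\mathbb R^d$, $d\ge1$, is an open bounded Lipschitz polyhedron, $J:=[0,+\infty)$, $V:=H^1_0(\Omega)$, $(\cdot,\cdot)_\Omega$ and $\|\cdot\|_\Omega$ are the $L^2(\Omega)$ inner product and norm (same notation for vector-valued functions). Dots (or superscripts $(r)$) denote time derivatives. For a Banach space $Y$, $C^r_{\rm b}(J;Y):=\{v\in C^r(J;Y): v^{(r)}\in L^\infty(J;Y)\}$ and $C^2_{0,}(J;Y):=\{v\in C^2(J;Y): v(0)=\dot v(0)=0\}$. The source $f\in H^1(J;L^2(\Omega))\cap L^\infty(J;L^2(\Omega))$ is supported away from zero, i.e. it vanishes for $t$ in a neighborhood of $0$ in $J$. The solution $u\in C^2_{0,}(J;L^2(\Omega))\cap C^0(J;V)$ satisfies $(\ddot u(t),v)_\Omega+(\nabla u(t),\nabla v)_\Omega=(f(t),v)_\Omega$ for all $t\in J$, $v\in V$. Discrete problem. $\mathcal T_h$ is an affine simplicial mesh covering $\Omega$ exactly, of mesh size $h$, and $V_h\subset V$ is the space of continuous, piecewise polynomial functions of degree at most $k\ge1$ on $\mathcal T_h$ vanishing on $\partial\Omega$. $\tau>0$ is a constant time step, $t^n:=n\tau$ and $J_n:=[t^n,t^{n+1})$ for $n\in\mathbb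 N$ ($0\in\mathbb N$). The leapfrog solution $U=(U^n)_{n\in\mathbb N}\subset V_h$ satisfies $U^0=U^1=0$ and $\frac1{\tau^2}(U^{n+1}-2U^n+U^{n-1},v_h)_\Omega+(\nabla U^n,\nabla v_h)_\Omega=(f(t^n),v_h)_\Omega$ for all $n\ge1$, $v_h\in V_h$. The projection $\pi_h$ is defined by $\pi_h(\phi)\in V_h$, $(\pi_h(\phi),v_h)_\Omega=(\phi,v_h)_\Omega$ for all $v_h\in V_h$. CFL condition. Set $m_{h\tau}(v_h,w_h):=(v_h,w_h)_\Omega-\tau^2(\nabla v_h,\nabla w_h)_\Omega$ on $V_h\times V_h$. The CFL condition is $\tau\le C(\mu_0)h_{\min}$, where $h_{\min}$ is the smallest diameter of a mesh cell, $\mu_0\in(0,1)$ is fixed, and the constant $C(\mu_0)>0$ (depending on $\mu_0$ and the mesh shape-regularity) is such that $\mu_0\|v_h\|_\Omega^2\le m_{h\tau}(v_h,v_h)\le\|v_h\|_\Omega^2$ holds for all $v_h\in V_h$. Time reconstructions. Sequences are extended by zero to negative indices. For a sequence $W=(W^n)_{n\in\mathbb N}$ and $t\in J_n$, $$R(W)(t):=W^n+\frac{W^{n+1}-W^{n-1}}{2\tau}(t-t^n)+\frac{W^{n+1}-2W^n+W^{n-1}}{\tau^2}\frac12(t-t^n)^2,$$ $$L(W)(t):=\alpha^n+\beta^n(t-t^n)+\gamma^n\tfrac12(t-t^n)^2+\vartheta^n\tfrac16(t-t^n)^3+\epsilon^n\tfrac1{24}(t-t^n)^4,$$ with $\alpha^n=\frac{3W^{n+1}+17W^n+5W^{n-1}-W^{n-2}}{24}$,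 $\beta^n=\frac{5W^{n+1}+3W^n-9W^{n-1}+W^{n-2}}{12\tau}$, $\gamma^n=\frac{W^{n+1}-2W^n+W^{n-1}}{\tau^2}$, $\vartheta^n=\frac{W^{n+2}-2W^{n+1}+2W^{n-1}-W^{n-2}}{2\tau^3}$, $\epsilon^n=\frac{W^{n+2}-4W^{n+1}+6W^n-4W^{n-1}+W^{n-2}}{\tau^4}$. Set $u_{h\tau}:=R(U)$, $w_{h\tau}:=L(U)$, $f_\tau:=R((f(t^n))_{n\in\mathbb N})$, $\delta_{h\tau}:=u_{h\tau}-w_{h\tau}$, $\eta_f:=f-f_\tau$. The reconstructions $u_{h\tau}$ and $w_{h\tau}$ are taken in broken polynomial spaces in time that are subspaces of $L^\infty(J;V_h)$, i.e. they are bounded in time. Residual. $\mathcal R(t)\in V'$ is $\langle\mathcal R(t),v\rangle:=(f_\tau(t),v)_\Omega-(\ddot w_{h\tau}(t),v)_\Omega-(\nabla w_{h\tau}(t),\nabla v)_\Omega$, $v\in V$, and $\|\mathcal R(t)\|_{V'}:=\sup_{v\in V,\ \|\nabla v\|_\Omega=1}|\langle\mathcal R(t),v\rangle|$. *)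

theory Defs
  imports "HOL-Analysis.Analysis"
begin

section \<open>The Hilbert space of square-integrable functions\<close>

definition square_integrable :: "('a::euclidean_space \<Rightarrow> 'b::euclidean_space) \<Rightarrow> bool" where
  "square_integrable f \<longleftrightarrow>
     f \<in> borel_measurable lebesgue \<and> integrable lebesgue (\<lambda>x. (norm (f x))\<^sup>2)"

definition l2_rel :: "('a::euclidean_space \<Rightarrow> 'b::euclidean_space) \<Rightarrow> ('a \<Rightarrow> 'b) \<Rightarrow> bool" where
  "l2_rel f g \<longleftrightarrow> square_integrable f \<and> square_integrable g \<and> (AE x in lebesgue. f x = g x)"

lemma square_integrable_0: "square_integrable (\<lambda>_. 0)"
  by (simp add: square_integrable_def)

lemma square_integrable_scaleR:
  "square_integrable f \<Longrightarrow> square_integrable (\<lambda>x. c *\<^sub>R f x)"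
  by (auto simp: square_integrable_def power_mult_distrib)

lemma square_integrable_add:
  assumes "square_integrable f" "square_integrable g"
  shows "square_integrable (\<lambda>x. f x + g x)"
proof -
  have m [measurable]: "f \<in> borel_measurable lebesgue" "g \<in> borel_measurable lebesgue"
    using assms by (auto simp: square_integrable_def)
  have "integrable lebesgue (\<lambda>x. (norm (f x + g x))\<^sup>2)"
  proof (rule Bochner_Integration.integrable_bound)
    show "integrable lebesgue (\<lambda>x. 2 * (norm (f x))\<^sup>2 + 2 * (norm (g x))\<^sup>2)"
      using assms by (auto simp: square_integrable_def)
    have "(norm (f x + g x))\<^sup>2 \<le> 2 * (norm (f x))\<^sup>2 + 2 * (norm (g x))\<^sup>2" for x
    proof -
      have "(norm (f x + g x))\<^sup>2 \<le> (norm (f x) + norm (g x))\<^sup>2"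
        by (intro power_mono norm_triangle_ineq) auto
      also have "\<dots> \<le> 2 * (norm (f x))\<^sup>2 + 2 * (norm (g x))\<^sup>2"
        using sum_squares_bound[of "norm (f x)" "norm (g x)"] by (simp add: power2_sum)
      finally show ?thesis .
    qed
    then show "AE x in lebesgue. norm ((norm (f x + g x))\<^sup>2)
        \<le> norm (2 * (norm (f x))\<^sup>2 + 2 * (norm (g x))\<^sup>2)"
      by auto
  qed measurable
  then show ?thesis by (simp add: square_integrable_def)
qed

lemma square_integrable_inner:
  assumes "square_integrable f" "square_integrable g"
  shows "integrable lebesgue (\<lambda>x. f x \<bullet> g x)"
proof -
  have m [measurable]: "f \<in> borel_measurable lebesgue" "g \<in> borel_measurable lebesgue"
    using assms by (auto simp: square_integrable_def)
  show ?thesis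
  proof (rule Bochner_Integration.integrable_bound)
    show "integrable lebesgue (\<lambda>x. (norm (f x))\<^sup>2 + (norm (g x))\<^sup>2)"
      using assms by (auto simp: square_integrable_def)
    have "\<bar>f x \<bullet> g x\<bar> \<le> (norm (f x))\<^sup>2 + (norm (g x))\<^sup>2" for x
    proof -
      have "\<bar>f x \<bullet> g x\<bar> \<le> norm (f x) * norm (g x)"
        by (rule Cauchy_Schwarz_ineq2)
      also have "\<dots> \<le> (norm (f x))\<^sup>2 + (norm (g x))\<^sup>2"
        using sum_squares_bound[of "norm (f x)" "norm (g x)"]
          mult_nonneg_nonneg[OF norm_ge_zero[of "f x"] norm_ge_zero[of "g x"]] by linarith
      finally show ?thesis .
    qed
    then show "AE x in lebesgue. norm (f x \<bullet> g x) \<le> norm ((norm (f x))\<^sup>2 + (norm (g x))\<^sup>2)"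
      by auto
  qed measurable
qed

quotient_type (overloaded) ('a, 'b) l2 = "'a::euclidean_space \<Rightarrow> 'b::euclidean_space" / partial: l2_rel
proof (rule part_equivpI)
  show "\<exists>f::'a \<Rightarrow> 'b. l2_rel f f"
    by (rule exI[of _ "\<lambda>_. 0"]) (simp add: l2_rel_def square_integrable_0)
  show "symp (l2_rel :: ('a \<Rightarrow> 'b) \<Rightarrow> _)"
    by (simp add: symp_def l2_rel_def eq_commute)
  show "transp (l2_rel :: ('a \<Rightarrow> 'b) \<Rightarrow> _)"
    unfolding transp_def l2_rel_def
    by (intro allI impI conjI; elim conjE; (assumption | (erule (1) eventually_elim2, simp)))
qed

instantiation l2 :: (euclidean_space, euclidean_space) real_inner
begin

lift_definition zero_l2 :: "('a, 'b) l2" is "\<lambda>_. 0"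
  by (simp add: l2_rel_def square_integrable_0)

lift_definition plus_l2 :: "('a, 'b) l2 \<Rightarrow> ('a, 'b) l2 \<Rightarrow> ('a, 'b) l2" is "\<lambda>f g x. f x + g x"
  unfolding l2_rel_def
  by (elim conjE, intro conjI square_integrable_add; (assumption | (erule (1) eventually_elim2, simp)))

lift_definition scaleR_l2 :: "real \<Rightarrow> ('a, 'b) l2 \<Rightarrow> ('a, 'b) l2" is "\<lambda>c f x. c *\<^sub>R f x"
  unfolding l2_rel_def
  by (elim conjE, intro conjI square_integrable_scaleR; (assumption | (erule eventually_mono, simp)))

definition uminus_l2 :: "('a, 'b) l2 \<Rightarrow> ('a, 'b) l2" where
  "uminus_l2 v = (- 1) *\<^sub>R v"

definition minus_l2 :: "('a, 'b) l2 \<Rightarrow> ('a, 'b) l2 \<Rightarrow> ('a, 'b) l2" where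
  "minus_l2 v w = v + (- w)"

lift_definition inner_l2 :: "('a, 'b) l2 \<Rightarrow> ('a, 'b) l2 \<Rightarrow> real"
  is "\<lambda>f g. integral\<^sup>L lebesgue (\<lambda>x. f x \<bullet> g x)"
proof -
  fix f f' g g' :: "'a \<Rightarrow> 'b"
  assume "l2_rel f f'" "l2_rel g g'"
  then have "f \<in> borel_measurable lebesgue" "f' \<in> borel_measurable lebesgue"
     "g \<in> borel_measurable lebesgue" "g' \<in> borel_measurable lebesgue"
    and "AE x in lebesgue. f x = f' x" "AE x in lebesgue. g x = g' x"
    by (auto simp: l2_rel_def square_integrable_def)
  then show "(\<integral>x. f x \<bullet> g x \<partial>lebesgue) = (\<integral>x. f' x \<bullet> g' x \<partial>lebesgue)"
    by - (intro integral_cong_AE borel_measurable_inner; (assumption | (erule (1) eventually_elim2, simp)))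
qed

definition norm_l2 :: "('a, 'b) l2 \<Rightarrow> real" where
  "norm_l2 v = sqrt (v \<bullet> v)"

definition sgn_l2 :: "('a, 'b) l2 \<Rightarrow> ('a, 'b) l2" where
  "sgn_l2 v = inverse (norm v) *\<^sub>R v"

definition dist_l2 :: "('a, 'b) l2 \<Rightarrow> ('a, 'b) l2 \<Rightarrow> real" where
  "dist_l2 v w = norm (v - w)"

definition uniformity_l2 :: "(('a, 'b) l2 \<times> ('a, 'b) l2) filter" where
  "uniformity_l2 = (INF e\<in>{0 <..}. principal {(x, y). dist x y < e})"

definition open_l2 :: "('a, 'b) l2 set \<Rightarrow> bool" where
  "open_l2 S = (\<forall>x\<in>S. \<forall>\<^sub>F (x', y) in uniformity. x' = x \<longrightarrow> y \<in> S)"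

instance
proof
  fix a b c :: "('a, 'b) l2" and r s :: real
  show "a + b + c = a + (b + c)"
    by transfer (simp add: l2_rel_def add.assoc square_integrable_add)
  show "a + b = b + a"
    by transfer (simp add: l2_rel_def add.commute square_integrable_add)
  show "0 + a = a"
    by transfer (simp add: l2_rel_def)
  show "- a + a = 0"
    unfolding uminus_l2_def
  proof transfer
    fix f :: "'a \<Rightarrow> 'b"
    assume "l2_rel f f"
    then have "square_integrable (\<lambda>x. (- 1) *\<^sub>R f x + f x)"
      unfolding l2_rel_def by (intro square_integrable_add square_integrable_scaleR) auto
    then show "l2_rel (\<lambda>x. (- 1) *\<^sub>R f x + f x) (\<lambda>_. 0)"
      by (simp add: l2_rel_def square_integrable_0)
  qed
  show "a - b = a + - b"
    by (simp add: minus_l2_def)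
  show "r *\<^sub>R (a + b) = r *\<^sub>R a + r *\<^sub>R b"
    by transfer (simp add: l2_rel_def scaleR_right_distrib square_integrable_add square_integrable_scaleR)
  show "(r + s) *\<^sub>R a = r *\<^sub>R a + s *\<^sub>R a"
    by transfer (simp add: l2_rel_def scaleR_left_distrib square_integrable_add square_integrable_scaleR)
  show "r *\<^sub>R s *\<^sub>R a = (r * s) *\<^sub>R a"
    by transfer (simp add: l2_rel_def square_integrable_scaleR)
  show "1 *\<^sub>R a = a"
    by transfer (simp add: l2_rel_def)
  show "dist a b = norm (a - b)"
    by (simp add: dist_l2_def)
  show "sgn a = inverse (norm a) *\<^sub>R a"
    by (simp add: sgn_l2_def)
  show "uniformity = (INF e\<in>{0 <..}. principal {(x, y). dist x (y :: ('a, 'b) l2) < e})"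
    by (simp add: uniformity_l2_def)
  show "open U = (\<forall>x\<in>U. \<forall>\<^sub>F (x', y) in uniformity. x' = x \<longrightarrow> y \<in> U)" for U :: "('a, 'b) l2 set"
    by (simp add: open_l2_def)
  show "a \<bullet> b = b \<bullet> a"
    by transfer (simp add: inner_commute)
  show "(a + b) \<bullet> c = a \<bullet> c + b \<bullet> c"
    by transfer (simp add: l2_rel_def inner_add_left square_integrable_inner)
  show "(r *\<^sub>R a) \<bullet> b = r * (a \<bullet> b)"
    by transfer simp
  show "0 \<le> a \<bullet> a"
    by transfer simp
  show "(a \<bullet> a = 0) = (a = 0)"
  proof transfer
    fix f :: "'a \<Rightarrow> 'b"
    assume "l2_rel f f"
    then have f: "square_integrable f" by (simp add: l2_rel_def)
    have "(\<integral>x. f x \<bullet> f x \<partial>lebesgue) = 0 \<longleftrightarrow> (AE x in lebesgue. f x \<bullet> f x = 0)"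
      using square_integrable_inner[OF f f] by (intro integral_nonneg_eq_0_iff_AE) auto
    then show "((\<integral>x. f x \<bullet> f x \<partial>lebesgue) = 0) = l2_rel f (\<lambda>_. 0)"
      using f by (simp add: l2_rel_def square_integrable_0)
  qed
  show "norm a = sqrt (a \<bullet> a)"
    by (simp add: norm_l2_def)
qed

end

text \<open>The class of a square-integrable function (unspecified on other functions).\<close>

definition l2_of :: "('a::euclidean_space \<Rightarrow> 'b::euclidean_space) \<Rightarrow> ('a, 'b) l2" where
  "l2_of f = abs_l2 f"

text \<open>
  Functions on \<open>\<Omega>\<close> are identified with their extension by zero to the whole space, so that
  \<open>L\<^sup>2(\<Omega>)\<close> is a closed subspace of the type above, and its inner product and norm are
  the restrictions of those of the type.
\<close>

lift_definition vanishes_outside ::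
  "'a::euclidean_space set \<Rightarrow> ('a, 'b::euclidean_space) l2 \<Rightarrow> bool"
  is "\<lambda>\<Omega> f. AE x in lebesgue. x \<notin> \<Omega> \<longrightarrow> f x = 0"
proof -
  fix \<Omega> :: "'a set" and f g :: "'a \<Rightarrow> 'b"
  assume "l2_rel f g"
  then have "AE x in lebesgue. f x = g x"
    by (simp add: l2_rel_def)
  then have "AE x in lebesgue. (x \<notin> \<Omega> \<longrightarrow> f x = 0) = (x \<notin> \<Omega> \<longrightarrow> g x = 0)"
    by (rule eventually_mono) simp
  then show "(AE x in lebesgue. x \<notin> \<Omega> \<longrightarrow> f x = 0) = (AE x in lebesgue. x \<notin> \<Omega> \<longrightarrow> g x = 0)"
    by (rule eventually_cong[OF _ ]) simp
qed

definition L2_on :: "'a::euclidean_space set \<Rightarrow> ('a, 'b::euclidean_space) l2 set" where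
  "L2_on \<Omega> = {v. vanishes_outside \<Omega> v}"


section \<open>Test functions, weak gradients and Sobolev spaces\<close>

fun Ck_fun :: "nat \<Rightarrow> ('a::euclidean_space \<Rightarrow> real) \<Rightarrow> bool" where
  "Ck_fun 0 \<phi> \<longleftrightarrow> continuous_on UNIV \<phi>"
| "Ck_fun (Suc k) \<phi> \<longleftrightarrow>
     (\<forall>x. \<phi> differentiable (at x)) \<and>
     (\<forall>b\<in>Basis. Ck_fun k (\<lambda>x. frechet_derivative \<phi> (at x) b))"

definition test_functions :: "'a::euclidean_space set \<Rightarrow> ('a \<Rightarrow> real) set" where
  "test_functions \<Omega> = {\<phi>. (\<forall>k. Ck_fun k \<phi>) \<and>
     compact (closure {x. \<phi> x \<noteq> 0}) \<and> closure {x. \<phi> x \<noteq> 0} \<subseteq> \<Omega>}"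

definition classical_grad :: "('a::euclidean_space \<Rightarrow> real) \<Rightarrow> 'a \<Rightarrow> 'a" where
  "classical_grad \<phi> x = (\<Sum>b\<in>Basis. frechet_derivative \<phi> (at x) b *\<^sub>R b)"

definition is_weak_grad ::
  "'a::euclidean_space set \<Rightarrow> ('a, real) l2 \<Rightarrow> ('a, 'a) l2 \<Rightarrow> bool" where
  "is_weak_grad \<Omega> v G \<longleftrightarrow> G \<in> L2_on \<Omega> \<and>
     (\<forall>\<phi>\<in>test_functions \<Omega>. \<forall>b\<in>Basis.
        v \<bullet> l2_of (\<lambda>x. frechet_derivative \<phi> (at x) b) = - (G \<bullet> l2_of (\<lambda>x. \<phi> x *\<^sub>R b)))"

definition grad :: "'a::euclidean_space set \<Rightarrow> ('a, real) l2 \<Rightarrow> ('a, 'a) l2" where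
  "grad \<Omega> v = (THE G. is_weak_grad \<Omega> v G)"

definition H1 :: "'a::euclidean_space set \<Rightarrow> ('a, real) l2 set" where
  "H1 \<Omega> = {v \<in> L2_on \<Omega>. \<exists>G. is_weak_grad \<Omega> v G}"

definition H10 :: "'a::euclidean_space set \<Rightarrow> ('a, real) l2 set" where
  "H10 \<Omega> = {v \<in> H1 \<Omega>. \<exists>\<phi>. (\<forall>n. \<phi> n \<in> test_functions \<Omega>) \<and>
     (\<lambda>n. l2_of (\<phi> n)) \<longlonglongrightarrow> v \<and> (\<lambda>n. l2_of (classical_grad (\<phi> n))) \<longlonglongrightarrow> grad \<Omega> v}"


section \<open>Functions of time\<close>

text \<open>Time derivatives on \<open>[0,\<infinity>)\<close>; at \<open>0\<close> they are one-sided.\<close>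

primrec tderiv :: "nat \<Rightarrow> (real \<Rightarrow> 'v::real_normed_vector) \<Rightarrow> real \<Rightarrow> 'v" where
  "tderiv 0 v = v"
| "tderiv (Suc n) v = (\<lambda>t. vector_derivative (tderiv n v) (at t within {0..}))"

definition C_time :: "nat \<Rightarrow> 'v::real_normed_vector set \<Rightarrow> (real \<Rightarrow> 'v) set" where
  "C_time r Y = {v. (\<forall>t\<ge>0. v t \<in> Y) \<and>
     (\<forall>i<r. \<forall>t\<ge>0. tderiv i v differentiable (at t within {0..})) \<and>
     continuous_on {0..} (tderiv r v)}"

text \<open>
  Since \<open>L\<^sup>2\<close> is separable, Borel measurability below is the same as strong (Bochner)
  measurability.
\<close>

definition Linf_time :: "'v::real_normed_vector set \<Rightarrow> (real \<Rightarrow> 'v) set" where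
  "Linf_time Y = {v. (\<forall>t\<ge>0. v t \<in> Y) \<and> v \<in> borel_measurable (lebesgue_on {0..}) \<and>
     (\<exists>M. AE t in lebesgue_on {0..}. norm (v t) \<le> M)}"

definition L2_time :: "'v::real_normed_vector set \<Rightarrow> (real \<Rightarrow> 'v) set" where
  "L2_time Y = {v. (\<forall>t\<ge>0. v t \<in> Y) \<and> v \<in> borel_measurable (lebesgue_on {0..}) \<and>
     integrable (lebesgue_on {0..}) (\<lambda>t. (norm (v t))\<^sup>2)}"

text \<open>
  The defining identity of the weak time derivative is an equality between elements of the
  Hilbert space; it is expressed by taking inner products with all \<open>y\<close>.
\<close>

definition H1_time :: "'v::real_inner set \<Rightarrow> (real \<Rightarrow> 'v) set" where
  "H1_time Y = {v \<in> L2_time Y. \<exists>g\<in>L2_time Y. \<forall>y. \<forall>\<phi>\<in>test_functions {0<..}.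
     (LINT t|lebesgue_on {0..}. (v t \<bullet> y) * deriv \<phi> t)
       = - (LINT t|lebesgue_on {0..}. (g t \<bullet> y) * \<phi> t)}"

definition Cb_time :: "nat \<Rightarrow> 'v::real_normed_vector set \<Rightarrow> (real \<Rightarrow> 'v) set" where
  "Cb_time r Y = {v \<in> C_time r Y. tderiv r v \<in> Linf_time Y}"

definition C20_time :: "'v::real_normed_vector set \<Rightarrow> (real \<Rightarrow> 'v) set" where
  "C20_time Y = {v \<in> C_time 2 Y. v 0 = 0 \<and> tderiv 1 v 0 = 0}"

definition C0_V :: "'a::euclidean_space set \<Rightarrow> (real \<Rightarrow> ('a, real) l2) set" where
  "C0_V \<Omega> = {v. (\<forall>t\<ge>0. v t \<in> H10 \<Omega>) \<and>
     continuous_on {0..} v \<and> continuous_on {0..} (\<lambda>t. grad \<Omega> (v t))}"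

definition Linf_V :: "'a::euclidean_space set \<Rightarrow> ('a, real) l2 set \<Rightarrow> (real \<Rightarrow> ('a, real) l2) set" where
  "Linf_V \<Omega> W = {v \<in> Linf_time W. (\<lambda>t. grad \<Omega> (v t)) \<in> Linf_time UNIV}"

definition supported_away_from_zero :: "(real \<Rightarrow> 'v::zero) \<Rightarrow> bool" where
  "supported_away_from_zero f \<longleftrightarrow> (\<exists>\<epsilon>>0. \<forall>t. 0 \<le> t \<and> t < \<epsilon> \<longrightarrow> f t = 0)"

definition damped_integral :: "real \<Rightarrow> (real \<Rightarrow> ennreal) \<Rightarrow> ennreal" where
  "damped_integral \<rho> g = (\<integral>\<^sup>+t\<in>{0..}. g t * ennreal (exp (- 2 * \<rho> * t)) \<partial>lborel)"


section \<open>Domain, mesh and finite element space\<close>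

definition lipschitz_boundary :: "'a::euclidean_space set \<Rightarrow> bool" where
  "lipschitz_boundary \<Omega> \<longleftrightarrow> (\<forall>p\<in>frontier \<Omega>. \<exists>N \<nu> \<gamma> L. open N \<and> p \<in> N \<and> norm \<nu> = 1 \<and>
     L-lipschitz_on {y. y \<bullet> \<nu> = 0} (\<gamma> :: 'a \<Rightarrow> real) \<and>
     \<Omega> \<inter> N = {x \<in> N. \<gamma> (x - (x \<bullet> \<nu>) *\<^sub>R \<nu>) < x \<bullet> \<nu>})"

text \<open>In the library a polyhedron is convex; here it is a finite union of polytopes.\<close>

definition lipschitz_polyhedron :: "'a::euclidean_space set \<Rightarrow> bool" where
  "lipschitz_polyhedron \<Omega> \<longleftrightarrow> open \<Omega> \<and> bounded \<Omega> \<and> lipschitz_boundary \<Omega> \<and>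
     (\<exists>\<P>. finite \<P> \<and> (\<forall>P\<in>\<P>. polytope P) \<and> closure \<Omega> = \<Union>\<P>)"

definition simplicial_mesh :: "'a::euclidean_space set \<Rightarrow> 'a set set \<Rightarrow> bool" where
  "simplicial_mesh \<Omega> \<T> \<longleftrightarrow>
     triangulation \<T> \<and> (\<forall>K\<in>\<T>. int DIM('a) simplex K) \<and> \<Union>\<T> = closure \<Omega>"

definition mesh_size :: "'a::euclidean_space set set \<Rightarrow> real" where
  "mesh_size \<T> = Max (diameter ` \<T>)"

definition mesh_size_min :: "'a::euclidean_space set set \<Rightarrow> real" where
  "mesh_size_min \<T> = Min (diameter ` \<T>)"

definition inball_diameter :: "'a::euclidean_space set \<Rightarrow> real" where
  "inball_diameter K = Sup {2 * s | s. 0 \<le> s \<and> (\<exists>x. cball x s \<subseteq> K)}"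

definition shape_regular :: "real \<Rightarrow> 'a::euclidean_space set set \<Rightarrow> bool" where
  "shape_regular \<sigma> \<T> \<longleftrightarrow> (\<forall>K\<in>\<T>. diameter K \<le> \<sigma> * inball_diameter K)"

definition poly_deg_le :: "nat \<Rightarrow> ('a::euclidean_space \<Rightarrow> real) set" where
  "poly_deg_le k = {p. \<exists>c. \<forall>x.
     p x = (\<Sum>m | m \<in> Basis \<rightarrow>\<^sub>E {..k} \<and> (\<Sum>b\<in>Basis. m b) \<le> k. c m * (\<Prod>b\<in>Basis. (x \<bullet> b) ^ m b))}"

text \<open>
  The continuous representative \<open>g\<close> is extended by zero, so the condition outside the open set
  \<open>\<Omega>\<close> includes that \<open>g\<close> vanishes on the boundary.
\<close>

definition fe_space :: "'a::euclidean_space set \<Rightarrow> 'a set set \<Rightarrow> nat \<Rightarrow> ('a, real) l2 set" where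
  "fe_space \<Omega> \<T> k = {v \<in> H10 \<Omega>. \<exists>g. v = l2_of g \<and> continuous_on (closure \<Omega>) g \<and>
     (\<forall>x. x \<notin> \<Omega> \<longrightarrow> g x = 0) \<and> (\<forall>K\<in>\<T>. \<exists>p\<in>poly_deg_le k. \<forall>x\<in>K. g x = p x)}"

definition l2_projection :: "('a::euclidean_space, real) l2 set \<Rightarrow> ('a, real) l2 \<Rightarrow> ('a, real) l2" where
  "l2_projection W \<phi> = (THE p. p \<in> W \<and> (\<forall>v\<in>W. p \<bullet> v = \<phi> \<bullet> v))"

definition m_form ::
  "'a::euclidean_space set \<Rightarrow> real \<Rightarrow> ('a, real) l2 \<Rightarrow> ('a, real) l2 \<Rightarrow> real" where
  "m_form \<Omega> \<tau> v w = v \<bullet> w - \<tau>\<^sup>2 * (grad \<Omega> v \<bullet> grad \<Omega> w)"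

text \<open>
  \<open>c\<close> is an admissible constant in the CFL condition \<open>\<tau> \<le> c h\<^sub>m\<^sub>i\<^sub>n\<close>; it depends on the parameter
  \<open>\<mu>\<^sub>0\<close>, on the shape-regularity \<open>\<sigma>\<close>, on \<open>k\<close> and (through the type argument) on the dimension, but
  not on the individual domain and mesh.
\<close>

definition cfl_constant :: "'a::euclidean_space itself \<Rightarrow> nat \<Rightarrow> real \<Rightarrow> real \<Rightarrow> real \<Rightarrow> bool" where
  "cfl_constant _ k \<sigma> \<mu>\<^sub>0 c \<longleftrightarrow> 0 < c \<and>
     (\<forall>(\<Omega>::'a set) \<T> \<tau>. lipschitz_polyhedron \<Omega> \<and> simplicial_mesh \<Omega> \<T> \<and> shape_regular \<sigma> \<T> \<and>
        0 < \<tau> \<and> \<tau> \<le> c * mesh_size_min \<T> \<longrightarrow>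
        (\<forall>v\<in>fe_space \<Omega> \<T> k. \<mu>\<^sub>0 * (norm v)\<^sup>2 \<le> m_form \<Omega> \<tau> v v \<and> m_form \<Omega> \<tau> v v \<le> (norm v)\<^sup>2))"


section \<open>The wave equation and its leapfrog discretization\<close>

definition wave_solution ::
  "'a::euclidean_space set \<Rightarrow> (real \<Rightarrow> ('a, real) l2) \<Rightarrow> (real \<Rightarrow> ('a, real) l2) \<Rightarrow> bool" where
  "wave_solution \<Omega> f u \<longleftrightarrow> u \<in> C20_time (L2_on \<Omega>) \<and> u \<in> C0_V \<Omega> \<and>
     (\<forall>t\<ge>0. \<forall>v\<in>H10 \<Omega>. tderiv 2 u t \<bullet> v + grad \<Omega> (u t) \<bullet> grad \<Omega> v = f t \<bullet> v)"

definition leapfrog_solution ::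
  "'a::euclidean_space set \<Rightarrow> ('a, real) l2 set \<Rightarrow> real \<Rightarrow> (real \<Rightarrow> ('a, real) l2)
     \<Rightarrow> (nat \<Rightarrow> ('a, real) l2) \<Rightarrow> bool" where
  "leapfrog_solution \<Omega> V\<^sub>h \<tau> f U \<longleftrightarrow> (\<forall>n. U n \<in> V\<^sub>h) \<and> U 0 = 0 \<and> U 1 = 0 \<and>
     (\<forall>n\<ge>1. \<forall>v\<in>V\<^sub>h. (1 / \<tau>\<^sup>2) * ((U (n + 1) - 2 *\<^sub>R U n + U (n - 1)) \<bullet> v)
        + grad \<Omega> (U n) \<bullet> grad \<Omega> v = f (real n * \<tau>) \<bullet> v)"

definition zero_ext :: "(nat \<Rightarrow> 'v::zero) \<Rightarrow> int \<Rightarrow> 'v" where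
  "zero_ext W n = (if n < 0 then 0 else W (nat n))"

text \<open>For \<open>t \<ge> 0\<close>, the index \<open>n\<close> with \<open>t \<in> [n\<tau>, (n+1)\<tau>)\<close> is \<open>\<lfloor>t / \<tau>\<rfloor>\<close>.\<close>

definition recon_R :: "real \<Rightarrow> (nat \<Rightarrow> 'v::real_vector) \<Rightarrow> real \<Rightarrow> 'v" where
  "recon_R \<tau> W t = (let n = \<lfloor>t / \<tau>\<rfloor>; s = t - of_int n * \<tau>; w = zero_ext W in
     w n + (s / (2 * \<tau>)) *\<^sub>R (w (n + 1) - w (n - 1))
     + (s\<^sup>2 / 2 / \<tau>\<^sup>2) *\<^sub>R (w (n + 1) - 2 *\<^sub>R w n + w (n - 1)))"

definition recon_L :: "real \<Rightarrow> (nat \<Rightarrow> 'v::real_vector) \<Rightarrow> real \<Rightarrow> 'v" where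
  "recon_L \<tau> W t = (let n = \<lfloor>t / \<tau>\<rfloor>; s = t - of_int n * \<tau>; w = zero_ext W;
      \<alpha> = (1 / 24) *\<^sub>R (3 *\<^sub>R w (n + 1) + 17 *\<^sub>R w n + 5 *\<^sub>R w (n - 1) - w (n - 2));
      \<beta> = (1 / (12 * \<tau>)) *\<^sub>R (5 *\<^sub>R w (n + 1) + 3 *\<^sub>R w n - 9 *\<^sub>R w (n - 1) + w (n - 2));
      \<gamma> = (1 / \<tau>\<^sup>2) *\<^sub>R (w (n + 1) - 2 *\<^sub>R w n + w (n - 1));
      \<theta> = (1 / (2 * \<tau> ^ 3)) *\<^sub>R (w (n + 2) - 2 *\<^sub>R w (n + 1) + 2 *\<^sub>R w (n - 1) - w (n - 2));
      \<epsilon> = (1 / \<tau> ^ 4) *\<^sub>R (w (n + 2) - 4 *\<^sub>R w (n + 1) + 6 *\<^sub>R w n - 4 *\<^sub>R w (n - 1) + w (n - 2))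
    in \<alpha> + s *\<^sub>R \<beta> + (s\<^sup>2 / 2) *\<^sub>R \<gamma> + (s ^ 3 / 6) *\<^sub>R \<theta> + (s ^ 4 / 24) *\<^sub>R \<epsilon>)"

definition residual ::
  "'a::euclidean_space set \<Rightarrow> (real \<Rightarrow> ('a, real) l2) \<Rightarrow> (real \<Rightarrow> ('a, real) l2)
     \<Rightarrow> real \<Rightarrow> ('a, real) l2 \<Rightarrow> real" where
  "residual \<Omega> f\<^sub>\<tau> w t v = f\<^sub>\<tau> t \<bullet> v - tderiv 2 w t \<bullet> v - grad \<Omega> (w t) \<bullet> grad \<Omega> v"

definition dual_norm :: "'a::euclidean_space set \<Rightarrow> (('a, real) l2 \<Rightarrow> real) \<Rightarrow> ennreal" where
  "dual_norm \<Omega> F = (SUP v\<in>{v \<in> H10 \<Omega>. norm (grad \<Omega> v) = 1}. ennreal \<bar>F v\<bar>)"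

end

theory Submission
  imports Defs
begin

text \<open>
  Write \<open>\<pi>\<close> for the \<open>L\<^sup>2\<close>-projection onto the finite element space \<open>V\<^sub>h\<close> and split a test function as
  \<open>v = \<pi> v + (v - \<pi> v)\<close>. The second time derivative of the quartic reconstruction is the quadratic
  reconstruction of the second differences, so the leapfrog scheme says that the residual of \<open>\<pi> v\<close> is
  \<open>(\<nabla>\<delta>, \<nabla>\<pi> v)\<close>. On \<open>v - \<pi> v\<close> the discrete acceleration vanishes, being in \<open>V\<^sub>h\<close>, and the wave equation
  turns the remaining part into \<open>- (\<eta>, v - \<pi> v) + ((1 - \<pi>) u'', v - \<pi> v) + (\<nabla>e, \<nabla>(v - \<pi> v))\<close>. As \<open>v - \<pi> v\<close>
  is of size \<open>h\<close>, everything is of the required form except \<open>h \<parallel>(1 - \<pi>) u''\<parallel>\<close>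
  (\<open>residual_bound\<close>, \<open>discrete_equation\<close>).

  For that term put \<open>g = (1 - \<pi>) u'\<close>. Since \<open>(1 - \<pi>)\<close> kills the discrete velocity, \<open>\<parallel>g\<parallel> \<le> \<parallel>e'\<parallel>\<close>, and it is
  enough to bound \<open>h \<parallel>g'\<parallel>\<close> by \<open>\<parallel>g\<parallel>\<close> and \<open>h\<^sup>r / \<rho> \<parallel>f\<^sup>(\<^sup>r\<^sup>)\<parallel>\<close> in the damped norm. In frequency this is clear:
  frequencies below \<open>1/h\<close> are controlled by \<open>g\<close>, those above by the smoothness of the source. The proof
  stays in the time domain and replaces the frequency cut-off by backward differences
  \<open>\<Delta>\<^sub>s F t = F t - F (t - s)\<close>. With \<open>m = r - 1\<close>, integrating \<open>\<Delta>\<^sub>s\<^sup>m g'\<close> over \<open>0 \<le> s \<le> h\<close> gives \<open>h g'\<close> plus a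
  combination of the values \<open>g t - g (t - j h)\<close>, whence \<open>derivative_interpolation\<close>. The differences of the
  acceleration obey \<open>\<parallel>\<Delta>\<^sub>s\<^sup>m u''\<parallel> \<le> \<rho>\<^sup>-\<^sup>1 \<parallel>\<Delta>\<^sub>s\<^sup>m f'\<parallel> \<le> s\<^sup>m \<rho>\<^sup>-\<^sup>1 \<parallel>f\<^sup>(\<^sup>r\<^sup>)\<parallel>\<close>: differences of solutions are solutions, the
  damped energy estimate \<open>wave_system_velocity_bound\<close> applies to them, and Fatou's lemma passes from difference
  quotients of the velocity to the acceleration (\<open>wave_system_acceleration_bound\<close>). In this way
  no time derivative of \<open>u\<close> beyond the second one ever occurs.

  The static part of the argument makes the operators meaningful: weak gradients are unique, by the fundamental
  lemma of the calculus of variations, so that \<open>grad\<close> is linear on \<open>H1\<close>; and \<open>V\<^sub>h\<close> is a finite-dimensional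
  subspace, so that \<open>\<pi>\<close> exists and is a linear contraction.
\<close>


section \<open>Damped integrals and backward differences\<close>

abbreviation damped_norm_sq :: "real \<Rightarrow> (real \<Rightarrow> 'v::real_normed_vector) \<Rightarrow> ennreal" where
  "damped_norm_sq \<rho> F \<equiv> damped_integral \<rho> (\<lambda>t. ennreal ((norm (F t))\<^sup>2))"

lemma damped_integral_mono_AE:
  assumes "AE t in lborel. 0 \<le> t \<longrightarrow> a t \<le> b t"
  shows "damped_integral \<rho> a \<le> damped_integral \<rho> b"
  unfolding damped_integral_def
  using assms by (intro nn_integral_mono_AE) (auto elim!: eventually_mono simp: indicator_def mult_right_mono)

lemma damped_integral_cong_AE:
  assumes "AE t in lborel. 0 \<le> t \<longrightarrow> a t = b t"
  shows "damped_integral \<rho> a = damped_integral \<rho> b"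
  using assms by (intro antisym damped_integral_mono_AE) (auto elim: eventually_mono)

lemma damped_integral_add:
  assumes [measurable]: "a \<in> borel_measurable borel" "b \<in> borel_measurable borel"
  shows "damped_integral \<rho> (\<lambda>t. a t + b t) = damped_integral \<rho> a + damped_integral \<rho> b"
  unfolding damped_integral_def by (simp add: distrib_right nn_integral_add)

lemma damped_integral_cmult:
  assumes [measurable]: "a \<in> borel_measurable borel"
  shows "damped_integral \<rho> (\<lambda>t. c * a t) = c * damped_integral \<rho> a"
  unfolding damped_integral_def by (simp add: mult.assoc nn_integral_cmult)

lemma damped_integral_sum:
  assumes "\<And>i. i \<in> I \<Longrightarrow> a i \<in> borel_measurable borel" 
  shows "damped_integral \<rho> (\<lambda>t. \<Sum>i\<in>I. a i t) = (\<Sum>i\<in>I. damped_integral \<rho> (a i))"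
  unfolding damped_integral_def using assms
  by (simp add: sum_distrib_right nn_integral_sum)

text \<open>
  The damping weight decreases in time, so a delay can only make the damped norm smaller.
\<close>

lemma damped_norm_sq_shift_le:
  fixes F :: "real \<Rightarrow> 'v::real_normed_vector"
  assumes s: "0 \<le> s" and rho: "0 \<le> \<rho>" and F: "continuous_on UNIV F" and F0: "\<And>t. t \<le> 0 \<Longrightarrow> F t = 0"
  shows "damped_norm_sq \<rho> (\<lambda>t. F (t - s)) \<le> damped_norm_sq \<rho> F"
proof -
  define G where "G = (\<lambda>t. ennreal ((norm (F t))\<^sup>2) * ennreal (exp (- 2 * \<rho> * t)) * indicator {0..} t)"
  have [measurable]: "(\<lambda>t. (norm (F t))\<^sup>2) \<in> borel_measurable borel"
    using F by (intro borel_measurable_continuous_onI continuous_intros)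
  have "damped_norm_sq \<rho> (\<lambda>t. F (t - s)) \<le> (\<integral>\<^sup>+t. G (- s + 1 * t) \<partial>lborel)"
    unfolding damped_integral_def
  proof (rule nn_integral_mono)
    fix t :: real
    show "ennreal ((norm (F (t - s)))\<^sup>2) * ennreal (exp (- 2 * \<rho> * t)) * indicator {0..} t \<le> G (- s + 1 * t)"
    proof (cases "t \<le> s")
      case True then show ?thesis using F0[of "t - s"] by simp
    next
      case False
      have "exp (- 2 * \<rho> * t) \<le> exp (- 2 * \<rho> * (t - s))"
        using s rho by (simp add: mult_left_mono)
      then show ?thesis using False s
        by (auto simp: G_def indicator_def intro!: mult_left_mono ennreal_leI)
    qed
  qed
  also have "\<dots> = (\<integral>\<^sup>+t. G t \<partial>lborel)"
    using nn_integral_real_affine[of G 1 "-s"] by (simp add: G_def)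
  finally show ?thesis by (simp add: damped_integral_def G_def)
qed

text \<open>
  Cauchy--Schwarz for \<open>\<phi> H = \<integral> \<psi>\<close>. In an incomplete space the vector-valued integral may not exist, so the
  fundamental theorem is applied to the scalar function \<open>\<phi> s \<bullet> \<phi> H\<close>.
\<close>

lemma norm_sq_le_integral_derivative:
  fixes \<phi> \<psi> :: "real \<Rightarrow> 'v::real_inner"
  assumes H: "0 \<le> H" and d: "\<And>s. s \<in> {0..H} \<Longrightarrow> (\<phi> has_vector_derivative \<psi> s) (at s within {0..H})"
    and c: "continuous_on {0..H} \<psi>" and z: "\<phi> 0 = 0"
  shows "ennreal ((norm (\<phi> H))\<^sup>2) \<le> ennreal H * (\<integral>\<^sup>+s\<in>{0..H}. ennreal ((norm (\<psi> s))\<^sup>2) \<partial>lborel)"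
proof (cases "H = 0")
  case True then show ?thesis using z by simp
next
  case False
  then have H0: "0 < H" using H by simp
  define e where "e = \<phi> H"
  have "((\<lambda>s. \<psi> s \<bullet> e) has_integral (\<phi> H \<bullet> e - \<phi> 0 \<bullet> e)) {0..H}"
  proof (rule fundamental_theorem_of_calculus[OF H])
    fix s assume "s \<in> {0..H}"
    from has_derivative_inner_left[OF d[OF this, unfolded has_vector_derivative_def], of e]
    show "((\<lambda>s. \<phi> s \<bullet> e) has_vector_derivative \<psi> s \<bullet> e) (at s within {0..H})"
      by (simp add: has_vector_derivative_def inner_scaleR_left)
  qed
  then have I1: "((\<lambda>s. \<psi> s \<bullet> e) has_integral (norm e)\<^sup>2) {0..H}"
    by (simp add: z e_def power2_norm_eq_inner)
  define K where "K = integral {0..H} (\<lambda>s. (norm (\<psi> s))\<^sup>2)"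
  have I2: "((\<lambda>s. (norm (\<psi> s))\<^sup>2) has_integral K) {0..H}"
    unfolding K_def using c by (intro integrable_integral integrable_continuous_interval continuous_intros)
  have I3: "((\<lambda>s. (H * (norm (\<psi> s))\<^sup>2 + (norm e)\<^sup>2 / H) / 2) has_integral (H * K + (norm e)\<^sup>2 / H * H) / 2) {0..H}"
    using has_integral_divide[OF has_integral_add[OF has_integral_mult_right[OF I2, of H] has_integral_const_real[of "(norm e)\<^sup>2 / H" 0 H]], of 2]
    H0 by (simp add: mult.commute)
  have "(norm e)\<^sup>2 \<le> (H * K + (norm e)\<^sup>2 / H * H) / 2"
  proof (rule has_integral_le[OF I1 I3])
    fix s
    have "\<psi> s \<bullet> e \<le> norm (\<psi> s) * norm e" by (rule norm_cauchy_schwarz)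
    also have "\<dots> \<le> (H * (norm (\<psi> s))\<^sup>2 + (norm e)\<^sup>2 / H) / 2"
      using H0 sum_squares_bound[of "H * norm (\<psi> s)" "norm e"]
      by (simp add: field_simps power2_eq_square)
    finally show "\<psi> s \<bullet> e \<le> (H * (norm (\<psi> s))\<^sup>2 + (norm e)\<^sup>2 / H) / 2" .
  qed
  then have le: "(norm e)\<^sup>2 \<le> H * K" using H0 by simp
  have "(\<integral>\<^sup>+s\<in>{0..H}. ennreal ((norm (\<psi> s))\<^sup>2) \<partial>lborel) = ennreal K"
    by (rule nn_integral_has_integral_lebesgue'[OF _ I2]) simp
  then show ?thesis using le H by (simp add: e_def ennreal_mult' [symmetric] ennreal_leI)
qed

text \<open>
  Tonelli: a pointwise bound of \<open>X\<close> by an average of the family \<open>Y s\<close> over a window of length \<open>H\<close>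
  becomes a bound between the damped norms.
\<close>

lemma damped_norm_sq_average:
  fixes Y :: "real \<Rightarrow> real \<Rightarrow> 'v::real_normed_vector" and X :: "real \<Rightarrow> 'w::real_normed_vector"
  assumes H: "0 \<le> H" and cont: "continuous_on UNIV (\<lambda>(s, t). Y s t)"
    and le: "\<And>t. 0 \<le> t \<Longrightarrow> ennreal ((norm (X t))\<^sup>2) \<le> ennreal H * (\<integral>\<^sup>+s\<in>{0..H}. ennreal ((norm (Y s t))\<^sup>2) \<partial>lborel)"
    and B: "\<And>s. s \<in> {0..H} \<Longrightarrow> damped_norm_sq \<rho> (Y s) \<le> B"
  shows "damped_norm_sq \<rho> X \<le> ennreal (H\<^sup>2) * B"
proof -
  have "(\<lambda>x. (norm (case x of (s, t) \<Rightarrow> Y s t))\<^sup>2) \<in> borel_measurable borel"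
    using cont by (intro borel_measurable_continuous_onI continuous_intros)
  then have [measurable]: "(\<lambda>(s,t). (norm (Y s t))\<^sup>2) \<in> borel_measurable (borel \<Otimes>\<^sub>M borel)"
    by (simp add: borel_prod split_beta')
  have "damped_norm_sq \<rho> X \<le> damped_integral \<rho> (\<lambda>t. ennreal H * (\<integral>\<^sup>+s\<in>{0..H}. ennreal ((norm (Y s t))\<^sup>2) \<partial>lborel))"
    using le by (intro damped_integral_mono_AE) auto
  also have "\<dots> = ennreal H * damped_integral \<rho> (\<lambda>t. (\<integral>\<^sup>+s\<in>{0..H}. ennreal ((norm (Y s t))\<^sup>2) \<partial>lborel))"
    by (rule damped_integral_cmult) measurable
  also have "damped_integral \<rho> (\<lambda>t. (\<integral>\<^sup>+s\<in>{0..H}. ennreal ((norm (Y s t))\<^sup>2) \<partial>lborel))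
    = (\<integral>\<^sup>+t. \<integral>\<^sup>+s. ennreal ((norm (Y s t))\<^sup>2) * indicator {0..H} s * (ennreal (exp (- 2 * \<rho> * t)) * indicator {0..} t) \<partial>lborel \<partial>lborel)"
    unfolding damped_integral_def
    by (intro nn_integral_cong, subst nn_integral_multc) (simp_all add: mult.assoc)
  also have "\<dots> = (\<integral>\<^sup>+s. \<integral>\<^sup>+t. ennreal ((norm (Y s t))\<^sup>2) * indicator {0..H} s * (ennreal (exp (- 2 * \<rho> * t)) * indicator {0..} t) \<partial>lborel \<partial>lborel)"
    by (rule lborel_pair.Fubini') measurable
  also have "\<dots> = (\<integral>\<^sup>+s. indicator {0..H} s * damped_norm_sq \<rho> (Y s) \<partial>lborel)"
    unfolding damped_integral_def 
    by (subst nn_integral_cmult[symmetric], measurable) (simp add: mult_ac)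
  also have "\<dots> \<le> (\<integral>\<^sup>+s. B * indicator {0..H} s \<partial>lborel)"
    using B by (intro nn_integral_mono) (auto simp: indicator_def)
  also have "\<dots> = B * ennreal H" using H by (simp add: nn_integral_cmult)
  finally have "damped_norm_sq \<rho> X \<le> ennreal H * (B * ennreal H)" by (simp add: mult_left_mono)
  then show ?thesis using H by (simp add: power2_eq_square ennreal_mult mult_ac)
qed

definition backward_diff :: "real \<Rightarrow> (real \<Rightarrow> 'v::real_vector) \<Rightarrow> real \<Rightarrow> 'v" where
  "backward_diff s F = (\<lambda>t. F t - F (t - s))"

lemma continuous_on_shift:
  fixes F :: "real \<Rightarrow> 'v::topological_space"
  assumes "continuous_on UNIV F" shows "continuous_on UNIV (\<lambda>t. F (t - s))"
  by (rule continuous_on_compose2[OF assms]) (auto intro!: continuous_intros)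

lemma has_vector_derivative_shift:
  fixes F :: "real \<Rightarrow> 'v::real_normed_vector"
  assumes "(F has_vector_derivative F1 (t - s)) (at (t - s))"
  shows "((\<lambda>t. F (t - s)) has_vector_derivative F1 (t - s)) (at t)"
proof -
  have "((\<lambda>t. t - s) has_vector_derivative 1) (at t)"
    by (auto intro!: derivative_eq_intros)
  from vector_diff_chain_at[OF this assms] show ?thesis by (simp add: o_def)
qed

text \<open>
  The difference is the integral of the derivative over a window of length \<open>s\<close>.
\<close>

lemma damped_norm_sq_backward_diff:
  fixes F F1 :: "real \<Rightarrow> 'v::real_inner"
  assumes s: "0 \<le> s" and rho: "0 \<le> \<rho>" and d: "\<And>t. (F has_vector_derivative F1 t) (at t)"
    and c: "continuous_on UNIV F1" and z: "\<And>t. t \<le> 0 \<Longrightarrow> F1 t = 0"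
  shows "damped_norm_sq \<rho> (backward_diff s F) \<le> ennreal (s\<^sup>2) * damped_norm_sq \<rho> F1"
proof (rule damped_norm_sq_average[where Y = "\<lambda>s t. F1 (t - s)", OF s])
  show "continuous_on UNIV (\<lambda>(s, t). F1 (t - s))"
    unfolding split_beta by (rule continuous_on_compose2[OF c]) (auto intro!: continuous_intros)
  show "damped_norm_sq \<rho> (\<lambda>t. F1 (t - \<sigma>)) \<le> damped_norm_sq \<rho> F1" if "\<sigma> \<in> {0..s}" for \<sigma>
    using that by (intro damped_norm_sq_shift_le[OF _ rho c z]) auto
  fix t :: real
  have "((\<lambda>\<sigma>. F t - F (t - \<sigma>)) has_vector_derivative F1 (t - \<sigma>)) (at \<sigma>)" for \<sigma>
  proof -
    have "((\<lambda>\<sigma>. t - \<sigma>) has_vector_derivative -1) (at \<sigma>)"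
      by (auto intro!: derivative_eq_intros)
    from vector_diff_chain_at[OF this d] have "((\<lambda>\<sigma>. F (t - \<sigma>)) has_vector_derivative - F1 (t - \<sigma>)) (at \<sigma>)"
      by (simp add: o_def)
    from has_vector_derivative_diff[OF has_vector_derivative_const this] show ?thesis by simp
  qed
  then show "ennreal ((norm (backward_diff s F t))\<^sup>2) \<le> ennreal s * (\<integral>\<^sup>+\<sigma>\<in>{0..s}. ennreal ((norm (F1 (t - \<sigma>)))\<^sup>2) \<partial>lborel)"
    unfolding backward_diff_def using s
    by (intro norm_sq_le_integral_derivative[of s "\<lambda>\<sigma>. F t - F (t - \<sigma>)"])
       (auto intro: has_vector_derivative_at_within intro!: continuous_on_compose2[OF c] continuous_intros)
qed


section \<open>Energy estimates for an abstract wave equation\<close>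

lemma has_vector_derivative_quotient_tendsto:
  fixes f :: "real \<Rightarrow> 'v::real_normed_vector"
  assumes "(f has_vector_derivative D) (at x within S)"
  shows "((\<lambda>y. (f y - f x) /\<^sub>R (y - x)) \<longlongrightarrow> D) (at x within S)"
proof -
  have "((\<lambda>y. norm ((f y - f x) - (y - x) *\<^sub>R D) / norm (y - x)) \<longlongrightarrow> 0) (at x within S)"
    using assms unfolding has_vector_derivative_def has_derivative_iff_norm by blast
  moreover have "\<forall>\<^sub>F y in at x within S. norm ((f y - f x) - (y - x) *\<^sub>R D) / norm (y - x)
      = norm ((f y - f x) /\<^sub>R (y - x) - D)"
    unfolding eventually_at_topological
  proof (intro exI[of _ UNIV] conjI ballI impI; simp?)
    fix y assume "y \<noteq> x"
    then have "(f y - f x) /\<^sub>R (y - x) - D = ((f y - f x) - (y - x) *\<^sub>R D) /\<^sub>R (y - x)"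
      by (simp add: scaleR_diff_right)
    then show "norm ((f y - f x) - (y - x) *\<^sub>R D) / \<bar>y - x\<bar> = norm ((f y - f x) /\<^sub>R (y - x) - D)"
      by (simp add: divide_inverse mult.commute)
  qed
  ultimately have "((\<lambda>y. norm ((f y - f x) /\<^sub>R (y - x) - D)) \<longlongrightarrow> 0) (at x within S)"
    by (rule Lim_transform_eventually)
  then show ?thesis by (simp add: tendsto_norm_zero_iff LIM_zero_iff)
qed

text \<open>
  The velocity is not an admissible test function, since \<open>z1 t\<close> has no gradient in general. Instead, the
  sum of the equations at two times \<open>y\<close> and \<open>t\<close> is tested with the increment \<open>z y - z t\<close>, which gives the
  increment of \<open>\<parallel>P\<parallel>\<^sup>2\<close> exactly; dividing by \<open>y - t\<close> shows that the potential energy is differentiable. Here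
  and below \<open>P\<close> stands for the gradient of \<open>z\<close>; all that is used of it is the bilinear identity \<open>eq\<close> between two
  arbitrary times.
\<close>

lemma energy_has_derivative:
  fixes z z1 z2 F :: "real \<Rightarrow> 'v::real_inner" and P :: "real \<Rightarrow> 'w::real_inner"
  assumes dz: "\<And>t. t \<in> S \<Longrightarrow> (z has_vector_derivative z1 t) (at t within S)"
    and dz1: "\<And>t. t \<in> S \<Longrightarrow> (z1 has_vector_derivative z2 t) (at t within S)"
    and cz2: "continuous_on S z2" and cF: "continuous_on S F"
    and eq: "\<And>t t'. t \<in> S \<Longrightarrow> t' \<in> S \<Longrightarrow> z2 t \<bullet> z t' + P t \<bullet> P t' = F t \<bullet> z t'"
    and t: "t \<in> S"
  shows "((\<lambda>t. (norm (z1 t))\<^sup>2 + (norm (P t))\<^sup>2) has_real_derivative 2 * (F t \<bullet> z1 t)) (at t within S)"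
proof -
  let ?q = "\<lambda>y. ((F y + F t) - (z2 y + z2 t)) \<bullet> ((z y - z t) /\<^sub>R (y - t))"
  have "(?q \<longlongrightarrow> ((F t + F t) - (z2 t + z2 t)) \<bullet> z1 t) (at t within S)"
    using cF cz2 t by (intro tendsto_intros has_vector_derivative_quotient_tendsto dz)
      (auto simp: continuous_on)
  moreover have "\<forall>\<^sub>F y in at t within S. ?q y = ((norm (P y))\<^sup>2 - (norm (P t))\<^sup>2) / (y - t)"
    unfolding eventually_at_topological
  proof (intro exI[of _ UNIV] conjI ballI impI; simp?)
    fix y assume y: "y \<noteq> t" "y \<in> S"
    \<comment> \<open>the sum of the equations at \<open>y\<close> and \<open>t\<close>, tested with \<open>z y - z t\<close>\<close>
    have "((F y + F t) - (z2 y + z2 t)) \<bullet> (z y - z t) = (norm (P y))\<^sup>2 - (norm (P t))\<^sup>2"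
      using eq[OF y(2) y(2)] eq[OF y(2) t] eq[OF t y(2)] eq[OF t t]
      by (simp add: power2_norm_eq_inner inner_commute[of "P y" "P t"] algebra_simps)
    then show "inverse (y - t) * (((F y + F t) - (z2 y + z2 t)) \<bullet> (z y - z t)) = ((norm (P y))\<^sup>2 - (norm (P t))\<^sup>2) / (y - t)"
      by (simp add: divide_inverse mult.commute)
  qed
  ultimately have "((\<lambda>y. ((norm (P y))\<^sup>2 - (norm (P t))\<^sup>2) / (y - t)) \<longlongrightarrow> ((F t + F t) - (z2 t + z2 t)) \<bullet> z1 t) (at t within S)"
    by (rule Lim_transform_eventually)
  then have dP: "((\<lambda>y. (norm (P y))\<^sup>2) has_real_derivative ((F t + F t) - (z2 t + z2 t)) \<bullet> z1 t) (at t within S)"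
    by (simp add: has_field_derivative_iff)
  have dz1': "((\<lambda>y. (norm (z1 y))\<^sup>2) has_real_derivative 2 * (z2 t \<bullet> z1 t)) (at t within S)"
    unfolding has_field_derivative_def power2_norm_eq_inner
    by (rule has_derivative_eq_rhs[OF has_derivative_inner[OF dz1[OF t, unfolded has_vector_derivative_def]
          dz1[OF t, unfolded has_vector_derivative_def]]]) (auto simp: fun_eq_iff inner_commute)
  from DERIV_add[OF dz1' dP] show ?thesis
    by (simp add: algebra_simps inner_simps)
qed

text \<open>
  Integrating the derivative of the energy times \<open>exp (- 2 \<rho> t)\<close>: the damping produces the good term
  \<open>2 \<rho>\<close> times the energy, half of which absorbs the velocity in the work of the source.
\<close>

lemma weighted_energy_bound:
  fixes z z1 z2 F :: "real \<Rightarrow> 'v::real_inner" and P :: "real \<Rightarrow> 'w::real_inner"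
  assumes dz: "\<And>t. t \<in> {0..T} \<Longrightarrow> (z has_vector_derivative z1 t) (at t within {0..T})"
    and dz1: "\<And>t. t \<in> {0..T} \<Longrightarrow> (z1 has_vector_derivative z2 t) (at t within {0..T})"
    and cz2: "continuous_on {0..T} z2" and cF: "continuous_on {0..T} F"
    and eq: "\<And>t t'. t \<in> {0..T} \<Longrightarrow> t' \<in> {0..T} \<Longrightarrow> z2 t \<bullet> z t' + P t \<bullet> P t' = F t \<bullet> z t'"
    and init: "z1 0 = 0" "P 0 = 0" and T: "0 \<le> T" and rho: "0 < \<rho>"
  shows "((norm (z1 T))\<^sup>2 + (norm (P T))\<^sup>2) * exp (- 2 * \<rho> * T)
      + \<rho> * integral {0..T} (\<lambda>t. (norm (z1 t))\<^sup>2 * exp (- 2 * \<rho> * t))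
    \<le> (1 / \<rho>) * integral {0..T} (\<lambda>t. (norm (F t))\<^sup>2 * exp (- 2 * \<rho> * t))"
proof -
  define E where "E = (\<lambda>t. (norm (z1 t))\<^sup>2 + (norm (P t))\<^sup>2)"
  define D where "D = (\<lambda>t. (2 * (F t \<bullet> z1 t) - 2 * \<rho> * E t) * exp (- 2 * \<rho> * t))"
  have dE: "(E has_real_derivative 2 * (F t \<bullet> z1 t)) (at t within {0..T})" if "t \<in> {0..T}" for t
    unfolding E_def by (rule energy_has_derivative[OF dz dz1 cz2 cF eq that])
  have I: "(D has_integral (E T * exp (- 2 * \<rho> * T) - E 0 * exp (- 2 * \<rho> * 0))) {0..T}"
  proof (rule fundamental_theorem_of_calculus[OF T])
    fix t assume t: "t \<in> {0..T}"
    have "((\<lambda>t. exp (- 2 * \<rho> * t)) has_real_derivative - 2 * \<rho> * exp (- 2 * \<rho> * t)) (at t within {0..T})"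
      by (auto intro!: derivative_eq_intros)
    from DERIV_mult[OF dE[OF t] this]
    have "((\<lambda>t. E t * exp (- 2 * \<rho> * t)) has_real_derivative D t) (at t within {0..T})"
      by (rule DERIV_cong) (simp add: D_def algebra_simps)
    then show "((\<lambda>t. E t * exp (- 2 * \<rho> * t)) has_vector_derivative D t) (at t within {0..T})"
      by (simp add: has_real_derivative_iff_has_vector_derivative)
  qed
  have cz1: "continuous_on {0..T} z1"
    unfolding continuous_on_eq_continuous_within using dz1 has_vector_derivative_continuous by blast
  define A where "A = integral {0..T} (\<lambda>t. (norm (z1 t))\<^sup>2 * exp (- 2 * \<rho> * t))"
  define B where "B = integral {0..T} (\<lambda>t. (norm (F t))\<^sup>2 * exp (- 2 * \<rho> * t))"
  have IA: "((\<lambda>t. (norm (z1 t))\<^sup>2 * exp (- 2 * \<rho> * t)) has_integral A) {0..T}"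
    unfolding A_def using cz1 by (intro integrable_integral integrable_continuous_interval continuous_intros)
  have IB: "((\<lambda>t. (norm (F t))\<^sup>2 * exp (- 2 * \<rho> * t)) has_integral B) {0..T}"
    unfolding B_def using cF by (intro integrable_integral integrable_continuous_interval continuous_intros)
  have "E T * exp (- 2 * \<rho> * T) - E 0 * exp (- 2 * \<rho> * 0) \<le> (1 / \<rho>) * B - \<rho> * A"
  proof (rule has_integral_le[OF I has_integral_diff[OF has_integral_mult_right[OF IB] has_integral_mult_right[OF IA]]])
    fix t
    \<comment> \<open>Young: \<open>2 F\<cdot>z1 \<le> |F|^2/\<rho> + \<rho> |z1|^2\<close>\<close>
    have "F t \<bullet> z1 t \<le> norm (F t) * norm (z1 t)" by (rule norm_cauchy_schwarz)
    moreover have "2 * (norm (F t) * norm (z1 t)) \<le> (norm (F t))\<^sup>2 / \<rho> + \<rho> * (norm (z1 t))\<^sup>2"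
      using sum_squares_bound[of "norm (F t)" "\<rho> * norm (z1 t)"] rho
      by (simp add: field_simps power2_eq_square)
    moreover have "\<rho> * (norm (z1 t))\<^sup>2 \<le> \<rho> * E t" using rho by (simp add: E_def)
    ultimately have "2 * (F t \<bullet> z1 t) - 2 * \<rho> * E t \<le> (norm (F t))\<^sup>2 / \<rho> - \<rho> * (norm (z1 t))\<^sup>2"
      by linarith
    then have "D t \<le> ((norm (F t))\<^sup>2 / \<rho> - \<rho> * (norm (z1 t))\<^sup>2) * exp (- 2 * \<rho> * t)"
      unfolding D_def by (rule mult_right_mono) simp
    then show "D t \<le> 1 / \<rho> * ((norm (F t))\<^sup>2 * exp (- 2 * \<rho> * t)) - \<rho> * ((norm (z1 t))\<^sup>2 * exp (- 2 * \<rho> * t))"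
      by (simp add: algebra_simps)
  qed
  then show ?thesis using init by (simp add: E_def A_def B_def)
qed

text \<open>
  A solution on the whole time axis that vanishes for negative times, so that delays of it are again solutions.
  The equation couples two times \<open>t\<close> and \<open>t'\<close>; as it is bilinear in the values at these times, it passes to
  differences of a solution.
\<close>

definition wave_system ::
  "(real \<Rightarrow> 'v::real_inner) \<Rightarrow> (real \<Rightarrow> 'v) \<Rightarrow> (real \<Rightarrow> 'v) \<Rightarrow> (real \<Rightarrow> 'w::real_inner) \<Rightarrow> (real \<Rightarrow> 'v) \<Rightarrow> bool" where
  "wave_system z z1 z2 P F \<longleftrightarrow>
     (\<forall>t. (z has_vector_derivative z1 t) (at t)) \<and> (\<forall>t. (z1 has_vector_derivative z2 t) (at t)) \<and>
     continuous_on UNIV z2 \<and> continuous_on UNIV F \<and>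
     (\<forall>t t'. z2 t \<bullet> z t' + P t \<bullet> P t' = F t \<bullet> z t') \<and>
     (\<forall>t\<le>0. z t = 0 \<and> z1 t = 0 \<and> z2 t = 0 \<and> P t = 0 \<and> F t = 0)"

lemma continuous_on_backward_diff:
  fixes F :: "real \<Rightarrow> 'v::real_normed_vector"
  assumes "continuous_on UNIV F" shows "continuous_on UNIV (backward_diff s F)"
  unfolding backward_diff_def using assms continuous_on_shift[OF assms] by (intro continuous_intros)

lemma has_vector_derivative_backward_diff:
  fixes F :: "real \<Rightarrow> 'v::real_normed_vector"
  assumes "\<And>t. (F has_vector_derivative F1 t) (at t)"
  shows "(backward_diff s F has_vector_derivative backward_diff s F1 t) (at t)"
  unfolding backward_diff_def
  by (intro has_vector_derivative_diff assms has_vector_derivative_shift)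

text \<open>
  The identity for the differences is the combination of the four identities at the times \<open>t\<close>, \<open>t - s\<close> and
  \<open>t'\<close>, \<open>t' - s\<close>.
\<close>

lemma wave_system_backward_diff:
  assumes w: "wave_system z z1 z2 P F" and s: "0 \<le> s"
  shows "wave_system (backward_diff s z) (backward_diff s z1) (backward_diff s z2) (backward_diff s P) (backward_diff s F)"
proof -
  have eq: "z2 t \<bullet> z t' + P t \<bullet> P t' = F t \<bullet> z t'" for t t' using w by (auto simp: wave_system_def)
  have "backward_diff s z2 t \<bullet> backward_diff s z t' + backward_diff s P t \<bullet> backward_diff s P t'
      = backward_diff s F t \<bullet> backward_diff s z t'" for t t'
    using eq[of t t'] eq[of "t - s" t'] eq[of t "t' - s"] eq[of "t - s" "t' - s"]
    by (simp add: backward_diff_def inner_diff_left inner_diff_right)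
  moreover have "\<forall>t\<le>0. backward_diff s z t = 0 \<and> backward_diff s z1 t = 0 \<and> backward_diff s z2 t = 0 
      \<and> backward_diff s P t = 0 \<and> backward_diff s F t = 0"
    using w s by (auto simp: wave_system_def backward_diff_def)
  moreover have "(backward_diff s z has_vector_derivative backward_diff s z1 t) (at t)"
    "(backward_diff s z1 has_vector_derivative backward_diff s z2 t) (at t)" for t
    using w by (simp_all add: wave_system_def has_vector_derivative_backward_diff)
  moreover have "continuous_on UNIV (backward_diff s z2)" "continuous_on UNIV (backward_diff s F)"
    using w by (simp_all add: wave_system_def continuous_on_backward_diff)
  ultimately show ?thesis unfolding wave_system_def by blast
qed

lemma damped_integral_bounded_horizon:
  assumes [measurable]: "g \<in> borel_measurable borel"
    and "\<And>N::nat. (\<integral>\<^sup>+t\<in>{0..real N}. g t * ennreal (exp (- 2 * \<rho> * t)) \<partial>lborel) \<le> B"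
  shows "damped_integral \<rho> g \<le> B"
proof -
  have "(SUP N::nat. \<integral>\<^sup>+t\<in>{0..real N}. g t * ennreal (exp (- 2 * \<rho> * t)) \<partial>lborel)
    = (\<integral>\<^sup>+t. (SUP N::nat. g t * ennreal (exp (- 2 * \<rho> * t)) * indicator {0..real N} t) \<partial>lborel)"
    by (rule nn_integral_monotone_convergence_SUP[symmetric])
       (auto simp: incseq_def le_fun_def split: split_indicator)
  also have "\<dots> = damped_integral \<rho> g"
    unfolding damped_integral_def
  proof (rule nn_integral_cong)
    fix t :: real
    show "(SUP N::nat. g t * ennreal (exp (- 2 * \<rho> * t)) * indicator {0..real N} t)
      = g t * ennreal (exp (- 2 * \<rho> * t)) * indicator {0..} t"
    proof (rule antisym)
      show "(SUP N::nat. g t * ennreal (exp (- 2 * \<rho> * t)) * indicator {0..real N} t)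
        \<le> g t * ennreal (exp (- 2 * \<rho> * t)) * indicator {0..} t"
        by (rule SUP_least) (auto simp: indicator_def)
      obtain N :: nat where "t \<le> real N" using real_arch_simple by blast
      then show "g t * ennreal (exp (- 2 * \<rho> * t)) * indicator {0..} t
        \<le> (SUP N::nat. g t * ennreal (exp (- 2 * \<rho> * t)) * indicator {0..real N} t)"
        by (intro SUP_upper2[of N]) (auto simp: indicator_def)
    qed
  qed
  finally have e: "damped_integral \<rho> g = (SUP N::nat. \<integral>\<^sup>+t\<in>{0..real N}. g t * ennreal (exp (- 2 * \<rho> * t)) \<partial>lborel)" ..
  show ?thesis unfolding e by (rule SUP_least) (rule assms(2))
qed

lemma wave_system_velocity_bound:
  assumes w: "wave_system z z1 z2 P F" and rho: "0 < \<rho>"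
  shows "damped_norm_sq \<rho> z1 \<le> ennreal (1 / \<rho>\<^sup>2) * damped_norm_sq \<rho> F"
proof (rule damped_integral_bounded_horizon)
  have d: "\<And>t. (z has_vector_derivative z1 t) (at t)" "\<And>t. (z1 has_vector_derivative z2 t) (at t)"
    "continuous_on UNIV z2" "continuous_on UNIV F"
    "\<And>t t'. z2 t \<bullet> z t' + P t \<bullet> P t' = F t \<bullet> z t'" "z1 0 = 0" "P 0 = 0"
    using w by (auto simp: wave_system_def)
  have c1: "continuous_on UNIV z1" using d(2) by (intro continuous_at_imp_continuous_on ballI has_vector_derivative_continuous) auto
  then have c1': "continuous_on UNIV (\<lambda>t. (norm (z1 t))\<^sup>2)" by (intro continuous_intros)
  show "(\<lambda>t. ennreal ((norm (z1 t))\<^sup>2)) \<in> borel_measurable borel"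
    using borel_measurable_continuous_onI[OF c1'] by measurable
  fix N :: nat
  let ?I = "\<lambda>G. integral {0..real N} (\<lambda>t. (norm (G t))\<^sup>2 * exp (- 2 * \<rho> * t))"
  have conv: "(\<integral>\<^sup>+t\<in>{0..real N}. ennreal ((norm (G t))\<^sup>2) * ennreal (exp (- 2 * \<rho> * t)) \<partial>lborel) = ennreal (?I G)"
    if "continuous_on UNIV G" for G :: "real \<Rightarrow> 'a"
  proof -
    have "((\<lambda>t. (norm (G t))\<^sup>2 * exp (- 2 * \<rho> * t)) has_integral ?I G) {0..real N}"
      by (intro integrable_integral integrable_continuous_interval continuous_intros continuous_on_subset[OF that]) auto
    from nn_integral_has_integral_lebesgue'[OF _ this] show ?thesis
      by (simp add: ennreal_mult)
  qed
  have "((norm (z1 N))\<^sup>2 + (norm (P N))\<^sup>2) * exp (- 2 * \<rho> * N) + \<rho> * ?I z1 \<le> (1 / \<rho>) * ?I F"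
    by (rule weighted_energy_bound[of N z z1 z2 F P])
       (use d rho in \<open>auto intro: has_vector_derivative_at_within continuous_on_subset\<close>)
  then have "\<rho> * ?I z1 \<le> (1 / \<rho>) * ?I F"
    by (smt (verit) exp_ge_zero mult_nonneg_nonneg zero_le_power2)
  then have "?I z1 \<le> (1 / \<rho>\<^sup>2) * ?I F"
    using rho by (simp add: field_simps power2_eq_square)
  then have "ennreal (?I z1) \<le> ennreal (1 / \<rho>\<^sup>2) * ennreal (?I F)"
    by (simp add: ennreal_mult'[symmetric] ennreal_leI)
  also have "ennreal (?I F) \<le> damped_norm_sq \<rho> F"
    unfolding conv[OF d(4), symmetric] damped_integral_def
    by (intro nn_integral_mono) (auto simp: indicator_def)
  finally show "(\<integral>\<^sup>+t\<in>{0..real N}. ennreal ((norm (z1 t))\<^sup>2) * ennreal (exp (- 2 * \<rho> * t)) \<partial>lborel)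
      \<le> ennreal (1 / \<rho>\<^sup>2) * damped_norm_sq \<rho> F"
    unfolding conv[OF c1] by (simp add: mult_left_mono)
qed


section \<open>Interpolation between velocity and source\<close>

text \<open>
  The velocity bound for the difference quotients of the system, and Fatou's lemma as the step tends to \<open>0\<close>.
  A third time derivative of \<open>z\<close>, which need not exist, is avoided.
\<close>

lemma wave_system_acceleration_bound:
  assumes w: "wave_system z z1 z2 P F" and rho: "0 < \<rho>"
    and dF: "\<And>t. (F has_vector_derivative F1 t) (at t)"
    and cF1: "continuous_on UNIV F1" and F1: "\<And>t. t \<le> 0 \<Longrightarrow> F1 t = 0"
  shows "damped_norm_sq \<rho> z2 \<le> ennreal (1 / \<rho>\<^sup>2) * damped_norm_sq \<rho> F1"
proof -
  define a :: "nat \<Rightarrow> real" where "a n = inverse (real (Suc n))" for n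
  have a0: "0 < a n" for n by (simp add: a_def)
  have dz1: "(z1 has_vector_derivative z2 t) (at t)" for t using w by (simp add: wave_system_def)
  have "continuous_on UNIV z1"
    by (intro continuous_at_imp_continuous_on ballI has_vector_derivative_continuous[OF dz1])
  then have c: "continuous_on UNIV (\<lambda>t. (norm (backward_diff (a n) z1 t))\<^sup>2)" for n
    by (intro continuous_intros continuous_on_backward_diff)
  have m [measurable]: "(\<lambda>t. (norm (backward_diff (a n) z1 t))\<^sup>2) \<in> borel_measurable borel" for n
    by (rule borel_measurable_continuous_onI[OF c])
  have bound: "damped_integral \<rho> (\<lambda>t. ennreal ((1 / a n)\<^sup>2) * ennreal ((norm (backward_diff (a n) z1 t))\<^sup>2))
      \<le> ennreal (1 / \<rho>\<^sup>2) * damped_norm_sq \<rho> F1" for n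
  proof -
    have "damped_norm_sq \<rho> (backward_diff (a n) z1) \<le> ennreal (1 / \<rho>\<^sup>2) * damped_norm_sq \<rho> (backward_diff (a n) F)"
      using wave_system_velocity_bound[OF wave_system_backward_diff[OF w less_imp_le[OF a0]] rho] .
    also have "\<dots> \<le> ennreal (1 / \<rho>\<^sup>2) * (ennreal ((a n)\<^sup>2) * damped_norm_sq \<rho> F1)"
      by (intro mult_left_mono damped_norm_sq_backward_diff dF cF1 F1) (use rho a0[of n] in auto)
    finally have "ennreal ((1 / a n)\<^sup>2) * damped_norm_sq \<rho> (backward_diff (a n) z1)
        \<le> ennreal ((1 / a n)\<^sup>2) * (ennreal (1 / \<rho>\<^sup>2) * (ennreal ((a n)\<^sup>2) * damped_norm_sq \<rho> F1))"
      by (rule mult_left_mono) simp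
    also have "\<dots> = ennreal ((1 / a n)\<^sup>2 * (a n)\<^sup>2) * (ennreal (1 / \<rho>\<^sup>2) * damped_norm_sq \<rho> F1)"
      by (simp add: ennreal_mult' mult_ac)
    also have "(1 / a n)\<^sup>2 * (a n)\<^sup>2 = 1" using a0[of n] by (simp add: field_simps)
    finally show ?thesis by (subst damped_integral_cmult) auto
  qed
  have lim: "(\<lambda>n. ennreal ((1 / a n)\<^sup>2) * ennreal ((norm (backward_diff (a n) z1 t))\<^sup>2)) \<longlonglongrightarrow> ennreal ((norm (z2 t))\<^sup>2)" for t
  proof -
    have a_lim: "(\<lambda>n. t - a n) \<longlonglongrightarrow> t"
      using tendsto_diff[OF tendsto_const LIMSEQ_inverse_real_of_nat, of t] by (simp add: a_def)
    have "filterlim (\<lambda>n. t - a n) (at t) sequentially"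
      using a_lim by (auto simp: filterlim_at a_def intro!: always_eventually)
    from filterlim_compose[OF has_vector_derivative_quotient_tendsto[OF dz1] this]
    have "(\<lambda>n. (z1 (t - a n) - z1 t) /\<^sub>R (t - a n - t)) \<longlonglongrightarrow> z2 t"
      .
    then have "(\<lambda>n. ennreal ((norm ((z1 (t - a n) - z1 t) /\<^sub>R (t - a n - t)))\<^sup>2)) \<longlonglongrightarrow> ennreal ((norm (z2 t))\<^sup>2)"
      by (intro tendsto_intros)
    moreover have e: "ennreal ((norm ((z1 (t - a n) - z1 t) /\<^sub>R (t - a n - t)))\<^sup>2)
        = ennreal ((1 / a n)\<^sup>2) * ennreal ((norm (backward_diff (a n) z1 t))\<^sup>2)" for n
      by (simp add: ennreal_mult'[symmetric] backward_diff_def norm_minus_commute power_mult_distrib power_divide power_inverse divide_inverse)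
    ultimately show ?thesis unfolding e by blast
  qed
  have "damped_norm_sq \<rho> z2
      = (\<integral>\<^sup>+t. liminf (\<lambda>n. ennreal ((1 / a n)\<^sup>2) * ennreal ((norm (backward_diff (a n) z1 t))\<^sup>2)
            * ennreal (exp (- 2 * \<rho> * t)) * indicator {0..} t) \<partial>lborel)"
    unfolding damped_integral_def
  proof (rule nn_integral_cong)
    fix t :: real
    have "(\<lambda>n. ennreal ((1 / a n)\<^sup>2) * ennreal ((norm (backward_diff (a n) z1 t))\<^sup>2) * ennreal (exp (- 2 * \<rho> * t)) * indicator {0..} t)
      \<longlonglongrightarrow> ennreal ((norm (z2 t))\<^sup>2) * ennreal (exp (- 2 * \<rho> * t)) * indicator {0..} t"
      using lim[of t] by (cases "0 \<le> t") (auto intro!: ennreal_tendsto_cmult simp: mult.commute[of _ "ennreal (exp _)"])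
    from lim_imp_Liminf[OF _ this]
    show "ennreal ((norm (z2 t))\<^sup>2) * ennreal (exp (- 2 * \<rho> * t)) * indicator {0..} t
      = liminf (\<lambda>n. ennreal ((1 / a n)\<^sup>2) * ennreal ((norm (backward_diff (a n) z1 t))\<^sup>2) * ennreal (exp (- 2 * \<rho> * t)) * indicator {0..} t)"
      by simp
  qed
  also have "\<dots> \<le> liminf (\<lambda>n. damped_integral \<rho> (\<lambda>t. ennreal ((1 / a n)\<^sup>2) * ennreal ((norm (backward_diff (a n) z1 t))\<^sup>2)))"
    unfolding damped_integral_def by (rule nn_integral_liminf) measurable
  also have "\<dots> \<le> liminf (\<lambda>n::nat. ennreal (1 / \<rho>\<^sup>2) * damped_norm_sq \<rho> F1)"
    by (intro Liminf_mono always_eventually allI bound)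
  also have "\<dots> = ennreal (1 / \<rho>\<^sup>2) * damped_norm_sq \<rho> F1"
    by (rule Liminf_const) simp
  finally show ?thesis .
qed

lemma wave_system_iterated_diff:
  assumes "wave_system z z1 z2 P F" and "0 \<le> s"
  shows "wave_system ((backward_diff s ^^ m) z) ((backward_diff s ^^ m) z1) ((backward_diff s ^^ m) z2)
     ((backward_diff s ^^ m) P) ((backward_diff s ^^ m) F)"
  by (induction m) (use assms wave_system_backward_diff in auto)

lemma has_vector_derivative_iterated_diff:
  fixes F :: "real \<Rightarrow> 'v::real_normed_vector"
  assumes "\<And>t. (F has_vector_derivative F1 t) (at t)"
  shows "((backward_diff s ^^ m) F has_vector_derivative (backward_diff s ^^ m) F1 t) (at t)"
proof (induction m arbitrary: t)
  case (Suc m)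
  from has_vector_derivative_backward_diff[OF Suc] show ?case by simp
qed (simp add: assms)

lemma continuous_on_iterated_diff:
  fixes F :: "real \<Rightarrow> 'v::real_normed_vector"
  assumes "continuous_on UNIV F" shows "continuous_on UNIV ((backward_diff s ^^ m) F)"
  by (induction m) (use assms continuous_on_backward_diff in auto)

lemma iterated_diff_eq_0:
  assumes "0 \<le> s" "\<And>t. t \<le> 0 \<Longrightarrow> F t = 0" "t \<le> 0"
  shows "(backward_diff s ^^ m) F t = 0"
  using assms(3) by (induction m arbitrary: t) (use assms(1,2) in \<open>auto simp: backward_diff_def\<close>)

text \<open>
  Each difference is traded for one derivative and one factor \<open>s\<close>.
\<close>

lemma damped_norm_sq_iterated_diff:
  fixes F :: "nat \<Rightarrow> real \<Rightarrow> 'v::real_inner"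
  assumes s: "0 \<le> s" and rho: "0 \<le> \<rho>"
    and dF: "\<And>j t. j < r \<Longrightarrow> (F j has_vector_derivative F (Suc j) t) (at t)"
    and cF: "continuous_on UNIV (F r)"
    and F0: "\<And>j t. j \<le> r \<Longrightarrow> t \<le> 0 \<Longrightarrow> F j t = 0"
  shows "j + m \<le> r \<Longrightarrow> damped_norm_sq \<rho> ((backward_diff s ^^ m) (F j)) \<le> ennreal (s ^ (2 * m)) * damped_norm_sq \<rho> (F (j + m))"
proof (induction m arbitrary: j)
  case (Suc m)
  have "continuous_on UNIV (F (Suc j))"
  proof (cases "Suc j = r")
    case False
    then have "Suc j < r" using Suc.prems by simp
    then show ?thesis
      by (intro continuous_at_imp_continuous_on ballI has_vector_derivative_continuous[OF dF])
  qed (use cF in simp)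
  then have "damped_norm_sq \<rho> (backward_diff s ((backward_diff s ^^ m) (F j)))
     \<le> ennreal (s\<^sup>2) * damped_norm_sq \<rho> ((backward_diff s ^^ m) (F (Suc j)))"
    using Suc.prems
    by (intro damped_norm_sq_backward_diff s rho has_vector_derivative_iterated_diff continuous_on_iterated_diff iterated_diff_eq_0 F0 dF) auto
  also have "\<dots> \<le> ennreal (s\<^sup>2) * (ennreal (s ^ (2 * m)) * damped_norm_sq \<rho> (F (Suc j + m)))"
    using Suc.prems by (intro mult_left_mono Suc.IH) auto
  also have "\<dots> = ennreal (s ^ (2 * Suc m)) * damped_norm_sq \<rho> (F (j + Suc m))"
    using s by (simp add: power2_eq_square ennreal_mult' mult_ac)
  finally show ?case by simp
qed simp

lemma iterated_diff_eq_sum: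
  fixes G :: "real \<Rightarrow> 'v::real_vector"
  shows "(backward_diff s ^^ m) G t = (\<Sum>j\<le>m. ((-1) ^ j * real (m choose j)) *\<^sub>R G (t - real j * s))"
proof (induction m arbitrary: t)
  case (Suc m)
  let ?c = "\<lambda>m j. (-1) ^ j * real (m choose j)" and ?G = "\<lambda>j. G (t - real j * s)"
  have cs: "?c (Suc m) (Suc j) = ?c m (Suc j) - ?c m j" for j
    by (simp add: algebra_simps)
  have "(\<Sum>j\<le>Suc m. ?c (Suc m) j *\<^sub>R ?G j) = ?G 0 + (\<Sum>j\<le>m. (?c m (Suc j) - ?c m j) *\<^sub>R ?G (Suc j))"
    by (subst sum.atMost_Suc_shift) (simp only: cs, simp)
  also have "\<dots> = (\<Sum>j\<le>Suc m. ?c m j *\<^sub>R ?G j) - (\<Sum>j\<le>m. ?c m j *\<^sub>R ?G (Suc j))"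
    by (subst sum.atMost_Suc_shift) (simp add: scaleR_diff_left sum_subtractf)
  also have "(\<Sum>j\<le>Suc m. ?c m j *\<^sub>R ?G j) = (\<Sum>j\<le>m. ?c m j *\<^sub>R ?G j)"
    by simp
  also have "(\<Sum>j\<le>m. ?c m j *\<^sub>R ?G (Suc j)) = (\<Sum>j\<le>m. ?c m j *\<^sub>R G ((t - s) - real j * s))"
    by (simp add: algebra_simps)
  finally have "(\<Sum>j\<le>Suc m. ?c (Suc m) j *\<^sub>R ?G j) = backward_diff s ((backward_diff s ^^ m) G) t"
    unfolding backward_diff_def[of s "(backward_diff s ^^ m) G"] Suc .
  then show ?case by (simp del: sum.atMost_Suc)
qed simp

lemma norm_sum_sq_le:
  fixes x :: "'i \<Rightarrow> 'v::real_normed_vector"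
  shows "(norm (\<Sum>i\<in>I. x i))\<^sup>2 \<le> real (card I) * (\<Sum>i\<in>I. (norm (x i))\<^sup>2)"
proof -
  have "(norm (\<Sum>i\<in>I. x i))\<^sup>2 \<le> (\<Sum>i\<in>I. norm (x i))\<^sup>2"
    by (intro power_mono norm_sum) simp
  also have "\<dots> \<le> real (card I) * (\<Sum>i\<in>I. (norm (x i))\<^sup>2)"
    using Cauchy_Schwarz_ineq_sum[of "\<lambda>_. 1" "\<lambda>i. norm (x i)" I] by simp
  finally show ?thesis .
qed

lemma norm_add_sq_le:
  fixes x y :: "'v::real_normed_vector"
  shows "(norm (x + y))\<^sup>2 \<le> 2 * (norm x)\<^sup>2 + 2 * (norm y)\<^sup>2"
proof -
  have "(norm (x + y))\<^sup>2 \<le> (norm x + norm y)\<^sup>2" by (intro power_mono norm_triangle_ineq) simp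
  also have "\<dots> \<le> 2 * (norm x)\<^sup>2 + 2 * (norm y)\<^sup>2"
    using sum_squares_bound[of "norm x" "norm y"] by (simp add: power2_sum)
  finally show ?thesis .
qed

text \<open>
  The constant that \<open>norm_sum_sq_le\<close> and \<open>norm_add_sq_le\<close> give in \<open>derivative_interpolation\<close>.
\<close>

definition interp_const :: "nat \<Rightarrow> real" where
  "interp_const m = (\<Sum>j=1..m. 8 * real m * (real (m choose j) / real j)\<^sup>2)"

lemma interp_const_nonneg: "0 \<le> interp_const m"
  unfolding interp_const_def by (intro sum_nonneg) simp

text \<open>
  A Landau--Kolmogorov inequality with differences in place of higher derivatives. The function
  \<open>\<phi> t s = s g1 t + (\<Sum>j=1..m. (c j / j) (g t - g (t - j s)))\<close>, where \<open>c j\<close> are the signed binomial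
  coefficients, has \<open>s\<close>-derivative \<open>\<Delta>\<^sub>s\<^sup>m g1 t\<close>. So \<open>\<phi> t H\<close> is an integral of differences, and \<open>H g1 t - \<phi> t H\<close>
  only involves values of \<open>g\<close>.
\<close>

lemma derivative_interpolation:
  fixes g g1 :: "real \<Rightarrow> 'v::real_inner"
  assumes H: "0 \<le> H" and rho: "0 \<le> \<rho>" and dg: "\<And>t. (g has_vector_derivative g1 t) (at t)"
    and cg1: "continuous_on UNIV g1" and g0: "\<And>t. t \<le> 0 \<Longrightarrow> g t = 0"
    and B: "\<And>s. s \<in> {0..H} \<Longrightarrow> damped_norm_sq \<rho> ((backward_diff s ^^ m) g1) \<le> B"
  shows "ennreal (H\<^sup>2) * damped_norm_sq \<rho> g1 \<le> ennreal (interp_const m) * damped_norm_sq \<rho> g + 2 * (ennreal (H\<^sup>2) * B)"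
proof -
  define c where "c j = (-1) ^ j * real (m choose j)" for j
  define \<phi> where "\<phi> t s = s *\<^sub>R g1 t + (\<Sum>j=1..m. (c j / real j) *\<^sub>R (g t - g (t - real j * s)))" for t s
  have sum_split: "(backward_diff s ^^ m) g1 t = g1 t + (\<Sum>j=1..m. c j *\<^sub>R g1 (t - real j * s))" for s t
  proof -
    have "{..m} = insert 0 {1..m}" by auto
    then show ?thesis unfolding iterated_diff_eq_sum c_def by simp
  qed
  have d\<phi>: "(\<phi> t has_vector_derivative (backward_diff s ^^ m) g1 t) (at s)" for s t
  proof -
    have "((\<lambda>s. (c j / real j) *\<^sub>R (g t - g (t - real j * s))) has_vector_derivative c j *\<^sub>R g1 (t - real j * s)) (at s)"
      if "j \<in> {1..m}" for j
    proof -
      have "((\<lambda>s. t - real j * s) has_vector_derivative - real j) (at s)"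
        by (auto intro!: derivative_eq_intros)
      from vector_diff_chain_at[OF this dg]
      have "((\<lambda>s. g (t - real j * s)) has_vector_derivative - real j *\<^sub>R g1 (t - real j * s)) (at s)"
        by (simp add: o_def)
      from bounded_linear.has_vector_derivative[OF bounded_linear_scaleR_right has_vector_derivative_diff[OF has_vector_derivative_const this]]
      have "((\<lambda>s. (c j / real j) *\<^sub>R (g t - g (t - real j * s))) has_vector_derivative
         (c j / real j) *\<^sub>R (0 - - real j *\<^sub>R g1 (t - real j * s))) (at s)" .
      then show ?thesis using that by simp
    qed
    moreover have "((\<lambda>s. s *\<^sub>R g1 t) has_vector_derivative g1 t) (at s)"
      by (auto intro!: derivative_eq_intros)
    ultimately show ?thesis unfolding \<phi>_def sum_split
      by (intro has_vector_derivative_add has_vector_derivative_sum) auto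
  qed
  have cD: "continuous_on UNIV (\<lambda>(s, t). (backward_diff s ^^ m) g1 t)"
  proof -
    have "continuous_on UNIV (\<lambda>x::real \<times> real. g1 (snd x - real j * fst x))" for j
      by (rule continuous_on_compose2[OF cg1]) (auto intro!: continuous_intros)
    then show ?thesis unfolding iterated_diff_eq_sum split_beta by (intro continuous_intros)
  qed
  have X: "damped_norm_sq \<rho> (\<lambda>t. \<phi> t H) \<le> ennreal (H\<^sup>2) * B"
  proof (rule damped_norm_sq_average[OF H cD _ B])
    fix t :: real
    have "continuous_on {0..H} (\<lambda>s. (backward_diff s ^^ m) g1 t)"
    proof -
      have "continuous_on {0..H} (\<lambda>s. (\<lambda>(s, t). (backward_diff s ^^ m) g1 t) (s, t))"
        by (rule continuous_on_compose2[OF cD]) (auto intro!: continuous_intros)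
      then show ?thesis by simp
    qed
    then show "ennreal ((norm (\<phi> t H))\<^sup>2) \<le> ennreal H * (\<integral>\<^sup>+s\<in>{0..H}. ennreal ((norm ((backward_diff s ^^ m) g1 t))\<^sup>2) \<partial>lborel)"
      by (rule norm_sq_le_integral_derivative[OF H has_vector_derivative_at_within[OF d\<phi>]]) (simp add: \<phi>_def)
  qed
  have cg: "continuous_on UNIV g"
    by (intro continuous_at_imp_continuous_on ballI has_vector_derivative_continuous[OF dg])
  have meas: "(\<lambda>t. ennreal ((norm (G t))\<^sup>2)) \<in> borel_measurable borel" if "continuous_on UNIV G" for G :: "real \<Rightarrow> 'v"
  proof -
    have "(\<lambda>t. (norm (G t))\<^sup>2) \<in> borel_measurable borel"
      using that by (intro borel_measurable_continuous_onI continuous_intros)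
    then show ?thesis by measurable
  qed
  define k where "k j = 4 * real m * (real (m choose j) / real j)\<^sup>2" for j
  have k0: "0 \<le> k j" for j by (simp add: k_def)
  let ?S = "\<lambda>t. \<Sum>j=1..m. ennreal (k j) * (ennreal ((norm (g t))\<^sup>2) + ennreal ((norm (g (t - real j * H)))\<^sup>2))"
  have pt: "ennreal (H\<^sup>2) * ennreal ((norm (g1 t))\<^sup>2) \<le> 2 * ennreal ((norm (\<phi> t H))\<^sup>2) + ?S t" for t
  proof -
    let ?x = "\<lambda>j. (c j / real j) *\<^sub>R (g t - g (t - real j * H))"
    have "(norm (H *\<^sub>R g1 t))\<^sup>2 = (norm (\<phi> t H + - (\<Sum>j=1..m. ?x j)))\<^sup>2"
      by (simp add: \<phi>_def)
    also have "\<dots> \<le> 2 * (norm (\<phi> t H))\<^sup>2 + 2 * (norm (\<Sum>j=1..m. ?x j))\<^sup>2"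
      by (rule order_trans[OF norm_add_sq_le]) simp
    finally have 1: "(norm (H *\<^sub>R g1 t))\<^sup>2 \<le> 2 * (norm (\<phi> t H))\<^sup>2 + 2 * (norm (\<Sum>j=1..m. ?x j))\<^sup>2" .
    have "2 * (norm (\<Sum>j=1..m. ?x j))\<^sup>2 \<le> 2 * (real m * (\<Sum>j=1..m. (norm (?x j))\<^sup>2))"
      using norm_sum_sq_le[of ?x "{1..m}"] by simp
    also have "\<dots> = (\<Sum>j=1..m. 2 * real m * (norm (?x j))\<^sup>2)"
      by (simp add: sum_distrib_left mult.assoc)
    also have "\<dots> \<le> (\<Sum>j=1..m. k j * ((norm (g t))\<^sup>2 + (norm (g (t - real j * H)))\<^sup>2))"
    proof (rule sum_mono)
      fix j
      have "(norm (?x j))\<^sup>2 = (real (m choose j) / real j)\<^sup>2 * (norm (g t + - g (t - real j * H)))\<^sup>2"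
        by (simp add: c_def power_mult_distrib abs_mult power_divide)
      also have "\<dots> \<le> (real (m choose j) / real j)\<^sup>2 * (2 * (norm (g t))\<^sup>2 + 2 * (norm (g (t - real j * H)))\<^sup>2)"
        by (intro mult_left_mono order_trans[OF norm_add_sq_le]) auto
      finally have "2 * real m * (norm (?x j))\<^sup>2
          \<le> 2 * real m * ((real (m choose j) / real j)\<^sup>2 * (2 * (norm (g t))\<^sup>2 + 2 * (norm (g (t - real j * H)))\<^sup>2))"
        by (rule mult_left_mono) simp
      also have "\<dots> = k j * ((norm (g t))\<^sup>2 + (norm (g (t - real j * H)))\<^sup>2)"
        unfolding k_def by (simp only: distrib_left[of 2, symmetric] mult_ac)
      finally show "2 * real m * (norm (?x j))\<^sup>2 \<le> k j * ((norm (g t))\<^sup>2 + (norm (g (t - real j * H)))\<^sup>2)" .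
    qed
    finally have "(norm (H *\<^sub>R g1 t))\<^sup>2 \<le> 2 * (norm (\<phi> t H))\<^sup>2 + (\<Sum>j=1..m. k j * ((norm (g t))\<^sup>2 + (norm (g (t - real j * H)))\<^sup>2))"
      using 1 by linarith
    then have "ennreal ((norm (H *\<^sub>R g1 t))\<^sup>2) \<le> ennreal (2 * (norm (\<phi> t H))\<^sup>2 + (\<Sum>j=1..m. k j * ((norm (g t))\<^sup>2 + (norm (g (t - real j * H)))\<^sup>2)))"
      by (rule ennreal_leI)
    also have "\<dots> = 2 * ennreal ((norm (\<phi> t H))\<^sup>2) + ?S t"
      using k0 by (simp add: ennreal_mult ennreal_plus sum_nonneg sum_ennreal[symmetric])
    finally show ?thesis by (simp add: power_mult_distrib ennreal_mult')
  qed
  have c\<phi>: "continuous_on UNIV (\<lambda>t. \<phi> t H)"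
    unfolding \<phi>_def by (intro continuous_intros continuous_on_compose2[OF cg] cg cg1) auto
  have csh: "continuous_on UNIV (\<lambda>t. g (t - a))" for a using cg by (rule continuous_on_shift)
  define A where "A t = ennreal ((norm (g t))\<^sup>2)" for t
  define A' where "A' j t = ennreal ((norm (g (t - real j * H)))\<^sup>2)" for j t
  define X where "X t = ennreal ((norm (\<phi> t H))\<^sup>2)" for t
  have [measurable]: "A \<in> borel_measurable borel" "A' j \<in> borel_measurable borel" "X \<in> borel_measurable borel" for j
    using meas[OF cg] meas[OF csh] meas[OF c\<phi>] by (simp_all add: A_def A'_def X_def cong: measurable_cong)
  have "ennreal (H\<^sup>2) * damped_norm_sq \<rho> g1 = damped_integral \<rho> (\<lambda>t. ennreal (H\<^sup>2) * ennreal ((norm (g1 t))\<^sup>2))"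
    by (rule damped_integral_cmult[OF meas[OF cg1], symmetric])
  also have "\<dots> \<le> damped_integral \<rho> (\<lambda>t. 2 * X t + (\<Sum>j=1..m. ennreal (k j) * (A t + A' j t)))"
    using pt by (intro damped_integral_mono_AE) (auto simp: A_def A'_def X_def)
  also have "\<dots> = damped_integral \<rho> (\<lambda>t. 2 * X t) + damped_integral \<rho> (\<lambda>t. \<Sum>j=1..m. ennreal (k j) * (A t + A' j t))"
    by (rule damped_integral_add) measurable
  also have "\<dots> = 2 * damped_integral \<rho> X + (\<Sum>j=1..m. ennreal (k j) * (damped_integral \<rho> A + damped_integral \<rho> (A' j)))"
    by (subst damped_integral_sum, measurable) (simp add: damped_integral_cmult damped_integral_add)
  also have "\<dots> = 2 * damped_norm_sq \<rho> (\<lambda>t. \<phi> t H)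
     + (\<Sum>j=1..m. ennreal (k j) * (damped_norm_sq \<rho> g + damped_norm_sq \<rho> (\<lambda>t. g (t - real j * H))))"
    by (simp add: A_def [abs_def] A'_def[abs_def] X_def[abs_def])
  also have "\<dots> \<le> 2 * (ennreal (H\<^sup>2) * B) + (\<Sum>j=1..m. ennreal (k j) * (damped_norm_sq \<rho> g + damped_norm_sq \<rho> g))"
    using H rho by (intro add_mono mult_left_mono X sum_mono order_refl damped_norm_sq_shift_le cg g0) auto
  also have "(\<Sum>j=1..m. ennreal (k j) * (damped_norm_sq \<rho> g + damped_norm_sq \<rho> g))
      = ennreal (interp_const m) * damped_norm_sq \<rho> g"
  proof -
    have "(\<Sum>j=1..m. ennreal (k j) * 2) = (\<Sum>j=1..m. ennreal (2 * k j))"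
      using k0 by (simp add: ennreal_mult mult.commute[of _ "2::ennreal"])
    also have "\<dots> = ennreal (\<Sum>j=1..m. 2 * k j)"
      using k0 by (intro sum_ennreal) simp
    also have "(\<Sum>j=1..m. 2 * k j) = interp_const m"
      unfolding interp_const_def k_def by (intro sum.cong) simp_all
    finally have "ennreal (interp_const m) = (\<Sum>j=1..m. ennreal (k j) * 2)" ..
    then show ?thesis by (simp add: sum_distrib_right mult_2 [symmetric] mult.assoc)
  qed
  finally show ?thesis by (simp add: add.commute)
qed

text \<open>
  The map \<open>Q\<close> is a contraction that commutes with differences; it will be the projection error. The first term
  on the right keeps \<open>Q\<close>, which is what allows it to be estimated by the velocity error.
\<close>

lemma wave_acceleration_interpolation:
  fixes z z1 z2 :: "real \<Rightarrow> 'v::real_inner" and F :: "nat \<Rightarrow> real \<Rightarrow> 'v" and Q :: "'v \<Rightarrow> 'v"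
  assumes w: "wave_system z z1 z2 P (F 0)" and rho: "0 < \<rho>" and H: "0 \<le> H"
    and dF: "\<And>j t. j < Suc m \<Longrightarrow> (F j has_vector_derivative F (Suc j) t) (at t)"
    and cF: "continuous_on UNIV (F (Suc m))"
    and F0: "\<And>j t. j \<le> Suc m \<Longrightarrow> t \<le> 0 \<Longrightarrow> F j t = 0"
    and Q: "bounded_linear Q" "\<And>x. norm (Q x) \<le> norm x"
  shows "ennreal (H\<^sup>2) * damped_norm_sq \<rho> (\<lambda>t. Q (z2 t)) \<le> ennreal (interp_const m) * damped_norm_sq \<rho> (\<lambda>t. Q (z1 t))
     + 2 * (ennreal (H ^ (2 * Suc m) / \<rho>\<^sup>2) * damped_norm_sq \<rho> (F (Suc m)))"
proof -
  interpret Q: bounded_linear Q by fact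
  have w': "\<And>t. (z1 has_vector_derivative z2 t) (at t)" "continuous_on UNIV z2" "\<And>t. t \<le> 0 \<Longrightarrow> z1 t = 0"
    using w by (auto simp: wave_system_def)
  have QD: "(backward_diff s ^^ m) (\<lambda>t. Q (z2 t)) t = Q ((backward_diff s ^^ m) z2 t)" for s t
    by (simp add: iterated_diff_eq_sum Q.sum Q.scaleR)
  have "ennreal (H\<^sup>2) * damped_norm_sq \<rho> (\<lambda>t. Q (z2 t)) \<le> ennreal (interp_const m) * damped_norm_sq \<rho> (\<lambda>t. Q (z1 t))
     + 2 * (ennreal (H\<^sup>2) * (ennreal (H ^ (2 * m) / \<rho>\<^sup>2) * damped_norm_sq \<rho> (F (Suc m))))"
  proof (rule derivative_interpolation[OF H less_imp_le[OF rho]])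
    show "((\<lambda>t. Q (z1 t)) has_vector_derivative Q (z2 t)) (at t)" for t
      using Q.has_vector_derivative w'(1) .
    show "continuous_on UNIV (\<lambda>t. Q (z2 t))" by (rule Q.continuous_on[OF w'(2)])
    show "Q (z1 t) = 0" if "t \<le> 0" for t using w'(3)[OF that] by simp
    fix s assume s: "s \<in> {0..H}"
    then have s0: "0 \<le> s" by simp
    have "continuous_on UNIV (F (Suc 0))"
    proof (cases m)
      case (Suc n)
      then show ?thesis
        by (intro continuous_at_imp_continuous_on ballI has_vector_derivative_continuous[OF dF]) simp
    qed (use cF in simp)
    then have "damped_norm_sq \<rho> ((backward_diff s ^^ m) z2) \<le> ennreal (1 / \<rho>\<^sup>2) * damped_norm_sq \<rho> ((backward_diff s ^^ m) (F (Suc 0)))"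
      by (intro wave_system_acceleration_bound[OF wave_system_iterated_diff[OF w s0] rho]
        has_vector_derivative_iterated_diff dF continuous_on_iterated_diff iterated_diff_eq_0 s0 F0) auto
    also have "\<dots> \<le> ennreal (1 / \<rho>\<^sup>2) * (ennreal (s ^ (2 * m)) * damped_norm_sq \<rho> (F (Suc 0 + m)))"
      using rho by (intro mult_left_mono damped_norm_sq_iterated_diff[where r = "Suc m"] s0 dF cF F0) auto
    also have "\<dots> \<le> ennreal (1 / \<rho>\<^sup>2) * (ennreal (H ^ (2 * m)) * damped_norm_sq \<rho> (F (Suc 0 + m)))"
      using s by (intro mult_left_mono mult_right_mono ennreal_leI power_mono) auto
    also have "\<dots> = ennreal (H ^ (2 * m) / \<rho>\<^sup>2) * damped_norm_sq \<rho> (F (Suc m))"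
      using H by (simp add: mult.assoc[symmetric] ennreal_mult'[symmetric])
    finally have D: "damped_norm_sq \<rho> ((backward_diff s ^^ m) z2) \<le> ennreal (H ^ (2 * m) / \<rho>\<^sup>2) * damped_norm_sq \<rho> (F (Suc m))" .
    have "damped_norm_sq \<rho> ((backward_diff s ^^ m) (\<lambda>t. Q (z2 t))) \<le> damped_norm_sq \<rho> ((backward_diff s ^^ m) z2)"
      unfolding QD by (intro damped_integral_mono_AE AE_I2 impI ennreal_leI power_mono Q(2)) auto
    then show "damped_norm_sq \<rho> ((backward_diff s ^^ m) (\<lambda>t. Q (z2 t))) \<le> ennreal (H ^ (2 * m) / \<rho>\<^sup>2) * damped_norm_sq \<rho> (F (Suc m))"
      using D by (rule order_trans)
  qed
  also have "ennreal (H\<^sup>2) * (ennreal (H ^ (2 * m) / \<rho>\<^sup>2) * damped_norm_sq \<rho> (F (Suc m)))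
     = ennreal (H ^ (2 * Suc m) / \<rho>\<^sup>2) * damped_norm_sq \<rho> (F (Suc m))"
    using H by (simp add: mult.assoc[symmetric] ennreal_mult'[symmetric] power2_eq_square)
  finally show ?thesis .
qed


section \<open>Extension by zero to negative times\<close>

definition zero_past :: "(real \<Rightarrow> 'v::zero) \<Rightarrow> real \<Rightarrow> 'v" where
  "zero_past v t = (if t \<le> 0 then 0 else v t)"

lemma at_half_line_nontrivial: 
  assumes "0 \<le> (t::real)" shows "at t within {0..} \<noteq> bot"
proof -
  have "t islimpt {t<..<t+1}" by (rule islimpt_greaterThanLessThan1) simp
  then have "t islimpt {0..}" by (rule islimpt_subset) (use assms in auto)
  then show ?thesis by (simp add: trivial_limit_within)
qed

lemma has_vector_derivative_tderiv:
  assumes "v \<in> C_time r Y" "i < r" "0 \<le> t"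
  shows "(tderiv i v has_vector_derivative tderiv (Suc i) v t) (at t within {0..})"
  using assms by (simp add: C_time_def vector_derivative_works[symmetric])

lemma tderiv_eq_0:
  assumes z: "\<And>t. 0 \<le> t \<Longrightarrow> t < \<epsilon> \<Longrightarrow> v t = 0" and t: "0 \<le> t" "t < \<epsilon>"
  shows "tderiv i v t = 0"
  using t
proof (induction i arbitrary: t)
  case (Suc i)
  have "\<forall>\<^sub>F x in nhds t. x \<in> {0..} \<longrightarrow> 0 = tderiv i v x"
    unfolding eventually_nhds by (rule exI[of _ "{..<\<epsilon>}"]) (use Suc in auto)
  then have "(tderiv i v has_vector_derivative 0) (at t within {0..})"
    using has_vector_derivative_cong_ev[of "{0..}" "\<lambda>_. 0" "tderiv i v" t 0] Suc by simp
  then show ?case using vector_derivative_within[OF at_half_line_nontrivial[OF Suc.prems(1)]] by simp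
qed (use z in auto)

lemma has_vector_derivative_zero_past:
  assumes eps: "0 < \<epsilon>" and d: "\<And>t. 0 \<le> t \<Longrightarrow> (v has_vector_derivative v1 t) (at t within {0..})"
    and z: "\<And>t. 0 \<le> t \<Longrightarrow> t < \<epsilon> \<Longrightarrow> v t = 0 \<and> v1 t = 0"
  shows "(zero_past v has_vector_derivative zero_past v1 t) (at t)"
proof (cases "0 < t")
  case True
  then have "t \<in> interior {0..}" by (simp add: interior_Ici)
  then have "(v has_vector_derivative v1 t) (at t)" using d[of t] True at_within_interior[of t "{0..}"] by simp
  moreover have "\<forall>\<^sub>F x in nhds t. x \<in> UNIV \<longrightarrow> zero_past v x = v x"
    unfolding eventually_nhds by (rule exI[of _ "{0<..}"]) (use True in \<open>auto simp: zero_past_def\<close>)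
  ultimately show ?thesis using True
    using has_vector_derivative_cong_ev[of UNIV "zero_past v" v t "v1 t"] by (simp add: zero_past_def)
next
  case False
  have "\<forall>\<^sub>F x in nhds t. x \<in> UNIV \<longrightarrow> zero_past v x = 0"
    unfolding eventually_nhds by (rule exI[of _ "{..<\<epsilon>}"]) (use False eps z in \<open>auto simp: zero_past_def\<close>)
  then show ?thesis using False
    using has_vector_derivative_cong_ev[of UNIV "zero_past v" "\<lambda>_. 0" t 0] by (simp add: zero_past_def)
qed

lemma continuous_on_zero_past:
  fixes v :: "real \<Rightarrow> 'v::real_normed_vector"
  assumes eps: "0 < \<epsilon>" and c: "continuous_on {0..} v"
    and z: "\<And>t. 0 \<le> t \<Longrightarrow> t < \<epsilon> \<Longrightarrow> v t = 0"
  shows "continuous_on UNIV (zero_past v)"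
proof -
  have "continuous_on {0<..} (zero_past v)"
    by (rule continuous_on_eq[OF continuous_on_subset[OF c]]) (auto simp: zero_past_def)
  moreover have "continuous_on {..<\<epsilon>} (zero_past v)"
    by (rule continuous_on_eq[OF continuous_on_const[of _ 0]]) (use z in \<open>auto simp: zero_past_def\<close>)
  ultimately have "continuous_on ({0<..} \<union> {..<\<epsilon>}) (zero_past v)"
    by (intro continuous_on_open_Un) auto
  moreover have "{0<..} \<union> {..<\<epsilon>} = (UNIV :: real set)" using eps by auto
  ultimately show ?thesis by simp
qed

text \<open>
  The energy estimate on \<open>[0, T]\<close> for \<open>T < \<epsilon>\<close>, where the source is zero. It makes the extension by zero to
  negative times twice continuously differentiable.
\<close>

lemma wave_vanishes_initially:
  fixes u f :: "real \<Rightarrow> 'v::real_inner" and p :: "real \<Rightarrow> 'w::real_inner"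
  assumes u: "u \<in> C20_time Y" and f: "continuous_on {0..} f" and f0: "\<And>t. 0 \<le> t \<Longrightarrow> t < \<epsilon> \<Longrightarrow> f t = 0"
    and eq: "\<And>t t'. 0 \<le> t \<Longrightarrow> 0 \<le> t' \<Longrightarrow> tderiv 2 u t \<bullet> u t' + p t \<bullet> p t' = f t \<bullet> u t'"
    and p0: "p 0 = 0" and t: "0 \<le> t" "t < \<epsilon>"
  shows "u t = 0"
proof -
  have uC: "u \<in> C_time 2 Y" "u 0 = 0" "tderiv 1 u 0 = 0" using u by (auto simp: C20_time_def)
  have d: "(tderiv 0 u has_vector_derivative tderiv (Suc 0) u s) (at s within {0..})"
    "(tderiv (Suc 0) u has_vector_derivative tderiv (Suc (Suc 0)) u s) (at s within {0..})" if "0 \<le> s" for s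
    using has_vector_derivative_tderiv[OF uC(1) _ that] by (auto simp del: tderiv.simps)
  have c2: "continuous_on {0..} (tderiv 2 u)" using uC by (simp add: C_time_def)
  have c1: "continuous_on {0..} (tderiv 1 u)"
    unfolding continuous_on_eq_continuous_within using has_vector_derivative_continuous[OF d(2)] by simp
  have v0: "tderiv 1 u T = 0" if T: "0 \<le> T" "T < \<epsilon>" for T
  proof -
    have sub: "{0..T} \<subseteq> {0..}" by auto
    have "((norm (tderiv 1 u T))\<^sup>2 + (norm (p T))\<^sup>2) * exp (- 2 * 1 * T)
        + 1 * integral {0..T} (\<lambda>t. (norm (tderiv 1 u t))\<^sup>2 * exp (- 2 * 1 * t))
      \<le> (1 / 1) * integral {0..T} (\<lambda>t. (norm (f t))\<^sup>2 * exp (- 2 * 1 * t))"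
    proof (rule weighted_energy_bound)
      show "(u has_vector_derivative tderiv 1 u s) (at s within {0..T})" if "s \<in> {0..T}" for s
        using d(1)[of s] that has_vector_derivative_within_subset[OF _ sub] by auto
      show "(tderiv 1 u has_vector_derivative tderiv 2 u s) (at s within {0..T})" if "s \<in> {0..T}" for s
        using d(2)[of s] that has_vector_derivative_within_subset[OF _ sub] by (auto simp: numeral_2_eq_2)
    qed (use T uC p0 eq in \<open>auto intro: continuous_on_subset[OF c2] continuous_on_subset[OF f]\<close>)
    also have "integral {0..T} (\<lambda>t. (norm (f t))\<^sup>2 * exp (- 2 * 1 * t)) = integral {0..T} (\<lambda>t. 0)"
      using f0 T by (intro Henstock_Kurzweil_Integration.integral_cong) auto
    finally have "((norm (tderiv 1 u T))\<^sup>2 + (norm (p T))\<^sup>2) * exp (- 2 * T)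
        + integral {0..T} (\<lambda>t. (norm (tderiv 1 u t))\<^sup>2 * exp (- 2 * t)) \<le> 0" by simp
    moreover have "0 \<le> integral {0..T} (\<lambda>t. (norm (tderiv 1 u t))\<^sup>2 * exp (- 2 * t))"
      by (intro Henstock_Kurzweil_Integration.integral_nonneg integrable_continuous_interval continuous_intros)
         (auto intro: continuous_on_subset[OF c1, simplified])
    ultimately have "((norm (tderiv 1 u T))\<^sup>2 + (norm (p T))\<^sup>2) * exp (- 2 * T) \<le> 0" by linarith
    then have "(norm (tderiv 1 u T))\<^sup>2 + (norm (p T))\<^sup>2 \<le> 0"
      by (simp add: mult_le_0_iff)
    then show ?thesis by (smt (verit) norm_eq_zero power2_less_0 zero_le_power2 power_eq_0_iff)
  qed
  have sub: "{0..<\<epsilon>} \<subseteq> {0..}" by auto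
  have "\<exists>c. \<forall>s\<in>{0..<\<epsilon>}. u s = c"
  proof (rule has_vector_derivative_zero_constant)
    show "(u has_vector_derivative 0) (at s within {0..<\<epsilon>})" if "s \<in> {0..<\<epsilon>}" for s
      using d(1)[of s] v0[of s] that has_vector_derivative_within_subset[OF _ sub] by auto
  qed auto
  then show ?thesis using t uC(2) by (metis atLeastLessThan_iff order_refl order_le_less_trans)
qed

lemma wave_system_zero_past:
  fixes u f :: "real \<Rightarrow> 'v::real_inner" and p :: "real \<Rightarrow> 'w::real_inner"
  assumes u: "u \<in> C20_time Y" and f: "continuous_on {0..} f" and f0: "supported_away_from_zero f"
    and eq: "\<And>t t'. 0 \<le> t \<Longrightarrow> 0 \<le> t' \<Longrightarrow> tderiv 2 u t \<bullet> u t' + p t \<bullet> p t' = f t \<bullet> u t'"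
    and p0: "p 0 = 0"
  shows "wave_system (zero_past u) (zero_past (tderiv 1 u)) (zero_past (tderiv 2 u)) (zero_past p) (zero_past f)"
proof -
  obtain \<epsilon> where eps: "0 < \<epsilon>" and fe: "\<And>t. 0 \<le> t \<Longrightarrow> t < \<epsilon> \<Longrightarrow> f t = 0"
    using f0 by (auto simp: supported_away_from_zero_def)
  have ue: "tderiv i u t = 0" if "0 \<le> t" "t < \<epsilon>" for t i
    by (rule tderiv_eq_0[OF wave_vanishes_initially[OF u f fe eq p0] that])
  have uC: "u \<in> C_time 2 Y" using u by (auto simp: C20_time_def)
  have d: "(zero_past (tderiv i u) has_vector_derivative zero_past (tderiv (Suc i) u) t) (at t)" if "i < 2" for i t
    by (rule has_vector_derivative_zero_past[OF eps has_vector_derivative_tderiv[OF uC that]]) (use ue in \<open>auto simp del: tderiv.simps\<close>)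
  have "continuous_on UNIV (zero_past (tderiv 2 u))" "continuous_on UNIV (zero_past f)"
    using uC by (auto intro!: continuous_on_zero_past[OF eps] f ue fe simp: C_time_def)
  then show ?thesis using d[of 0] d[of 1] eq
    by (auto simp: wave_system_def zero_past_def numeral_2_eq_2 simp del: tderiv.simps(2))
qed

lemma zero_past_derivatives:
  fixes f :: "real \<Rightarrow> 'v::real_normed_vector"
  assumes f: "f \<in> C_time r Y" and f0: "supported_away_from_zero f"
  shows "j < r \<Longrightarrow> (zero_past (tderiv j f) has_vector_derivative zero_past (tderiv (Suc j) f) t) (at t)"
    and "continuous_on UNIV (zero_past (tderiv r f))"
proof -
  obtain \<epsilon> where eps: "0 < \<epsilon>" and fe: "\<And>t. 0 \<le> t \<Longrightarrow> t < \<epsilon> \<Longrightarrow> f t = 0"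
    using f0 by (auto simp: supported_away_from_zero_def)
  note z = tderiv_eq_0[where v = f and \<epsilon> = \<epsilon>, OF fe]
  show "j < r \<Longrightarrow> (zero_past (tderiv j f) has_vector_derivative zero_past (tderiv (Suc j) f) t) (at t)"
    by (rule has_vector_derivative_zero_past[OF eps has_vector_derivative_tderiv[OF f]]) (use z in \<open>auto simp del: tderiv.simps\<close>)
  show "continuous_on UNIV (zero_past (tderiv r f))"
    by (rule continuous_on_zero_past[OF eps _ z]) (use f in \<open>auto simp: C_time_def\<close>)
qed

lemma damped_integral_zero_past:
  "damped_integral \<rho> (\<lambda>t. g (zero_past v t)) = damped_integral \<rho> (\<lambda>t. g (v t))"
proof (rule damped_integral_cong_AE)
  show "AE t in lborel. 0 \<le> t \<longrightarrow> g (zero_past v t) = g (v t)"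
    using AE_lborel_singleton[of 0] by eventually_elim (auto simp: zero_past_def)
qed

text \<open>
  The outcome of the analysis in time, for a solution on the half line and its one-sided derivatives.
\<close>

lemma projected_acceleration_bound:
  fixes u f :: "real \<Rightarrow> 'v::real_inner" and p :: "real \<Rightarrow> 'w::real_inner" and Q :: "'v \<Rightarrow> 'v"
  assumes u: "u \<in> C20_time Y" and f: "f \<in> C_time (Suc m) Y'" and f0: "supported_away_from_zero f"
    and eq: "\<And>t t'. 0 \<le> t \<Longrightarrow> 0 \<le> t' \<Longrightarrow> tderiv 2 u t \<bullet> u t' + p t \<bullet> p t' = f t \<bullet> u t'"
    and p0: "p 0 = 0" and rho: "0 < \<rho>" and H: "0 \<le> H"
    and Q: "bounded_linear Q" "\<And>x. norm (Q x) \<le> norm x"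
  shows "ennreal (H\<^sup>2) * damped_norm_sq \<rho> (\<lambda>t. Q (tderiv 2 u t))
    \<le> ennreal (interp_const m) * damped_norm_sq \<rho> (\<lambda>t. Q (tderiv 1 u t))
     + 2 * (ennreal (H ^ (2 * Suc m) / \<rho>\<^sup>2) * damped_norm_sq \<rho> (tderiv (Suc m) f))"
proof -
  interpret Q: bounded_linear Q by fact
  have "continuous_on {0..} (tderiv 0 f)"
    unfolding continuous_on_eq_continuous_within
    using has_vector_derivative_continuous[OF has_vector_derivative_tderiv[OF f]] by (auto simp del: tderiv.simps)
  then have w: "wave_system (zero_past u) (zero_past (tderiv 1 u)) (zero_past (tderiv 2 u)) (zero_past p) (zero_past (tderiv 0 f))"
    using wave_system_zero_past[OF u _ f0 eq p0] by simp
  have "ennreal (H\<^sup>2) * damped_norm_sq \<rho> (\<lambda>t. Q (zero_past (tderiv 2 u) t))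
    \<le> ennreal (interp_const m) * damped_norm_sq \<rho> (\<lambda>t. Q (zero_past (tderiv 1 u) t))
     + 2 * (ennreal (H ^ (2 * Suc m) / \<rho>\<^sup>2) * damped_norm_sq \<rho> (zero_past (tderiv (Suc m) f)))"
    by (rule wave_acceleration_interpolation[where F = "\<lambda>j. zero_past (tderiv j f)",
          OF w rho H zero_past_derivatives[OF f f0] _ Q]) (simp_all add: zero_past_def)
  then show ?thesis
    unfolding damped_integral_zero_past[where g = "\<lambda>x. ennreal ((norm (Q x))\<^sup>2)"]
      damped_integral_zero_past[where g = "\<lambda>x. ennreal ((norm x)\<^sup>2)"] .
qed


section \<open>Uniqueness of the weak gradient\<close>

lemma inner_l2_of:
  assumes "square_integrable f" "square_integrable g"
  shows "l2_of f \<bullet> l2_of g = (\<integral>x. f x \<bullet> g x \<partial>lebesgue)"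
  unfolding l2_of_def using assms by (intro inner_l2.abs_eq) (auto simp: l2_rel_def)

lemma l2_of_add:
  assumes "square_integrable f" "square_integrable g"
  shows "l2_of (\<lambda>x. f x + g x) = l2_of f + l2_of g"
  unfolding l2_of_def using assms by (intro plus_l2.abs_eq[symmetric]) (auto simp: l2_rel_def)

lemma l2_of_scaleR:
  assumes "square_integrable f"
  shows "l2_of (\<lambda>x. c *\<^sub>R f x) = c *\<^sub>R l2_of f"
  unfolding l2_of_def using assms by (intro scaleR_l2.abs_eq[symmetric]) (auto simp: l2_rel_def)

lemma l2_of_zero: "l2_of (\<lambda>_. 0) = 0"
  by (simp add: l2_of_def zero_l2_def)

lemma l2_of_exhaust:
  obtains f where "square_integrable f" "v = l2_of f"
proof -
  have "\<exists>f. square_integrable f \<and> v = l2_of f"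
    unfolding l2_of_def by (induction v rule: l2.abs_induct) (auto simp: l2_rel_def)
  then show ?thesis using that by blast
qed

lemma l2_of_eq_0:
  assumes "square_integrable f" "AE x in lebesgue. f x = 0"
  shows "l2_of f = 0"
proof -
  have "l2_of f \<bullet> l2_of f = (\<integral>x. f x \<bullet> f x \<partial>lebesgue)" using assms by (simp add: inner_l2_of)
  also have "\<dots> = 0"
    using assms(2) by (intro integral_eq_zero_AE) (auto elim: eventually_mono)
  finally show ?thesis by simp
qed

lemma vanishes_outside_l2_of:
  assumes "square_integrable f"
  shows "vanishes_outside \<Omega> (l2_of f) \<longleftrightarrow> (AE x in lebesgue. x \<notin> \<Omega> \<longrightarrow> f x = 0)"
  unfolding l2_of_def using assms by (intro vanishes_outside.abs_eq) (auto simp: l2_rel_def)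

lemma L2_on_add: "v \<in> L2_on \<Omega> \<Longrightarrow> w \<in> L2_on \<Omega> \<Longrightarrow> v + w \<in> L2_on \<Omega>"
proof -
  assume a: "v \<in> L2_on \<Omega>" "w \<in> L2_on \<Omega>"
  obtain f g where f: "square_integrable f" "v = l2_of f" and g: "square_integrable g" "w = l2_of g"
    using l2_of_exhaust[of v] l2_of_exhaust[of w] by metis
  from a have "AE x in lebesgue. x \<notin> \<Omega> \<longrightarrow> f x = 0" "AE x in lebesgue. x \<notin> \<Omega> \<longrightarrow> g x = 0"
    by (simp_all add: L2_on_def f g vanishes_outside_l2_of)
  then have "AE x in lebesgue. x \<notin> \<Omega> \<longrightarrow> f x + g x = 0" by eventually_elim simp
  then show ?thesis
    by (simp add: L2_on_def f(2) g(2) l2_of_add[OF f(1) g(1), symmetric] vanishes_outside_l2_of square_integrable_add f(1) g(1))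
qed

lemma L2_on_scaleR: "v \<in> L2_on \<Omega> \<Longrightarrow> c *\<^sub>R v \<in> L2_on \<Omega>"
proof -
  assume a: "v \<in> L2_on \<Omega>"
  obtain f where f: "square_integrable f" "v = l2_of f" using l2_of_exhaust[of v] by metis
  from a have "AE x in lebesgue. x \<notin> \<Omega> \<longrightarrow> f x = 0"
    by (simp add: L2_on_def f vanishes_outside_l2_of)
  then have "AE x in lebesgue. x \<notin> \<Omega> \<longrightarrow> c *\<^sub>R f x = 0" by eventually_elim simp
  then show ?thesis
    by (simp only: L2_on_def f(2) l2_of_scaleR[OF f(1), symmetric] vanishes_outside_l2_of[OF square_integrable_scaleR[OF f(1)]] mem_Collect_eq)
qed

lemma L2_on_0: "0 \<in> L2_on \<Omega>"
  unfolding l2_of_zero[symmetric] by (simp add: L2_on_def vanishes_outside_l2_of square_integrable_0)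

lemma square_integrable_compact_support:
  fixes g :: "'a::euclidean_space \<Rightarrow> 'b::euclidean_space"
  assumes K: "compact K" and c: "continuous_on K g" and z: "\<And>x. x \<notin> K \<Longrightarrow> g x = 0"
  shows "square_integrable g"
proof -
  have "g = (\<lambda>x. indicator K x *\<^sub>R g x)" using z by (auto simp: fun_eq_iff indicator_def)
  moreover have "(\<lambda>x. indicator K x *\<^sub>R g x) \<in> borel_measurable borel"
    using borel_measurable_continuous_on_indicator[OF _ c] K by (simp add: borel_compact)
  ultimately have m: "g \<in> borel_measurable borel" by simp
  have e: "(\<lambda>x. (norm (g x))\<^sup>2) = (\<lambda>x. indicator K x *\<^sub>R (norm (g x))\<^sup>2)"
    using z by (auto simp: fun_eq_iff indicator_def)
  have "integrable lborel (\<lambda>x. (norm (g x))\<^sup>2)"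
    by (subst e, rule borel_integrable_compact[OF K]) (intro continuous_intros c)
  then have "integrable lebesgue (\<lambda>x. (norm (g x))\<^sup>2)"
    using m by (subst integrable_completion) auto
  moreover have "g \<in> borel_measurable lebesgue"
    using m by (intro measurable_completion) simp
  ultimately show ?thesis by (simp add: square_integrable_def)
qed

text \<open>
  For \<open>k = 0\<close> the standard smooth function that vanishes on the negative half line. The powers of \<open>1/t\<close> are
  included because they arise from its derivatives.
\<close>

definition flat :: "nat \<Rightarrow> real \<Rightarrow> real" where
  "flat k t = (if 0 < t then inverse t ^ k * exp (- inverse t) else 0)"

lemma flat_tendsto_0: "(flat k \<longlongrightarrow> 0) (at 0)"
proof (rule filterlim_split_at)
  have "\<forall>\<^sub>F t in at_left 0. flat k t = 0"
    by (auto simp: eventually_at_left_field flat_def intro: exI[of _ "-1"])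
  then show "(flat k \<longlongrightarrow> 0) (at_left 0)" by (rule tendsto_eventually)
  have "((\<lambda>t. inverse t ^ k / exp (inverse t)) \<longlongrightarrow> (0::real)) (at_right 0)"
    by (rule filterlim_compose[OF tendsto_power_div_exp_0 filterlim_inverse_at_top_right])
  moreover have "\<forall>\<^sub>F t in at_right 0. inverse t ^ k / exp (inverse t) = flat k t"
    by (auto simp: eventually_at_right_field flat_def exp_minus divide_inverse intro: exI[of _ 1])
  ultimately show "(flat k \<longlongrightarrow> 0) (at_right 0)" by (rule Lim_transform_eventually)
qed

lemma flat_has_derivative:
  "(flat k has_real_derivative flat (k + 2) t - real k * flat (k + 1) t) (at t)"
proof (cases t "0 :: real" rule: linorder_cases)
  case less
  have "\<forall>\<^sub>F s in nhds t. flat k s = 0"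
    unfolding eventually_nhds by (rule exI[of _ "{..<0}"]) (use less in \<open>auto simp: flat_def\<close>)
  then have "(flat k has_real_derivative 0) (at t)"
    using DERIV_cong_ev[of t t "flat k" "\<lambda>_. 0" 0 0] by simp
  then show ?thesis using less by (simp add: flat_def)
next
  case equal
  have "((\<lambda>s. (flat k s - flat k 0) / (s - 0)) \<longlongrightarrow> 0) (at 0)"
    using flat_tendsto_0[of "Suc k"]
    by (rule Lim_transform_eventually) (auto simp: flat_def divide_inverse intro!: always_eventually)
  then show ?thesis using equal by (simp add: has_field_derivative_iff flat_def)
next
  case greater
  have ev: "\<forall>\<^sub>F s in nhds t. flat k s = inverse s ^ k * exp (- inverse s)"
    unfolding eventually_nhds by (rule exI[of _ "{0<..}"]) (use greater in \<open>auto simp: flat_def\<close>)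
  have "((\<lambda>s. inverse s ^ k) has_real_derivative - real k * inverse t ^ (k + 1)) (at t)"
  proof (cases k)
    case (Suc n)
    have "((\<lambda>s. inverse s ^ k) has_real_derivative real k * (- (inverse t ^ Suc (Suc 0)) * inverse t ^ (k - Suc 0))) (at t)"
      by (rule DERIV_power[OF DERIV_inverse]) (use greater in simp)
    then show ?thesis by (rule DERIV_cong) (simp add: Suc algebra_simps)
  qed simp
  moreover have "((\<lambda>s. exp (- inverse s)) has_real_derivative exp (- inverse t) * inverse t ^ 2) (at t)"
    by (rule DERIV_cong[OF DERIV_fun_exp[OF DERIV_minus[OF DERIV_inverse]]]) (use greater in \<open>auto simp: power2_eq_square\<close>)
  ultimately have "((\<lambda>s. inverse s ^ k * exp (- inverse s)) has_real_derivative
     - real k * inverse t ^ (k + 1) * exp (- inverse t) + exp (- inverse t) * inverse t ^ 2 * inverse t ^ k) (at t)"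
    by (rule DERIV_mult)
  then have "(flat k has_real_derivative
     - real k * inverse t ^ (k + 1) * exp (- inverse t) + exp (- inverse t) * inverse t ^ 2 * inverse t ^ k) (at t)"
    using DERIV_cong_ev[OF refl ev refl] by simp
  then show ?thesis using greater by (simp add: flat_def mult_ac power2_eq_square)
qed

text \<open>
  A class of functions that contains the bumps below and is closed under directional derivatives; membership
  therefore implies smoothness of every order by a single induction.
\<close>

inductive flat_algebra :: "('a::euclidean_space \<Rightarrow> real) \<Rightarrow> bool" where
  const: "flat_algebra (\<lambda>_. c)"
| flat: "flat_algebra (\<lambda>x. flat k (x \<bullet> v + c))"
| add: "flat_algebra \<phi> \<Longrightarrow> flat_algebra \<psi> \<Longrightarrow> flat_algebra (\<lambda>x. \<phi> x + \<psi> x)"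
| mult: "flat_algebra \<phi> \<Longrightarrow> flat_algebra \<psi> \<Longrightarrow> flat_algebra (\<lambda>x. \<phi> x * \<psi> x)"

lemma flat_algebra_derivative:
  assumes "flat_algebra \<phi>"
  shows "(\<forall>x. \<phi> differentiable (at x)) \<and> (\<forall>b. flat_algebra (\<lambda>x. frechet_derivative \<phi> (at x) b))"
  using assms
proof induction
  case (const c)
  then show ?case by (simp add: frechet_derivative_const flat_algebra.const)
next
  case (flat k v c)
  have d: "((\<lambda>x. flat k (x \<bullet> v + c)) has_derivative
     (\<lambda>h. (flat (k + 2) (x \<bullet> v + c) - real k * flat (k + 1) (x \<bullet> v + c)) * (h \<bullet> v))) (at x)" for x
  proof -
    have "((\<lambda>x. x \<bullet> v + c) has_derivative (\<lambda>h. h \<bullet> v)) (at x)"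
      by (auto intro!: derivative_eq_intros)
    from has_derivative_compose[OF this flat_has_derivative[unfolded has_field_derivative_def]]
    show ?thesis by simp
  qed
  have "flat_algebra (\<lambda>x. (flat (k + 2) (x \<bullet> v + c) + (- real k) * flat (k + 1) (x \<bullet> v + c)) * (b \<bullet> v))" for b
    by (intro flat_algebra.intros)
  then show ?case using d by (auto simp: frechet_derivative_at[OF d, symmetric] differentiable_def)
next
  case (add \<phi> \<psi>)
  have d: "((\<lambda>x. \<phi> x + \<psi> x) has_derivative (\<lambda>h. frechet_derivative \<phi> (at x) h + frechet_derivative \<psi> (at x) h)) (at x)" for x
    using add.IH by (intro has_derivative_add) (auto simp: frechet_derivative_works)
  have "flat_algebra (\<lambda>x. frechet_derivative \<phi> (at x) b + frechet_derivative \<psi> (at x) b)" for b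
    using add by (intro flat_algebra.add) auto
  then show ?case using d by (auto simp: frechet_derivative_at[OF d, symmetric] differentiable_def)
next
  case (mult \<phi> \<psi>)
  have d: "((\<lambda>x. \<phi> x * \<psi> x) has_derivative (\<lambda>h. \<phi> x * frechet_derivative \<psi> (at x) h + frechet_derivative \<phi> (at x) h * \<psi> x)) (at x)" for x
    using mult.IH by (intro has_derivative_mult) (auto simp: frechet_derivative_works)
  have "flat_algebra (\<lambda>x. \<phi> x * frechet_derivative \<psi> (at x) b + frechet_derivative \<phi> (at x) b * \<psi> x)" for b
    using mult by (intro flat_algebra.add flat_algebra.mult) auto
  then show ?case using d by (auto simp: frechet_derivative_at[OF d, symmetric] differentiable_def)
qed

lemma flat_algebra_Ck: "flat_algebra \<phi> \<Longrightarrow> Ck_fun k \<phi>"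
proof (induction k arbitrary: \<phi>)
  case 0
  then show ?case
    using flat_algebra_derivative[OF 0] by (auto intro!: continuous_at_imp_continuous_on differentiable_imp_continuous_within)
next
  case (Suc k)
  then show ?case using flat_algebra_derivative[OF Suc.prems] by auto
qed

lemma flat_algebra_prod:
  "finite I \<Longrightarrow> (\<And>i. i \<in> I \<Longrightarrow> flat_algebra (\<phi> i)) \<Longrightarrow> flat_algebra (\<lambda>x. \<Prod>i\<in>I. \<phi> i x)"
  by (induction I rule: finite_induct) (auto intro: flat_algebra.const flat_algebra.mult)

text \<open>
  The factors are \<open>exp (- 1 / ((n + 1) s))\<close> in the distances \<open>s\<close> to the faces, so the bumps increase to the indicator
  function of the open box.
\<close>

definition box_bump :: "'a::euclidean_space \<Rightarrow> 'a \<Rightarrow> nat \<Rightarrow> 'a \<Rightarrow> real" where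
  "box_bump a b n x = (\<Prod>i\<in>Basis. flat 0 (real (Suc n) * (x \<bullet> i - a \<bullet> i)) * flat 0 (real (Suc n) * (b \<bullet> i - x \<bullet> i)))"

lemma box_bump_smooth: "Ck_fun k (box_bump a b n)"
proof (rule flat_algebra_Ck)
  have "flat_algebra (\<lambda>x. flat 0 (x \<bullet> (real (Suc n) *\<^sub>R i) + (- real (Suc n) * (a \<bullet> i))) * flat 0 (x \<bullet> (- real (Suc n) *\<^sub>R i) + real (Suc n) * (b \<bullet> i)))" for i
    by (intro flat_algebra.intros)
  then have "flat_algebra (\<lambda>x. \<Prod>i\<in>Basis. flat 0 (real (Suc n) * (x \<bullet> i - a \<bullet> i)) * flat 0 (real (Suc n) * (b \<bullet> i - x \<bullet> i)))"
    by (intro flat_algebra_prod) (auto simp: algebra_simps)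
  then show "flat_algebra (box_bump a b n)" by (simp add: box_bump_def[abs_def])
qed

lemma flat_bounds: "0 \<le> flat 0 t" "flat 0 t \<le> 1" by (auto simp: flat_def)

lemma box_bump_bounds: "0 \<le> box_bump a b n x" "box_bump a b n x \<le> 1"
  unfolding box_bump_def by (auto intro!: prod_nonneg prod_le_1 mult_le_one simp: flat_bounds)

lemma box_bump_eq_0: "x \<notin> box a b \<Longrightarrow> box_bump a b n x = 0"
proof -
  assume "x \<notin> box a b"
  then obtain i where "i \<in> Basis" "x \<bullet> i \<le> a \<bullet> i \<or> b \<bullet> i \<le> x \<bullet> i" by (force simp: mem_box)
  then show ?thesis unfolding box_bump_def
    by (intro prod_zero) (auto intro!: bexI[of _ i] simp: flat_def mult_less_0_iff zero_less_mult_iff)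
qed

lemma box_bump_tendsto: "(\<lambda>n. box_bump a b n x) \<longlonglongrightarrow> indicator (box a b) x"
proof (cases "x \<in> box a b")
  case True
  have l: "(\<lambda>n. flat 0 (real (Suc n) * s)) \<longlonglongrightarrow> 1" if "0 < s" for s
  proof -
    have "(\<lambda>n. exp (- (inverse (real (Suc n)) * inverse s))) \<longlonglongrightarrow> exp (- (0 * inverse s))"
      by (intro tendsto_intros LIMSEQ_inverse_real_of_nat)
    then show ?thesis using that by (simp add: flat_def zero_less_mult_iff)
  qed
  have "(\<lambda>n. box_bump a b n x) \<longlonglongrightarrow> (\<Prod>i\<in>(Basis::'a set). 1 * 1)"
    unfolding box_bump_def by (intro tendsto_prod tendsto_mult l) (use True in \<open>auto simp: mem_box\<close>)
  then show ?thesis using True by simp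
qed (simp add: box_bump_eq_0)

lemma box_bump_test_function: 
  assumes "cbox a b \<subseteq> \<Omega>" shows "box_bump a b n \<in> test_functions \<Omega>"
proof -
  have "{x. box_bump a b n x \<noteq> 0} \<subseteq> cbox a b"
    using box_bump_eq_0[of _ a b n] box_subset_cbox[of a b] by blast
  then have "closure {x. box_bump a b n x \<noteq> 0} \<subseteq> cbox a b" by (rule closure_minimal) (rule closed_cbox)
  moreover from this have "compact (closure {x. box_bump a b n x \<noteq> 0})"
    by (meson bounded_cbox bounded_subset closed_closure compact_eq_bounded_closed)
  ultimately show ?thesis using assms by (auto simp: test_functions_def box_bump_smooth)
qed

lemma test_function_smooth: "\<phi> \<in> test_functions \<Omega> \<Longrightarrow> Ck_fun k \<phi>"
  by (simp add: test_functions_def)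

lemma test_function_continuous: "\<phi> \<in> test_functions \<Omega> \<Longrightarrow> continuous_on UNIV \<phi>"
  using test_function_smooth[of \<phi> \<Omega> 0] by simp

lemma test_function_square_integrable:
  assumes "\<phi> \<in> test_functions \<Omega>" 
  shows "square_integrable \<phi>" "square_integrable (\<lambda>x. \<phi> x *\<^sub>R b)"
proof -
  have z: "x \<notin> closure {x. \<phi> x \<noteq> 0} \<Longrightarrow> \<phi> x = 0" for x
    using closure_subset[of "{x. \<phi> x \<noteq> 0}"] by auto
  have K: "compact (closure {x. \<phi> x \<noteq> 0})" using assms by (simp add: test_functions_def)
  have c: "continuous_on S \<phi>" for S by (rule continuous_on_subset[OF test_function_continuous[OF assms]]) simp
  show "square_integrable \<phi>" by (rule square_integrable_compact_support[OF K c z])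
  show "square_integrable (\<lambda>x. \<phi> x *\<^sub>R b)"
  proof (rule square_integrable_compact_support[OF K])
    show "continuous_on (closure {x. \<phi> x \<noteq> 0}) (\<lambda>x. \<phi> x *\<^sub>R b)" by (intro continuous_intros c)
    show "\<phi> x *\<^sub>R b = 0" if "x \<notin> closure {x. \<phi> x \<noteq> 0}" for x
      unfolding z[OF that] by simp
  qed
qed

text \<open>
  Dominated convergence along the bumps gives that \<open>g\<close> has integral zero over every box inside \<open>\<Omega>\<close>, and by
  Lebesgue differentiation almost every value of \<open>g\<close> is a limit of averages over such boxes.
\<close>

lemma fundamental_lemma_variations:
  fixes g :: "'a::euclidean_space \<Rightarrow> real"
  assumes g: "square_integrable g" and op: "open \<Omega>"
    and z: "\<And>\<phi>. \<phi> \<in> test_functions \<Omega> \<Longrightarrow> (\<integral>x. g x * \<phi> x \<partial>lebesgue) = 0"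
  shows "AE x in lebesgue. x \<in> \<Omega> \<longrightarrow> g x = 0"
proof -
  have gm [measurable]: "g \<in> borel_measurable lebesgue" and gi: "integrable lebesgue (\<lambda>x. (g x)\<^sup>2)"
    using g by (auto simp: square_integrable_def)
  have ind: "(\<lambda>x. indicator (box a b) x) \<in> borel_measurable lebesgue" for a b :: 'a
    by (intro borel_measurable_indicator) (simp add: fmeasurableD)
  have loc: "integrable lebesgue (\<lambda>x. \<bar>g x\<bar> * indicator (box a b) x)" for a b
  proof (rule Bochner_Integration.integrable_bound)
    show "integrable lebesgue (\<lambda>x. (g x)\<^sup>2 + indicator (box a b) x)"
      by (intro Bochner_Integration.integrable_add gi integrable_real_indicator) (auto simp: emeasure_lborel_box_eq)
    show "AE x in lebesgue. norm (\<bar>g x\<bar> * indicator (box a b) x) \<le> norm ((g x)\<^sup>2 + indicator (box a b) x)"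
    proof (rule AE_I2)
      fix x
      show "norm (\<bar>g x\<bar> * indicator (box a b) x) \<le> norm ((g x)\<^sup>2 + indicator (box a b) x)"
        using sum_squares_bound[of "\<bar>g x\<bar>" 1] by (auto simp: indicator_def)
    qed
  qed (intro borel_measurable_times borel_measurable_abs gm ind)
  have loc': "integrable lebesgue (\<lambda>x. g x * indicator (box a b) x)" for a b
    by (rule Bochner_Integration.integrable_bound[OF loc[of a b]]) (auto intro!: borel_measurable_times gm ind simp: abs_mult)
  have HK: "(g has_integral (\<integral>x. g x * indicator (box a b) x \<partial>lebesgue)) (cbox a b)" for a b
  proof -
    have "((\<lambda>x. g x * indicator (box a b) x) has_integral (\<integral>x. g x * indicator (box a b) x \<partial>lebesgue)) UNIV"
      by (rule has_integral_integral_lebesgue[OF loc'])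
    then have "((\<lambda>x. if x \<in> box a b then g x else 0) has_integral (\<integral>x. g x * indicator (box a b) x \<partial>lebesgue)) UNIV"
      by (rule has_integral_eq_rhs[OF has_integral_eq, rotated]) (auto simp: indicator_def)
    then show ?thesis by (simp add: has_integral_restrict_UNIV has_integral_open_interval)
  qed
  have zero: "integral (cbox a b) g = 0" if "cbox a b \<subseteq> \<Omega>" for a b
  proof -
    have "(\<lambda>n. \<integral>x. g x * box_bump a b n x \<partial>lebesgue) \<longlonglongrightarrow> (\<integral>x. g x * indicator (box a b) x \<partial>lebesgue)"
    proof (rule integral_dominated_convergence[OF _ _ loc[of a b]])
      show "(\<lambda>x. g x * box_bump a b n x) \<in> borel_measurable lebesgue" for n
        using test_function_square_integrable(1)[OF box_bump_test_function[of a b UNIV n]]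
        by (intro borel_measurable_times) (auto simp: square_integrable_def)
      show "AE x in lebesgue. (\<lambda>n. g x * box_bump a b n x) \<longlonglongrightarrow> g x * indicator (box a b) x"
        by (intro AE_I2 tendsto_intros box_bump_tendsto)
      show "AE x in lebesgue. norm (g x * box_bump a b n x) \<le> \<bar>g x\<bar> * indicator (box a b) x" for n
      proof (rule AE_I2)
        fix x show "norm (g x * box_bump a b n x) \<le> \<bar>g x\<bar> * indicator (box a b) x"
          using box_bump_bounds[of a b n x] box_bump_eq_0[of x a b n]
          by (cases "x \<in> box a b") (auto simp: abs_mult mult_left_le)
      qed
    qed (intro borel_measurable_times gm ind)
    then have "(\<integral>x. g x * indicator (box a b) x \<partial>lebesgue) = 0"
      using z[OF box_bump_test_function[OF that]] by (simp add: LIMSEQ_const_iff)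
    then show ?thesis using HK[of a b] by (simp add: integral_unique)
  qed
  obtain N where N: "negligible N" and diff: "\<And>x e. x \<notin> N \<Longrightarrow> 0 < e \<Longrightarrow>
      \<exists>d>0. \<forall>h. 0 < h \<and> h < d \<longrightarrow> norm (integral (cbox x (x + h *\<^sub>R One)) g /\<^sub>R h ^ DIM('a) - g x) < e"
    using integrable_ccontinuous_explicit[of g, OF has_integral_integrable[OF HK]] by blast
  have zN: "g x = 0" if x: "x \<in> \<Omega>" "x \<notin> N" for x
  proof (rule ccontr)
    assume "g x \<noteq> 0"
    then obtain d where d: "0 < d" "\<And>h. 0 < h \<Longrightarrow> h < d \<Longrightarrow> norm (integral (cbox x (x + h *\<^sub>R One)) g /\<^sub>R h ^ DIM('a) - g x) < \<bar>g x\<bar>"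
      using diff[OF x(2), of "\<bar>g x\<bar>"] by auto
    obtain r where r: "0 < r" "cball x r \<subseteq> \<Omega>" using op x(1) open_contains_cball by blast
    define h where "h = min (d / 2) (r / norm (One :: 'a))"
    have One: "0 < norm (One :: 'a)" by simp
    have h: "0 < h" "h < d" using d(1) r(1) One by (auto simp: h_def)
    have "cbox x (x + h *\<^sub>R One) \<subseteq> cball x r"
    proof
      fix y assume y: "y \<in> cbox x (x + h *\<^sub>R One)"
      have "norm (y - x) \<le> norm (h *\<^sub>R (One :: 'a))"
        using y h(1) by (intro norm_le_componentwise) (auto simp: mem_box inner_simps)
      also have "\<dots> = h * norm (One :: 'a)" using h(1) by simp
      also have "\<dots> \<le> r" using One by (simp add: h_def min_def field_simps)
      finally show "y \<in> cball x r" by (simp add: dist_norm norm_minus_commute)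
    qed
    then have "integral (cbox x (x + h *\<^sub>R One)) g = 0" using r(2) by (intro zero) blast
    then show False using d(2)[OF h] by simp
  qed
  have "AE x in lebesgue. x \<notin> N"
    using N by (intro AE_not_in) (simp add: negligible_iff_null_sets)
  then show ?thesis by eventually_elim (use zN in blast)
qed

lemma weak_grad_unique:
  assumes op: "open \<Omega>" and G: "is_weak_grad \<Omega> v G" "is_weak_grad \<Omega> v G'"
  shows "G = G'"
proof -
  have "G + (- 1) *\<^sub>R G' \<in> L2_on \<Omega>"
    using G by (intro L2_on_add L2_on_scaleR) (auto simp: is_weak_grad_def)
  then have D: "G - G' \<in> L2_on \<Omega>" by simp
  obtain d where d: "square_integrable d" "G - G' = l2_of d" by (rule l2_of_exhaust)
  have out: "AE x in lebesgue. x \<notin> \<Omega> \<longrightarrow> d x = 0"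
    using D by (simp add: L2_on_def d vanishes_outside_l2_of)
  have "AE x in lebesgue. x \<in> \<Omega> \<longrightarrow> d x \<bullet> b = 0" if b: "b \<in> Basis" for b
  proof (rule fundamental_lemma_variations[OF _ op])
    show "square_integrable (\<lambda>x. d x \<bullet> b)"
      unfolding square_integrable_def
    proof
      show m: "(\<lambda>x. d x \<bullet> b) \<in> borel_measurable lebesgue" using d by (auto simp: square_integrable_def)
      show "integrable lebesgue (\<lambda>x. (norm (d x \<bullet> b))\<^sup>2)"
      proof (rule Bochner_Integration.integrable_bound)
        show "integrable lebesgue (\<lambda>x. (norm (d x))\<^sup>2)" using d by (simp add: square_integrable_def)
        show "AE x in lebesgue. norm ((norm (d x \<bullet> b))\<^sup>2) \<le> norm ((norm (d x))\<^sup>2)"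
          using power_mono[OF Basis_le_norm[OF b], of _ 2] by (intro AE_I2) simp
      qed (use m in measurable)
    qed
    fix \<phi> assume \<phi>: "\<phi> \<in> test_functions \<Omega>"
    have "(\<integral>x. d x \<bullet> b * \<phi> x \<partial>lebesgue) = (\<integral>x. d x \<bullet> (\<phi> x *\<^sub>R b) \<partial>lebesgue)"
      by (simp add: mult.commute)
    also have "\<dots> = (G - G') \<bullet> l2_of (\<lambda>x. \<phi> x *\<^sub>R b)"
      unfolding d(2) by (rule inner_l2_of[symmetric, OF d(1) test_function_square_integrable(2)[OF \<phi>]])
    also have "\<dots> = 0"
      using G \<phi> b by (simp add: is_weak_grad_def inner_diff_left)
    finally show "(\<integral>x. d x \<bullet> b * \<phi> x \<partial>lebesgue) = 0" .
  qed
  then have "AE x in lebesgue. \<forall>b\<in>Basis. x \<in> \<Omega> \<longrightarrow> d x \<bullet> b = 0"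
    by (subst AE_finite_all) auto
  with out have "AE x in lebesgue. d x = 0"
  proof eventually_elim
    case (elim x)
    then show ?case using euclidean_all_zero_iff[of "d x"] by (cases "x \<in> \<Omega>") auto
  qed
  then have "G - G' = 0" unfolding d(2) by (rule l2_of_eq_0[OF d(1)])
  then show ?thesis by simp
qed

lemma grad_eqI:
  assumes "open \<Omega>" "is_weak_grad \<Omega> v G"
  shows "grad \<Omega> v = G"
  unfolding grad_def
proof (rule the_equality[where P = "is_weak_grad \<Omega> v", OF assms(2)])
  show "G' = G" if "is_weak_grad \<Omega> v G'" for G' using weak_grad_unique[OF assms(1) that assms(2)] .
qed

lemma is_weak_grad_grad:
  assumes "open \<Omega>" "v \<in> H1 \<Omega>"
  shows "is_weak_grad \<Omega> v (grad \<Omega> v)"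
proof -
  obtain G where G: "is_weak_grad \<Omega> v G" using assms(2) unfolding H1_def by blast
  then show ?thesis using grad_eqI[OF assms(1) G] by simp
qed

lemma is_weak_grad_add_scaleR:
  assumes "is_weak_grad \<Omega> v G" "is_weak_grad \<Omega> w K"
  shows "is_weak_grad \<Omega> (v + c *\<^sub>R w) (G + c *\<^sub>R K)"
  using assms by (auto simp: is_weak_grad_def inner_add_left L2_on_add L2_on_scaleR algebra_simps)

lemma H1_add_scaleR:
  assumes "v \<in> H1 \<Omega>" "w \<in> H1 \<Omega>" shows "v + c *\<^sub>R w \<in> H1 \<Omega>"
proof -
  obtain G K where "is_weak_grad \<Omega> v G" "is_weak_grad \<Omega> w K" using assms unfolding H1_def by blast
  from is_weak_grad_add_scaleR[OF this] show ?thesis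
    using assms unfolding H1_def by (blast intro: L2_on_add L2_on_scaleR)
qed

lemma grad_add_scaleR:
  assumes "open \<Omega>" "v \<in> H1 \<Omega>" "w \<in> H1 \<Omega>"
  shows "grad \<Omega> (v + c *\<^sub>R w) = grad \<Omega> v + c *\<^sub>R grad \<Omega> w"
  by (rule grad_eqI[OF assms(1) is_weak_grad_add_scaleR[OF is_weak_grad_grad[OF assms(1,2)] is_weak_grad_grad[OF assms(1,3)]]])


section \<open>The finite element space and its projection\<close>

lemma Ck_fun_add_scale:
  "Ck_fun k \<phi> \<Longrightarrow> Ck_fun k \<psi> \<Longrightarrow> Ck_fun k (\<lambda>x. \<phi> x + c * \<psi> x)"
proof (induction k arbitrary: \<phi> \<psi>)
  case 0
  then show ?case by (auto intro!: continuous_intros)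
next
  case (Suc k)
  have d: "((\<lambda>x. \<phi> x + c * \<psi> x) has_derivative
      (\<lambda>h. frechet_derivative \<phi> (at x) h + c * frechet_derivative \<psi> (at x) h)) (at x)" for x
    using Suc.prems by (intro has_derivative_add has_derivative_mult_right) (auto simp: frechet_derivative_works)
  have "Ck_fun k (\<lambda>x. frechet_derivative \<phi> (at x) b + c * frechet_derivative \<psi> (at x) b)" if "b \<in> Basis" for b
    using Suc.prems that by (intro Suc.IH) auto
  moreover have "frechet_derivative (\<lambda>x. \<phi> x + c * \<psi> x) (at x) = 
      (\<lambda>h. frechet_derivative \<phi> (at x) h + c * frechet_derivative \<psi> (at x) h)" for x
    by (rule frechet_derivative_at[OF d, symmetric])
  moreover have "(\<lambda>x. \<phi> x + c * \<psi> x) differentiable (at x)" for x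
    using d unfolding differentiable_def by blast
  ultimately show ?case by simp
qed

lemma test_function_differentiable: "\<phi> \<in> test_functions \<Omega> \<Longrightarrow> \<phi> differentiable (at x)"
  using test_function_smooth[of \<phi> \<Omega> 1] by simp

lemma test_functions_add_scale:
  assumes "\<phi> \<in> test_functions \<Omega>" "\<psi> \<in> test_functions \<Omega>"
  shows "(\<lambda>x. \<phi> x + c * \<psi> x) \<in> test_functions \<Omega>"
proof -
  let ?S = "\<lambda>\<phi>. closure {x. \<phi> x \<noteq> (0::real)}"
  have "?S (\<lambda>x. \<phi> x + c * \<psi> x) \<subseteq> ?S \<phi> \<union> ?S \<psi>"
    unfolding closure_Un[symmetric] by (rule closure_mono) auto
  moreover have "compact (?S \<phi> \<union> ?S \<psi>)" "?S \<phi> \<union> ?S \<psi> \<subseteq> \<Omega>"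
    using assms by (auto simp: test_functions_def)
  moreover have "compact (?S (\<lambda>x. \<phi> x + c * \<psi> x))"
    using compact_Int_closed[OF calculation(2) closed_closure[of "{x. \<phi> x + c * \<psi> x \<noteq> 0}"]]
    unfolding Int_absorb1[OF calculation(1)] .
  ultimately show ?thesis
    using assms by (auto simp: test_functions_def intro: Ck_fun_add_scale)
qed

lemma classical_grad_add_scale:
  assumes "\<phi> \<in> test_functions \<Omega>" "\<psi> \<in> test_functions \<Omega>"
  shows "classical_grad (\<lambda>x. \<phi> x + c * \<psi> x) = (\<lambda>x. classical_grad \<phi> x + c *\<^sub>R classical_grad \<psi> x)"
proof
  fix x
  have "((\<lambda>x. \<phi> x + c * \<psi> x) has_derivative
      (\<lambda>h. frechet_derivative \<phi> (at x) h + c * frechet_derivative \<psi> (at x) h)) (at x)"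
    using test_function_differentiable[OF assms(1)] test_function_differentiable[OF assms(2)]
    by (intro has_derivative_add has_derivative_mult_right) (auto simp: frechet_derivative_works)
  from frechet_derivative_at[OF this, symmetric]
  show "classical_grad (\<lambda>x. \<phi> x + c * \<psi> x) x = classical_grad \<phi> x + c *\<^sub>R classical_grad \<psi> x"
    unfolding classical_grad_def by (simp add: scaleR_add_left sum.distrib scaleR_sum_right)
qed

lemma classical_grad_square_integrable:
  assumes \<phi>: "\<phi> \<in> test_functions \<Omega>"
  shows "square_integrable (classical_grad \<phi>)"
proof (rule square_integrable_compact_support)
  let ?K = "closure {x. \<phi> x \<noteq> 0}"
  show "compact ?K" using \<phi> by (simp add: test_functions_def)
  have "continuous_on UNIV (\<lambda>x. frechet_derivative \<phi> (at x) b)" if "b \<in> Basis" for b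
    using test_function_smooth[OF \<phi>, of 1] that by simp
  then have "continuous_on ?K (\<lambda>x. frechet_derivative \<phi> (at x) b)" if "b \<in> Basis" for b
    using that continuous_on_subset by blast
  then show "continuous_on ?K (classical_grad \<phi>)"
    unfolding classical_grad_def by (intro continuous_intros) auto
  fix x assume x: "x \<notin> ?K"
  have "(\<phi> has_derivative (\<lambda>_. 0)) (at x)"
  proof (rule has_derivative_transform_within_open[of "\<lambda>_. 0" "\<lambda>_. 0"])
    show "open (- ?K)" by (rule open_Compl[OF closed_closure])
    show "0 = \<phi> y" if "y \<in> - ?K" for y
      using that closure_subset[of "{x. \<phi> x \<noteq> 0}"] by auto
  qed (use x in auto)
  from frechet_derivative_at[OF this, symmetric] show "classical_grad \<phi> x = 0"
    by (simp add: classical_grad_def)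
qed

lemma H10_H1: "v \<in> H10 \<Omega> \<Longrightarrow> v \<in> H1 \<Omega>"
  by (simp add: H10_def)

text \<open>
  The sequences of test functions are combined; the gradient of the limit is identified by linearity of
  the weak gradient.
\<close>

lemma H10_add_scaleR:
  assumes op: "open \<Omega>" and v: "v \<in> H10 \<Omega>" and w: "w \<in> H10 \<Omega>"
  shows "v + c *\<^sub>R w \<in> H10 \<Omega>"
proof -
  obtain \<phi> where \<phi>: "\<And>n. \<phi> n \<in> test_functions \<Omega>" "(\<lambda>n. l2_of (\<phi> n)) \<longlonglongrightarrow> v" "(\<lambda>n. l2_of (classical_grad (\<phi> n))) \<longlonglongrightarrow> grad \<Omega> v"
    using v unfolding H10_def by blast
  obtain \<psi> where \<psi>: "\<And>n. \<psi> n \<in> test_functions \<Omega>" "(\<lambda>n. l2_of (\<psi> n)) \<longlonglongrightarrow> w" "(\<lambda>n. l2_of (classical_grad (\<psi> n))) \<longlonglongrightarrow> grad \<Omega> w"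
    using w unfolding H10_def by blast
  define \<zeta> where "\<zeta> n = (\<lambda>x. \<phi> n x + c * \<psi> n x)" for n
  have "l2_of (\<zeta> n) = l2_of (\<phi> n) + c *\<^sub>R l2_of (\<psi> n)" for n
    using l2_of_add[OF test_function_square_integrable(1)[OF \<phi>(1)] square_integrable_scaleR[OF test_function_square_integrable(1)[OF \<psi>(1)]], of n c n]
      l2_of_scaleR[OF test_function_square_integrable(1)[OF \<psi>(1)], of c n]
    by (simp add: \<zeta>_def)
  then have 1: "(\<lambda>n. l2_of (\<zeta> n)) \<longlonglongrightarrow> v + c *\<^sub>R w" using \<phi>(2) \<psi>(2) by (auto intro!: tendsto_intros)
  have "l2_of (classical_grad (\<zeta> n)) = l2_of (classical_grad (\<phi> n)) + c *\<^sub>R l2_of (classical_grad (\<psi> n))" for n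
    unfolding \<zeta>_def classical_grad_add_scale[OF \<phi>(1) \<psi>(1)]
    using l2_of_add[OF classical_grad_square_integrable[OF \<phi>(1)] square_integrable_scaleR[OF classical_grad_square_integrable[OF \<psi>(1)]], of n c n]
      l2_of_scaleR[OF classical_grad_square_integrable[OF \<psi>(1)], of c n]
    by simp
  then have 2: "(\<lambda>n. l2_of (classical_grad (\<zeta> n))) \<longlonglongrightarrow> grad \<Omega> (v + c *\<^sub>R w)"
    unfolding grad_add_scaleR[OF op H10_H1[OF v] H10_H1[OF w]] using \<phi>(3) \<psi>(3) by (auto intro!: tendsto_intros)
  have 3: "\<zeta> n \<in> test_functions \<Omega>" for n unfolding \<zeta>_def by (rule test_functions_add_scale[OF \<phi>(1) \<psi>(1)])
  show ?thesis unfolding H10_def mem_Collect_eq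
    using H1_add_scaleR[OF H10_H1[OF v] H10_H1[OF w], of c] 1 2 3 by blast
qed

lemma is_weak_grad_0: "is_weak_grad \<Omega> 0 0"
  by (simp add: is_weak_grad_def L2_on_0)

lemma grad_0: "open \<Omega> \<Longrightarrow> grad \<Omega> 0 = 0"
  by (rule grad_eqI[OF _ is_weak_grad_0])

lemma H10_0:
  assumes op: "open \<Omega>" shows "0 \<in> H10 \<Omega>"
proof -
  have "(0::('a, real) l2) \<in> H1 \<Omega>" unfolding H1_def using is_weak_grad_0 L2_on_0 by blast
  moreover have "(\<lambda>_. 0) \<in> test_functions \<Omega>"
    by (simp add: test_functions_def flat_algebra_Ck[OF flat_algebra.const])
  moreover have "classical_grad (\<lambda>_::'a. 0) = (\<lambda>_. 0)"
    by (simp add: classical_grad_def fun_eq_iff frechet_derivative_const)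
  ultimately show ?thesis unfolding H10_def mem_Collect_eq
    by (intro conjI exI[of _ "\<lambda>_ _. 0"]) (simp_all add: l2_of_zero grad_0[OF op])
qed

lemma poly_deg_le_add_scale:
  assumes "p \<in> poly_deg_le k" "q \<in> poly_deg_le k"
  shows "(\<lambda>x. p x + c * q x) \<in> poly_deg_le k"
proof -
  obtain a b where "\<forall>x. p x = (\<Sum>m | m \<in> Basis \<rightarrow>\<^sub>E {..k} \<and> (\<Sum>b\<in>Basis. m b) \<le> k. a m * (\<Prod>b\<in>Basis. (x \<bullet> b) ^ m b))"
    "\<forall>x. q x = (\<Sum>m | m \<in> Basis \<rightarrow>\<^sub>E {..k} \<and> (\<Sum>b\<in>Basis. m b) \<le> k. b m * (\<Prod>b\<in>Basis. (x \<bullet> b) ^ m b))"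
    using assms unfolding poly_deg_le_def by auto
  then show ?thesis unfolding poly_deg_le_def mem_Collect_eq
    by (intro exI[of _ "\<lambda>m. a m + c * b m"]) (simp add: sum.distrib sum_distrib_left distrib_right mult.assoc)
qed

lemma poly_deg_le_0: "(\<lambda>_. 0) \<in> poly_deg_le k"
  unfolding poly_deg_le_def by (auto intro: exI[of _ "\<lambda>_. 0"])

lemma subspace_fe_space:
  fixes \<Omega> :: "'a::euclidean_space set"
  assumes op: "open \<Omega>" and bd: "bounded \<Omega>"
  shows "subspace (fe_space \<Omega> \<T> k)"
proof -
  have add: "v + c *\<^sub>R w \<in> fe_space \<Omega> \<T> k" if v: "v \<in> fe_space \<Omega> \<T> k" and w: "w \<in> fe_space \<Omega> \<T> k" for v w c
  proof -
    obtain g where g: "v = l2_of g" "continuous_on (closure \<Omega>) g" "\<And>x. x \<notin> \<Omega> \<Longrightarrow> g x = 0"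
      "\<And>K. K \<in> \<T> \<Longrightarrow> \<exists>p\<in>poly_deg_le k. \<forall>x\<in>K. g x = p x" using v unfolding fe_space_def by blast
    obtain g' where g': "w = l2_of g'" "continuous_on (closure \<Omega>) g'" "\<And>x. x \<notin> \<Omega> \<Longrightarrow> g' x = 0"
      "\<And>K. K \<in> \<T> \<Longrightarrow> \<exists>p\<in>poly_deg_le k. \<forall>x\<in>K. g' x = p x" using w unfolding fe_space_def by blast
    have c: "compact (closure \<Omega>)" using bd by simp
    have sub: "x \<notin> closure \<Omega> \<Longrightarrow> x \<notin> \<Omega>" for x using closure_subset by blast
    have si: "square_integrable g" "square_integrable g'"
      using square_integrable_compact_support[OF c g(2) g(3)[OF sub]]
        square_integrable_compact_support[OF c g'(2) g'(3)[OF sub]] by blast+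
    have "v + c *\<^sub>R w = l2_of (\<lambda>x. g x + c * g' x)"
      using l2_of_add[OF si(1) square_integrable_scaleR[OF si(2)], of c] l2_of_scaleR[OF si(2), of c]
      by (simp add: g(1) g'(1))
    moreover have "continuous_on (closure \<Omega>) (\<lambda>x. g x + c * g' x)"
      by (intro continuous_intros g g')
    moreover have "\<forall>x. x \<notin> \<Omega> \<longrightarrow> g x + c * g' x = 0" using g(3) g'(3) by simp
    moreover have "\<forall>K\<in>\<T>. \<exists>p\<in>poly_deg_le k. \<forall>x\<in>K. g x + c * g' x = p x"
    proof
      fix K assume "K \<in> \<T>"
      then obtain p q where "p \<in> poly_deg_le k" "\<forall>x\<in>K. g x = p x" "q \<in> poly_deg_le k" "\<forall>x\<in>K. g' x = q x"
        using g(4) g'(4) by metis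
      then show "\<exists>p\<in>poly_deg_le k. \<forall>x\<in>K. g x + c * g' x = p x"
        by (intro bexI[of _ "\<lambda>x. p x + c * q x"] poly_deg_le_add_scale) auto
    qed
    moreover have "v + c *\<^sub>R w \<in> H10 \<Omega>" using v w by (intro H10_add_scaleR[OF op]) (auto simp: fe_space_def)
    ultimately show ?thesis unfolding fe_space_def mem_Collect_eq by blast
  qed
  have zero: "0 \<in> fe_space \<Omega> \<T> k"
    unfolding fe_space_def mem_Collect_eq
    by (intro conjI exI[of _ "\<lambda>_. 0"] H10_0[OF op]) (auto simp: l2_of_zero intro: bexI[OF _ poly_deg_le_0])
  show ?thesis unfolding subspace_def
    using zero add[of _ _ 1] add[OF zero] by auto
qed

lemma l2_of_linear_combination:
  assumes "finite I" "\<And>i. i \<in> I \<Longrightarrow> square_integrable (f i)"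
  shows "square_integrable (\<lambda>x. \<Sum>i\<in>I. c i *\<^sub>R f i x) \<and> l2_of (\<lambda>x. \<Sum>i\<in>I. c i *\<^sub>R f i x) = (\<Sum>i\<in>I. c i *\<^sub>R l2_of (f i))"
  using assms
proof (induction I rule: finite_induct)
  case empty
  then show ?case by (simp add: square_integrable_0 l2_of_zero)
next
  case (insert i I)
  then have IH: "square_integrable (\<lambda>x. \<Sum>i\<in>I. c i *\<^sub>R f i x)" "l2_of (\<lambda>x. \<Sum>i\<in>I. c i *\<^sub>R f i x) = (\<Sum>i\<in>I. c i *\<^sub>R l2_of (f i))"
    and i: "square_integrable (f i)" by auto
  then show ?case
    using insert.hyps square_integrable_add[OF square_integrable_scaleR[OF i] IH(1)] l2_of_add[OF square_integrable_scaleR[OF i] IH(1)]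
    by (simp add: l2_of_scaleR[OF i])
qed

lemma square_integrable_restricted_continuous:
  fixes q :: "'a::euclidean_space \<Rightarrow> real"
  assumes K: "compact K" and A: "A \<in> sets borel" "A \<subseteq> K" and q: "continuous_on UNIV q"
  shows "square_integrable (\<lambda>x. if x \<in> A then q x else 0)"
proof -
  have e: "(\<lambda>x. if x \<in> A then q x else 0) = (\<lambda>x. indicator A x * q x)" by (auto simp: fun_eq_iff indicator_def)
  have m: "(\<lambda>x. indicator A x * q x) \<in> borel_measurable borel"
    using A borel_measurable_continuous_onI[OF q] by (intro borel_measurable_times borel_measurable_indicator) auto
  have qK: "integrable lborel (\<lambda>x. indicator K x *\<^sub>R (q x)\<^sup>2)"
    by (rule borel_integrable_compact[OF K]) (intro continuous_intros continuous_on_subset[OF q] subset_UNIV)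
  have "integrable lborel (\<lambda>x. (norm (indicator A x * q x))\<^sup>2)"
  proof (rule Bochner_Integration.integrable_bound[OF qK])
    show "(\<lambda>x. (norm (indicator A x * q x))\<^sup>2) \<in> borel_measurable lborel" using m by simp
    show "AE x in lborel. norm ((norm (indicator A x * q x))\<^sup>2) \<le> norm (indicator K x *\<^sub>R (q x)\<^sup>2)"
      using A(2) by (intro AE_I2) (auto simp: indicator_def)
  qed
  then have "integrable lebesgue (\<lambda>x. (norm (indicator A x * q x))\<^sup>2)"
    using m by (subst integrable_completion) auto
  then show ?thesis unfolding square_integrable_def e using measurable_completion[of _ lborel] m by simp
qed

text \<open>
  Neighbouring cells overlap in faces. Adding the cells one at a time and cutting away what has been covered
  makes the monomials on the cut cells span all piecewise polynomials.
\<close>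

lemma piecewise_polynomials_finite_span:
  fixes \<T> :: "'a::euclidean_space set set"
  assumes "finite \<T>" "\<And>K. K \<in> \<T> \<Longrightarrow> compact K"
  shows "\<exists>S. finite S \<and> (\<forall>g. (\<forall>K\<in>\<T>. \<exists>p\<in>poly_deg_le k. \<forall>x\<in>K. g x = p x) \<longrightarrow>
     square_integrable (\<lambda>x. if x \<in> \<Union>\<T> then g x else 0) \<and> l2_of (\<lambda>x. if x \<in> \<Union>\<T> then g x else (0::real)) \<in> span S)"
  using assms
proof (induction \<T> rule: finite_induct)
  case empty
  show ?case by (intro exI[of _ "{}"]) (simp add: square_integrable_0 l2_of_zero)
next
  case (insert K \<T>)
  from insert obtain S where S: "finite S" "\<And>g. (\<And>K. K\<in>\<T> \<Longrightarrow> \<exists>p\<in>poly_deg_le k. \<forall>x\<in>K. g x = p x) \<Longrightarrow>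
     square_integrable (\<lambda>x. if x \<in> \<Union>\<T> then g x else 0) \<and> l2_of (\<lambda>x. if x \<in> \<Union>\<T> then g x else (0::real)) \<in> span S"
    by auto
  define I where "I = {m. m \<in> (Basis :: 'a set) \<rightarrow>\<^sub>E {..k} \<and> (\<Sum>b\<in>Basis. m b) \<le> k}"
  have I: "finite I" unfolding I_def by (rule finite_subset[OF _ finite_PiE[of "Basis :: 'a set" "\<lambda>_. {..k}"]]) auto
  define q where "q m x = (if x \<in> K - \<Union>\<T> then \<Prod>b\<in>Basis. (x \<bullet> b) ^ m b else 0)" for m and x :: 'a
  have cT: "compact (\<Union>\<T>)" using insert by (intro compact_Union) auto
  have K: "compact K" using insert by simp
  have q: "square_integrable (q m)" for m
    unfolding q_def
  proof (rule square_integrable_restricted_continuous[OF K])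
    show "K - \<Union>\<T> \<in> sets borel" by (intro sets.Diff borel_compact K cT)
    show "continuous_on UNIV (\<lambda>x::'a. \<Prod>b\<in>Basis. (x \<bullet> b) ^ m b)" by (intro continuous_intros)
  qed auto
  show ?case
  proof (intro exI[of _ "S \<union> (\<lambda>m. l2_of (q m)) ` I"] conjI allI impI)
    show "finite (S \<union> (\<lambda>m. l2_of (q m)) ` I)" using S(1) I by simp
    fix g :: "'a \<Rightarrow> real" assume g: "\<forall>K\<in>insert K \<T>. \<exists>p\<in>poly_deg_le k. \<forall>x\<in>K. g x = p x"
    then obtain p where p: "p \<in> poly_deg_le k" "\<forall>x\<in>K. g x = p x" by auto
    then obtain c where c: "\<And>x. p x = (\<Sum>m\<in>I. c m * (\<Prod>b\<in>Basis. (x \<bullet> b) ^ m b))"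
      unfolding poly_deg_le_def I_def by blast
    define g0 where "g0 = (\<lambda>x. if x \<in> \<Union>\<T> then g x else 0)"
    have g0: "square_integrable g0" "l2_of g0 \<in> span S" using S(2)[of g] g by (auto simp: g0_def)
    note L = l2_of_linear_combination[OF I q, of c]
    have e: "(\<lambda>x. if x \<in> \<Union>(insert K \<T>) then g x else 0) = (\<lambda>x. g0 x + (\<Sum>m\<in>I. c m *\<^sub>R q m x))"
    proof
      fix x show "(if x \<in> \<Union>(insert K \<T>) then g x else 0) = g0 x + (\<Sum>m\<in>I. c m *\<^sub>R q m x)"
      proof (cases "x \<in> \<Union>\<T>")
        case True
        then have "q m x = 0" for m by (simp add: q_def)
        then show ?thesis using True by (simp add: g0_def)
      next
        case False
        then have "q m x = (if x \<in> K then \<Prod>b\<in>Basis. (x \<bullet> b) ^ m b else 0)" for m by (simp add: q_def)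
        then show ?thesis using False p(2) c[of x] by (simp add: g0_def)
      qed
    qed
    show "square_integrable (\<lambda>x. if x \<in> \<Union>(insert K \<T>) then g x else 0)"
      unfolding e using g0 L by (intro square_integrable_add) auto
    have "l2_of g0 \<in> span (S \<union> (\<lambda>m. l2_of (q m)) ` I)" using g0(2) span_mono[of S] by blast
    moreover have "(\<Sum>m\<in>I. c m *\<^sub>R l2_of (q m)) \<in> span (S \<union> (\<lambda>m. l2_of (q m)) ` I)"
      by (intro span_sum span_scale span_base) auto
    ultimately show "l2_of (\<lambda>x. if x \<in> \<Union>(insert K \<T>) then g x else 0) \<in> span (S \<union> (\<lambda>m. l2_of (q m)) ` I)"
      unfolding e using g0(1) L by (simp add: l2_of_add span_add)
  qed
qed

lemma fe_space_finite_span: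
  fixes \<Omega> :: "'a::euclidean_space set"
  assumes mesh: "simplicial_mesh \<Omega> \<T>"
  shows "\<exists>S. finite S \<and> fe_space \<Omega> \<T> k \<subseteq> span S"
proof -
  have "finite \<T>" using mesh by (simp add: simplicial_mesh_def triangulation_def)
  moreover have "compact K" if "K \<in> \<T>" for K
  proof -
    have "int DIM('a) simplex K" using mesh that by (simp add: simplicial_mesh_def)
    then obtain C where "\<not> affine_dependent C" "K = convex hull C" unfolding simplex_def by blast
    then show ?thesis using aff_independent_finite finite_imp_compact_convex_hull by blast
  qed
  ultimately obtain S where S: "finite S" "\<And>g. (\<And>K. K\<in>\<T> \<Longrightarrow> \<exists>p\<in>poly_deg_le k. \<forall>x\<in>K. g x = p x) \<Longrightarrow>
     l2_of (\<lambda>x. if x \<in> \<Union>\<T> then g x else (0::real)) \<in> span S"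
    using piecewise_polynomials_finite_span[of \<T> k] by auto
  have "v \<in> span S" if v: "v \<in> fe_space \<Omega> \<T> k" for v
  proof -
    obtain g where g: "v = l2_of g" "\<And>x. x \<notin> \<Omega> \<Longrightarrow> g x = 0"
      "\<And>K. K \<in> \<T> \<Longrightarrow> \<exists>p\<in>poly_deg_le k. \<forall>x\<in>K. g x = p x" using v unfolding fe_space_def by blast
    have "\<Union>\<T> = closure \<Omega>" using mesh by (simp add: simplicial_mesh_def)
    then have "(\<lambda>x. if x \<in> \<Union>\<T> then g x else 0) = g"
      using g(2) closure_subset[of \<Omega>] by (auto simp: fun_eq_iff)
    then show ?thesis using S(2)[of g] g by simp
  qed
  then show ?thesis using S(1) by blast
qed

text \<open>
  Gram--Schmidt, one vector at a time.
\<close>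

lemma orthogonal_projection_span:
  fixes \<phi> :: "'v::real_inner"
  assumes "finite B"
  shows "\<exists>p\<in>span B. \<forall>v\<in>span B. p \<bullet> v = \<phi> \<bullet> v"
  using assms
proof (induction B arbitrary: \<phi> rule: finite_induct)
  case empty
  then show ?case by simp
next
  case (insert a B)
  obtain q where q: "q \<in> span B" "\<And>v. v \<in> span B \<Longrightarrow> q \<bullet> v = a \<bullet> v" using insert.IH by blast
  obtain p where p: "p \<in> span B" "\<And>v. v \<in> span B \<Longrightarrow> p \<bullet> v = \<phi> \<bullet> v" using insert.IH by blast
  define a' where "a' = a - q"
  have a': "a' \<bullet> v = 0" if "v \<in> span B" for v using q(2)[OF that] by (simp add: a'_def inner_diff_left)
  show ?case
  proof (cases "a' = 0")
    case True
    then have "a \<in> span B" using q(1) by (simp add: a'_def)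
    then have "span (insert a B) = span B" by (rule span_redundant)
    then show ?thesis using p by auto
  next
    case False
    define c where "c = (\<phi> \<bullet> a') / (a' \<bullet> a')"
    have c: "c * (a' \<bullet> a') = \<phi> \<bullet> a'" using False by (simp add: c_def)
    have mono: "span B \<subseteq> span (insert a B)" by (rule span_mono) auto
    have aS: "a' \<in> span (insert a B)" unfolding a'_def
      by (rule span_diff[OF span_base subsetD[OF mono q(1)]]) simp
    have pS: "p \<in> span (insert a B)" by (rule subsetD[OF mono p(1)])
    show ?thesis
    proof (intro bexI[of _ "p + c *\<^sub>R a'"] ballI)
      show "p + c *\<^sub>R a' \<in> span (insert a B)" by (intro span_add span_scale aS pS)
      fix v assume "v \<in> span (insert a B)"
      then obtain t where t: "v - t *\<^sub>R a \<in> span B" unfolding span_breakdown_eq by blast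
      define w where "w = v - t *\<^sub>R a + t *\<^sub>R q"
      have w: "w \<in> span B" unfolding w_def by (intro span_add span_scale t q(1))
      have v: "v = w + t *\<^sub>R a'" by (simp add: w_def a'_def algebra_simps)
      have "(p + c *\<^sub>R a') \<bullet> v = p \<bullet> w + t * (a' \<bullet> p) + c * (a' \<bullet> w) + t * (c * (a' \<bullet> a'))"
        unfolding v by (simp add: inner_simps inner_commute[of p a'] algebra_simps)
      also have "\<dots> = \<phi> \<bullet> v"
        unfolding c v by (simp add: p(2)[OF w] a'[OF p(1)] a'[OF w] inner_simps)
      finally show "(p + c *\<^sub>R a') \<bullet> v = \<phi> \<bullet> v" .
    qed
  qed
qed

lemma orthogonal_projection_exists:
  fixes W :: "'v::real_inner set"
  assumes W: "subspace W" "W \<subseteq> span S" "finite S"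
  shows "\<exists>p\<in>W. \<forall>v\<in>W. p \<bullet> v = \<phi> \<bullet> v"
proof -
  obtain B where B: "B \<subseteq> W" "independent B" "W \<subseteq> span B"
    using basis_exists[of W] by metis
  have "finite B" using independent_span_bound[OF W(3) B(2) order_trans[OF B(1) W(2)]] by (rule conjunct1)
  moreover have "span B = W" by (rule antisym[OF span_minimal[OF B(1) W(1)] B(3)])
  ultimately show ?thesis using orthogonal_projection_span[of B \<phi>] by simp
qed

context
  fixes W :: "('a::euclidean_space, real) l2 set"
  assumes sub: "subspace W" and fin: "\<exists>S. finite S \<and> W \<subseteq> span S"
begin

lemma projection_unique:
  assumes p: "p \<in> W" "\<forall>v\<in>W. p \<bullet> v = \<phi> \<bullet> v"
  shows "l2_projection W \<phi> = p"
  unfolding l2_projection_def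
proof (rule the_equality)
  show "p \<in> W \<and> (\<forall>v\<in>W. p \<bullet> v = \<phi> \<bullet> v)" using p by blast
  fix q assume q: "q \<in> W \<and> (\<forall>v\<in>W. q \<bullet> v = \<phi> \<bullet> v)"
  then have "q - p \<in> W" using p(1) sub by (simp add: subspace_diff)
  then have "(q - p) \<bullet> (q - p) = 0" using p q by (simp add: inner_diff_left)
  then show "q = p" by simp
qed

lemma projection_exists: "\<exists>p\<in>W. \<forall>v\<in>W. p \<bullet> v = \<phi> \<bullet> v"
  using fin orthogonal_projection_exists[OF sub] by blast

lemma projection_in: "l2_projection W \<phi> \<in> W"
  and projection_inner: "v \<in> W \<Longrightarrow> l2_projection W \<phi> \<bullet> v = \<phi> \<bullet> v"
proof -
  obtain p where p: "p \<in> W" "\<forall>v\<in>W. p \<bullet> v = \<phi> \<bullet> v" using projection_exists[of \<phi>] by blast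
  note e = projection_unique[OF p]
  show "l2_projection W \<phi> \<in> W" unfolding e by (rule p(1))
  show "v \<in> W \<Longrightarrow> l2_projection W \<phi> \<bullet> v = \<phi> \<bullet> v" unfolding e using p(2) by blast
qed

lemma projection_id: "v \<in> W \<Longrightarrow> l2_projection W v = v"
  by (rule projection_unique) auto

lemma projection_linear: "linear (l2_projection W)"
proof
  fix x y :: "('a, real) l2" and c :: real
  show "l2_projection W (x + y) = l2_projection W x + l2_projection W y"
    by (rule projection_unique) (simp_all add: projection_in projection_inner inner_add_left subspace_add[OF sub])
  show "l2_projection W (c *\<^sub>R x) = c *\<^sub>R l2_projection W x"
    by (rule projection_unique) (simp_all add: projection_in projection_inner subspace_scale[OF sub])
qed

lemma projection_error_norm: "norm (x - l2_projection W x) \<le> norm x"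
proof -
  let ?p = "l2_projection W x"
  have "(norm (x - ?p))\<^sup>2 + (norm ?p)\<^sup>2 = (norm x)\<^sup>2"
    using projection_inner[OF projection_in, of x x]
    by (simp add: power2_norm_eq_inner inner_diff_left inner_diff_right inner_commute[of x ?p])
  then have "(norm (x - ?p))\<^sup>2 \<le> (norm x)\<^sup>2" using zero_le_power2[of "norm ?p"] by linarith
  then show ?thesis by (rule power2_le_imp_le) simp
qed

lemma projection_error_linear: "bounded_linear (\<lambda>x. x - l2_projection W x)"
proof (rule bounded_linear_intro[where K = 1])
  interpret linear "l2_projection W" by (rule projection_linear)
  show "x + y - l2_projection W (x + y) = x - l2_projection W x + (y - l2_projection W y)" for x y by (simp add: add)
  show "r *\<^sub>R x - l2_projection W (r *\<^sub>R x) = r *\<^sub>R (x - l2_projection W x)" for r x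
    by (simp add: scale scaleR_diff_right)
  show "norm (x - l2_projection W x) \<le> norm x * 1" for x using projection_error_norm by simp
qed

end


section \<open>The residual of the reconstruction\<close>

text \<open>
  Taylor form, in which differentiation just shifts the coefficients.
\<close>

definition quartic :: "'v::real_vector \<Rightarrow> 'v \<Rightarrow> 'v \<Rightarrow> 'v \<Rightarrow> 'v \<Rightarrow> real \<Rightarrow> 'v" where
  "quartic a b c d e s = a + s *\<^sub>R b + (s\<^sup>2 / 2) *\<^sub>R c + (s ^ 3 / 6) *\<^sub>R d + (s ^ 4 / 24) *\<^sub>R e"

lemma quartic_has_derivative:
  fixes a :: "'v::real_normed_vector"
  shows "((\<lambda>t. quartic a b c d e (t - m)) has_vector_derivative quartic b c d e 0 (t - m)) (at t)"
proof -
  have 1: "((\<lambda>t. t - m) has_real_derivative 1) (at t)" by (auto intro!: derivative_eq_intros)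
  have 2: "((\<lambda>t. (t - m)\<^sup>2 / 2) has_real_derivative t - m) (at t)"
    by (auto intro!: derivative_eq_intros)
  have 3: "((\<lambda>t. (t - m) ^ 3 / 6) has_real_derivative (t - m)\<^sup>2 / 2) (at t)"
    by (auto intro!: derivative_eq_intros)
  have 4: "((\<lambda>t. (t - m) ^ 4 / 24) has_real_derivative (t - m) ^ 3 / 6) (at t)"
    by (auto intro!: derivative_eq_intros)
  have s: "((\<lambda>t. p t *\<^sub>R x) has_vector_derivative p' *\<^sub>R x) (at t)"
    if "(p has_real_derivative p') (at t)" for p p' and x :: 'v
    using bounded_linear.has_vector_derivative[OF bounded_linear_scaleR_left that[unfolded has_real_derivative_iff_has_vector_derivative]] .
  have "((\<lambda>t. quartic a b c d e (t - m)) has_vector_derivative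
      0 + 1 *\<^sub>R b + (t - m) *\<^sub>R c + ((t - m)\<^sup>2 / 2) *\<^sub>R d + ((t - m) ^ 3 / 6) *\<^sub>R e) (at t)"
    unfolding quartic_def
    by (intro has_vector_derivative_add has_vector_derivative_const s 1 2 3 4)
  then show ?thesis by (simp add: quartic_def)
qed

text \<open>
  The coefficients \<open>\<alpha>, \<beta>, \<gamma>, \<theta>, \<epsilon>\<close> of the quartic reconstruction, continued by \<open>0\<close>, so that the derivative of order
  \<open>i\<close> uses the coefficients from \<open>i\<close> on.
\<close>

definition L_coeff :: "real \<Rightarrow> (int \<Rightarrow> 'v::real_vector) \<Rightarrow> int \<Rightarrow> nat \<Rightarrow> 'v" where
  "L_coeff \<tau> w n i = 
    (if i = 0 then (1 / 24) *\<^sub>R (3 *\<^sub>R w (n + 1) + 17 *\<^sub>R w n + 5 *\<^sub>R w (n - 1) - w (n - 2))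
     else if i = 1 then (1 / (12 * \<tau>)) *\<^sub>R (5 *\<^sub>R w (n + 1) + 3 *\<^sub>R w n - 9 *\<^sub>R w (n - 1) + w (n - 2))
     else if i = 2 then (1 / \<tau>\<^sup>2) *\<^sub>R (w (n + 1) - 2 *\<^sub>R w n + w (n - 1))
     else if i = 3 then (1 / (2 * \<tau> ^ 3)) *\<^sub>R (w (n + 2) - 2 *\<^sub>R w (n + 1) + 2 *\<^sub>R w (n - 1) - w (n - 2))
     else if i = 4 then (1 / \<tau> ^ 4) *\<^sub>R (w (n + 2) - 4 *\<^sub>R w (n + 1) + 6 *\<^sub>R w n - 4 *\<^sub>R w (n - 1) + w (n - 2))
     else 0)"

definition L_deriv :: "nat \<Rightarrow> real \<Rightarrow> (int \<Rightarrow> 'v::real_vector) \<Rightarrow> int \<Rightarrow> real \<Rightarrow> 'v" where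
  "L_deriv i \<tau> w n t = quartic (L_coeff \<tau> w n i) (L_coeff \<tau> w n (i + 1)) (L_coeff \<tau> w n (i + 2))
     (L_coeff \<tau> w n (i + 3)) (L_coeff \<tau> w n (i + 4)) (t - of_int n * \<tau>)"

definition R_piece :: "real \<Rightarrow> (int \<Rightarrow> 'v::real_vector) \<Rightarrow> int \<Rightarrow> real \<Rightarrow> 'v" where
  "R_piece \<tau> w n t = (let s = t - of_int n * \<tau> in w n + (s / (2 * \<tau>)) *\<^sub>R (w (n + 1) - w (n - 1))
     + (s\<^sup>2 / 2 / \<tau>\<^sup>2) *\<^sub>R (w (n + 1) - 2 *\<^sub>R w n + w (n - 1)))"

lemma recon_L_eq: "recon_L \<tau> W t = L_deriv 0 \<tau> (zero_ext W) \<lfloor>t / \<tau>\<rfloor> t"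
  by (simp add: recon_L_def L_deriv_def quartic_def L_coeff_def Let_def)

lemma recon_R_eq: "recon_R \<tau> W t = R_piece \<tau> (zero_ext W) \<lfloor>t / \<tau>\<rfloor> t"
  by (simp add: recon_R_def R_piece_def Let_def)

lemma L_deriv_has_derivative:
  fixes w :: "int \<Rightarrow> 'v::real_normed_vector"
  shows "(L_deriv i \<tau> w n has_vector_derivative L_deriv (Suc i) \<tau> w n t) (at t)"
proof -
  have "L_coeff \<tau> w n (i + 5) = 0" by (simp add: L_coeff_def)
  then show ?thesis
    using quartic_has_derivative[of "L_coeff \<tau> w n i" "L_coeff \<tau> w n (i + 1)" "L_coeff \<tau> w n (i + 2)" "L_coeff \<tau> w n (i + 3)" "L_coeff \<tau> w n (i + 4)" "of_int n * \<tau>" t]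
    unfolding L_deriv_def[abs_def] by (simp add: numeral_eq_Suc)
qed

lemma continuous_on_L_deriv:
  fixes w :: "int \<Rightarrow> 'v::real_normed_vector"
  shows "continuous_on S (L_deriv i \<tau> w n)"
  unfolding L_deriv_def[abs_def] quartic_def by (intro continuous_intros) auto

lemma continuous_on_R_piece:
  fixes w :: "int \<Rightarrow> 'v::real_normed_vector"
  assumes "0 < \<tau>"
  shows "continuous_on S (R_piece \<tau> w n)"
  unfolding R_piece_def[abs_def] Let_def by (intro continuous_intros) (use assms in auto)

text \<open>
  The reason for the choice of the quartic reconstruction: its second derivative is the quadratic
  reconstruction of the second differences that occur in the leapfrog scheme.
\<close>

lemma L_deriv_2_eq_R_piece:
  fixes w :: "int \<Rightarrow> 'v::real_vector"
  assumes "0 < \<tau>"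
  shows "L_deriv 2 \<tau> w n t = R_piece \<tau> (\<lambda>m. (1 / \<tau>\<^sup>2) *\<^sub>R (w (m + 1) - 2 *\<^sub>R w m + w (m - 1))) n t"
proof -
  let ?g = "\<lambda>m. (1 / \<tau>\<^sup>2) *\<^sub>R (w (m + 1) - 2 *\<^sub>R w m + w (m - 1))"
  define s where "s = t - of_int n * \<tau>"
  have 3: "s *\<^sub>R L_coeff \<tau> w n 3 = (s / (2 * \<tau>)) *\<^sub>R (?g (n + 1) - ?g (n - 1))"
  proof -
    have "?g (n + 1) - ?g (n - 1) = (1 / \<tau>\<^sup>2) *\<^sub>R (w (n + 2) - 2 *\<^sub>R w (n + 1) + 2 *\<^sub>R w (n - 1) - w (n - 2))"
      by (simp add: algebra_simps)
    then show ?thesis by (simp add: L_coeff_def power2_eq_square power3_eq_cube mult.assoc)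
  qed
  have 4: "(s\<^sup>2 / 2) *\<^sub>R L_coeff \<tau> w n 4 = (s\<^sup>2 / 2 / \<tau>\<^sup>2) *\<^sub>R (?g (n + 1) - 2 *\<^sub>R ?g n + ?g (n - 1))"
  proof -
    have "?g (n + 1) - 2 *\<^sub>R ?g n + ?g (n - 1) = (1 / \<tau>\<^sup>2) *\<^sub>R ((w (n + 2) - 2 *\<^sub>R w (n + 1) + w n)
       - 2 *\<^sub>R (w (n + 1) - 2 *\<^sub>R w n + w (n - 1)) + (w n - 2 *\<^sub>R w (n - 1) + w (n - 2)))"
      by (simp add: scaleR_add_right scaleR_diff_right mult.commute) (simp add: add.commute)
    also have "(w (n + 2) - 2 *\<^sub>R w (n + 1) + w n) - 2 *\<^sub>R (w (n + 1) - 2 *\<^sub>R w n + w (n - 1)) + (w n - 2 *\<^sub>R w (n - 1) + w (n - 2))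
      = (1 + 1 + 4) *\<^sub>R w n + w (n + 2) - (2 + 2) *\<^sub>R w (n + 1) - (2 + 2) *\<^sub>R w (n - 1) + w (n - 2)"
      unfolding scaleR_add_left by (simp add: scaleR_add_right scaleR_diff_right)
    finally have "?g (n + 1) - 2 *\<^sub>R ?g n + ?g (n - 1) = (1 / \<tau>\<^sup>2) *\<^sub>R (w (n + 2) - 4 *\<^sub>R w (n + 1) + 6 *\<^sub>R w n - 4 *\<^sub>R w (n - 1) + w (n - 2))"
      by (simp add: algebra_simps)
    then show ?thesis by (simp add: L_coeff_def power2_eq_square power4_eq_xxxx mult.assoc)
  qed
  have "L_coeff \<tau> w n 2 = ?g n" by (simp add: L_coeff_def)
  moreover have "L_deriv 2 \<tau> w n t = L_coeff \<tau> w n 2 + s *\<^sub>R L_coeff \<tau> w n 3 + (s\<^sup>2 / 2) *\<^sub>R L_coeff \<tau> w n 4"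
    by (simp add: L_deriv_def quartic_def s_def L_coeff_def)
  ultimately show ?thesis unfolding 3 4 by (simp only: R_piece_def Let_def s_def)
qed

lemma inner_R_piece: "R_piece \<tau> w n t \<bullet> v = R_piece \<tau> (\<lambda>m. w m \<bullet> v) n t"
  by (simp add: R_piece_def Let_def inner_simps)

lemma R_piece_add: "R_piece \<tau> (\<lambda>m. a m + b m) n t = R_piece \<tau> a n t + R_piece \<tau> b n t"
  by (simp add: R_piece_def Let_def algebra_simps)

lemma subspace_L_deriv:
  assumes "subspace X" "\<And>m. w m \<in> X" shows "L_deriv i \<tau> w n t \<in> X"
  unfolding L_deriv_def quartic_def L_coeff_def
  using assms by (simp add: subspace_add subspace_diff subspace_scale subspace_0)

locale linear_on_subspace =
  fixes T :: "'v::real_vector \<Rightarrow> 'w::real_vector" and X :: "'v set"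
  assumes X: "subspace X"
    and T: "\<And>v w c. v \<in> X \<Longrightarrow> w \<in> X \<Longrightarrow> T (v + c *\<^sub>R w) = T v + c *\<^sub>R T w"
begin

lemma zero: "T 0 = 0"
  using T[OF subspace_0[OF X] subspace_0[OF X], of 1] by simp

lemma add: "v \<in> X \<Longrightarrow> w \<in> X \<Longrightarrow> T (v + w) = T v + T w"
  using T[of v w 1] by simp

lemma diff: "v \<in> X \<Longrightarrow> w \<in> X \<Longrightarrow> T (v - w) = T v - T w"
  using T[of v w "- 1"] by simp

lemma scale: "v \<in> X \<Longrightarrow> T (c *\<^sub>R v) = c *\<^sub>R T v"
  using T[OF subspace_0[OF X], of v c] zero by simp

lemmas closed = subspace_add[OF X] subspace_diff[OF X] subspace_scale[OF X] subspace_0[OF X]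

lemma L_deriv: "(\<And>m. w m \<in> X) \<Longrightarrow> T (L_deriv 0 \<tau> w n t) = L_deriv 0 \<tau> (\<lambda>m. T (w m)) n t"
  by (simp add: L_deriv_def quartic_def L_coeff_def add diff scale closed)

lemma R_piece: "(\<And>m. w m \<in> X) \<Longrightarrow> T (R_piece \<tau> w n t) = R_piece \<tau> (\<lambda>m. T (w m)) n t"
  by (simp add: R_piece_def Let_def add diff scale closed)

end

lemma tderiv_eq_on_open:
  assumes I: "open I" "I \<subseteq> {0..}" and v: "\<And>t. t \<in> I \<Longrightarrow> v t = q 0 t"
    and q: "\<And>i t. i < m \<Longrightarrow> t \<in> I \<Longrightarrow> (q i has_vector_derivative q (Suc i) t) (at t)"
  shows "i \<le> m \<Longrightarrow> t \<in> I \<Longrightarrow> tderiv i v t = q i t"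
proof (induction i arbitrary: t)
  case (Suc i)
  have "(tderiv i v has_vector_derivative q (Suc i) t) (at t)"
    by (rule has_vector_derivative_transform_within_open[OF q[of i t] I(1)]) (use Suc in auto)
  then have "(tderiv i v has_vector_derivative q (Suc i) t) (at t within {0..})"
    by (rule has_vector_derivative_at_within)
  from vector_derivative_within[OF at_half_line_nontrivial this]
  show ?case using Suc.prems I by auto
qed (use v in auto)

text \<open>
  At the nodes \<open>n \<tau>\<close> the derivatives of a piecewise polynomial are unspecified; they form a null set.
\<close>

lemma AE_time_cells:
  assumes "0 < \<tau>"
  shows "AE t in lborel. 0 \<le> (t::real) \<longrightarrow> (\<exists>n::int. 0 \<le> n \<and> of_int n * \<tau> < t \<and> t < of_int (n + 1) * \<tau>)"
proof -
  have "countable (range (\<lambda>n::int. of_int n * \<tau>))" by simp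
  then have "range (\<lambda>n::int. of_int n * \<tau>) \<in> null_sets lborel" by (rule countable_imp_null_set_lborel)
  from AE_not_in[OF this] show ?thesis
  proof eventually_elim
    case (elim t)
    show ?case
    proof
      assume t: "0 \<le> t"
      let ?n = "\<lfloor>t / \<tau>\<rfloor>"
      have "of_int ?n * \<tau> \<le> t" "t < of_int (?n + 1) * \<tau>"
        using floor_divide_lower[OF assms, of t] floor_divide_upper[OF assms, of t] by simp_all
      moreover have "of_int ?n * \<tau> \<noteq> t" using elim rangeI[of "\<lambda>n::int. of_int n * \<tau>" ?n] by auto
      moreover have "0 \<le> ?n" using t assms by simp
      ultimately show "\<exists>n::int. 0 \<le> n \<and> of_int n * \<tau> < t \<and> t < of_int (n + 1) * \<tau>"
        by (intro exI[of _ ?n]) simp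
    qed
  qed
qed

lemma floor_cell:
  assumes "0 < \<tau>" "of_int n * \<tau> < t" "t < of_int (n + 1) * \<tau>"
  shows "\<lfloor>t / \<tau>\<rfloor> = n"
  using assms by (intro floor_unique) (simp_all add: field_simps)

lemma tderiv_recon_L:
  fixes W :: "nat \<Rightarrow> 'v::real_normed_vector"
  assumes tau: "0 < \<tau>" and n: "0 \<le> n" "of_int n * \<tau> < t" "t < of_int (n + 1) * \<tau>"
  shows "tderiv i (recon_L \<tau> W) t = L_deriv i \<tau> (zero_ext W) \<lfloor>t / \<tau>\<rfloor> t"
proof -
  let ?I = "{of_int n * \<tau><..<of_int (n + 1) * \<tau>}"
  have nt: "0 \<le> of_int n * \<tau>" using tau n(1) by simp
  have "tderiv i (recon_L \<tau> W) t = L_deriv i \<tau> (zero_ext W) n t"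
  proof (rule tderiv_eq_on_open[where I = ?I and m = i])
    show "?I \<subseteq> {0..}" using nt by auto
    show "recon_L \<tau> W x = L_deriv 0 \<tau> (zero_ext W) n x" if "x \<in> ?I" for x
      using floor_cell[OF tau, of n x] that by (simp add: recon_L_eq)
  qed (use n L_deriv_has_derivative in auto)
  then show ?thesis using floor_cell[OF tau n(2,3)] by simp
qed

lemma borel_measurable_time_cells:
  fixes G :: "int \<Rightarrow> real \<Rightarrow> real"
  assumes "\<And>n. continuous_on {0..} (G n)"
  shows "(\<lambda>t. if 0 \<le> t then G \<lfloor>t / \<tau>\<rfloor> t else 0) \<in> borel_measurable borel"
proof (rule measurable_compose_countable[where f = "\<lambda>n t. if 0 \<le> t then G n t else 0"])
  show "(\<lambda>t. if 0 \<le> t then G n t else 0) \<in> borel_measurable borel" for n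
  proof -
    have "(\<lambda>t. indicator {0..} t *\<^sub>R G n t) \<in> borel_measurable borel"
      by (rule borel_measurable_continuous_on_indicator) (use assms in auto)
    moreover have "(\<lambda>t. indicator {0..} t *\<^sub>R G n t) = (\<lambda>t. if 0 \<le> t then G n t else 0)"
      by (auto simp: fun_eq_iff indicator_def)
    ultimately show ?thesis by simp
  qed
  show "(\<lambda>t. \<lfloor>t / \<tau>\<rfloor>) \<in> borel \<rightarrow>\<^sub>M count_space UNIV" by measurable
qed

lemma sum_four_squares:
  fixes x y z w :: real
  shows "(x + y + z + w)\<^sup>2 \<le> 4 * (x\<^sup>2 + y\<^sup>2 + z\<^sup>2 + w\<^sup>2)"
  using sum_squares_bound[of x y] sum_squares_bound[of x z] sum_squares_bound[of x w]
    sum_squares_bound[of y z] sum_squares_bound[of y w] sum_squares_bound[of z w]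
  by (simp add: power2_eq_square algebra_simps)

text \<open>
  The pointwise splitting of the residual, with \<open>pv\<close> and \<open>pu2\<close> the projections of the test function and of the
  acceleration. The acceleration may be replaced by its projection error because the test function
  \<open>v - pv\<close> is orthogonal to the range of the projection.
\<close>

lemma residual_bound:
  fixes ft f\<tau> u2 pu2 L2 v pv :: "'v::real_inner" and gu gw gR gv gpv :: "'w::real_inner"
  assumes wave: "u2 \<bullet> v + gu \<bullet> gv = ft \<bullet> v" "u2 \<bullet> pv + gu \<bullet> gpv = ft \<bullet> pv"
    and disc: "L2 \<bullet> pv + gR \<bullet> gpv = f\<tau> \<bullet> pv"
    and orth: "L2 \<bullet> (v - pv) = 0" "pu2 \<bullet> (v - pv) = 0"
  shows "\<bar>f\<tau> \<bullet> v - L2 \<bullet> v - gw \<bullet> gv\<bar> \<le> norm (gR - gw) * norm gpv + norm (ft - f\<tau>) * norm (v - pv)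
     + norm (u2 - pu2) * norm (v - pv) + norm (gu - gw) * (norm gv + norm gpv)"
proof -
  have "f\<tau> \<bullet> v - L2 \<bullet> v - gw \<bullet> gv = (gR - gw) \<bullet> gpv - (ft - f\<tau>) \<bullet> (v - pv) + (u2 - pu2) \<bullet> (v - pv) + (gu - gw) \<bullet> (gv - gpv)"
    using assms by (simp add: inner_diff_left inner_diff_right)
  also have "\<bar>\<dots>\<bar> \<le> \<bar>(gR - gw) \<bullet> gpv\<bar> + \<bar>(ft - f\<tau>) \<bullet> (v - pv)\<bar> + \<bar>(u2 - pu2) \<bullet> (v - pv)\<bar> + \<bar>(gu - gw) \<bullet> (gv - gpv)\<bar>"
    by linarith
  also have "\<dots> \<le> norm (gR - gw) * norm gpv + norm (ft - f\<tau>) * norm (v - pv)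
     + norm (u2 - pu2) * norm (v - pv) + norm (gu - gw) * norm (gv - gpv)"
    by (intro add_mono Cauchy_Schwarz_ineq2)
  also have "norm (gu - gw) * norm (gv - gpv) \<le> norm (gu - gw) * (norm gv + norm gpv)"
    by (intro mult_left_mono norm_triangle_ineq4) simp
  finally show ?thesis by simp
qed

text \<open>
  The scheme holds from index \<open>1\<close> on; for smaller indices all terms vanish, because the sequence starts with two
  zeros and is extended by zero. So the identity may be combined over any three consecutive indices.
\<close>

lemma discrete_equation:
  assumes op: "open \<Omega>" and sub: "subspace (fe_space \<Omega> \<T> k)" and tau: "0 < \<tau>"
    and U: "leapfrog_solution \<Omega> (fe_space \<Omega> \<T> k) \<tau> f U" and f0: "f 0 = 0" and v: "v \<in> fe_space \<Omega> \<T> k"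
  shows "L_deriv 2 \<tau> (zero_ext U) n t \<bullet> v + R_piece \<tau> (\<lambda>m. grad \<Omega> (zero_ext U m)) n t \<bullet> grad \<Omega> v
     = R_piece \<tau> (zero_ext (\<lambda>n. f (real n * \<tau>))) n t \<bullet> v"
proof -
  let ?w = "zero_ext U" and ?F = "zero_ext (\<lambda>n. f (real n * \<tau>))"
  have U01: "U 0 = 0" "U (Suc 0) = 0" using U by (auto simp: leapfrog_solution_def)
  have eq: "(1 / \<tau>\<^sup>2) *\<^sub>R (?w (m + 1) - 2 *\<^sub>R ?w m + ?w (m - 1)) \<bullet> v + grad \<Omega> (?w m) \<bullet> grad \<Omega> v = ?F m \<bullet> v" for m
  proof (cases "1 \<le> m")
    case True
    define j where "j = nat m"
    have j: "1 \<le> j" "m = int j" using True by (auto simp: j_def)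
    have "nat (int j + 1) = j + 1" "nat (int j - 1) = j - 1" using j(1) by auto
    then show ?thesis using U v j by (simp add: leapfrog_solution_def zero_ext_def)
  next
    case False
    then consider "m = 0" | "m = - 1" | "m < - 1" by linarith
    then have "?w (m + 1) = 0" "?w m = 0" "?w (m - 1) = 0" "?F m = 0"
      using U01 f0 by (cases; simp add: zero_ext_def)+
    then show ?thesis by (simp add: grad_0[OF op])
  qed
  show ?thesis
    unfolding L_deriv_2_eq_R_piece[OF tau] inner_R_piece R_piece_add[symmetric] eq ..
qed


text \<open>
  Collects the terms of \<open>residual_bound\<close>, whose acceleration term is replaced with
  \<open>projected_acceleration_bound\<close> for the projection error \<open>Q = 1 - \<pi>\<close>.
\<close>

lemma residual_estimate:
  fixes \<Omega> :: "'a::euclidean_space set" and \<T> :: "'a set set" and k m :: nat and \<tau> :: real and f u :: "real \<Rightarrow> ('a, real) l2" and U :: "nat \<Rightarrow> ('a, real) l2"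
  defines "W \<equiv> fe_space \<Omega> \<T> k" and "w \<equiv> recon_L \<tau> U" and "f\<^sub>\<tau> \<equiv> recon_R \<tau> (\<lambda>n. f (real n * \<tau>))"
  assumes poly: "lipschitz_polyhedron \<Omega>" and mesh: "simplicial_mesh \<Omega> \<T>"
    and f: "f \<in> C_time (Suc m) Y" and f0: "supported_away_from_zero f"
    and u: "wave_solution \<Omega> f u" and tau: "0 < \<tau>" and U: "leapfrog_solution \<Omega> W \<tau> f U"
    and rho: "0 < \<rho>" and H: "0 \<le> H" and c: "0 \<le> c\<^sub>1" "0 \<le> c\<^sub>2"
    and pi1: "\<And>\<phi>. \<phi> \<in> H10 \<Omega> \<Longrightarrow> norm (\<phi> - l2_projection W \<phi>) \<le> c\<^sub>1 * H * norm (grad \<Omega> \<phi>)"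
    and pi2: "\<And>\<phi>. \<phi> \<in> H10 \<Omega> \<Longrightarrow> norm (grad \<Omega> (l2_projection W \<phi>)) \<le> c\<^sub>2 * norm (grad \<Omega> \<phi>)"
  shows "damped_integral \<rho> (\<lambda>t. (dual_norm \<Omega> (residual \<Omega> f\<^sub>\<tau> w t))\<^sup>2)
      \<le> ennreal (4 * (c\<^sub>1\<^sup>2 + (1 + c\<^sub>2)\<^sup>2) * (2 + interp_const m)) *
         (damped_integral \<rho> (\<lambda>t. ennreal ((norm (tderiv 1 (\<lambda>t. u t - w t) t))\<^sup>2 + (norm (grad \<Omega> (u t - w t)))\<^sup>2))
          + damped_integral \<rho> (\<lambda>t. ennreal ((norm (grad \<Omega> (recon_R \<tau> U t - w t)))\<^sup>2))
          + ennreal (H\<^sup>2) * damped_integral \<rho> (\<lambda>t. ennreal ((norm (f t - f\<^sub>\<tau> t))\<^sup>2))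
          + ennreal (H ^ (2 * Suc m) / \<rho>\<^sup>2) * damped_integral \<rho> (\<lambda>t. ennreal ((norm (tderiv (Suc m) f t))\<^sup>2)))"
proof -
  have op: "open \<Omega>" and bd: "bounded \<Omega>" using poly by (auto simp: lipschitz_polyhedron_def)
  have sub: "subspace W" unfolding W_def by (rule subspace_fe_space[OF op bd])
  have fin: "\<exists>S. finite S \<and> W \<subseteq> span S" unfolding W_def by (rule fe_space_finite_span[OF mesh])
  have WH: "W \<subseteq> H10 \<Omega>" by (auto simp: W_def fe_space_def)
  note [simp del] = tderiv.simps
  define z where "z = zero_ext U"
  define F where "F = zero_ext (\<lambda>n. f (real n * \<tau>))"
  define gz where "gz = (\<lambda>m. grad \<Omega> (z m))"
  define \<pi> where "\<pi> = l2_projection W"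
  define Q where "Q x = x - \<pi> x" for x
  have zW: "z m \<in> W" for m
    using U subspace_0[OF sub] by (auto simp: z_def zero_ext_def leapfrog_solution_def)
  have LW: "L_deriv i \<tau> z n t \<in> W" for i n t by (rule subspace_L_deriv[OF sub zW])
  have H1s: "subspace (H1 \<Omega>)"
  proof -
    have z0: "0 \<in> H1 \<Omega>" using H10_H1[OF H10_0[OF op]] .
    show ?thesis unfolding subspace_def using z0 H1_add_scaleR[of _ \<Omega> _ 1] H1_add_scaleR[OF z0] by auto
  qed
  interpret G: linear_on_subspace "grad \<Omega>" "H1 \<Omega>"
    by unfold_locales (rule H1s, rule grad_add_scaleR[OF op])
  have zH: "z m \<in> H1 \<Omega>" for m using zW WH H10_H1 by blast
  have uH: "u t \<in> H1 \<Omega>" if "0 \<le> t" for t using u that H10_H1 by (auto simp: wave_solution_def C0_V_def)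
  have wt: "w t = L_deriv 0 \<tau> z \<lfloor>t / \<tau>\<rfloor> t" for t by (simp add: w_def recon_L_eq z_def)
  have Rt: "recon_R \<tau> U t = R_piece \<tau> z \<lfloor>t / \<tau>\<rfloor> t" for t by (simp add: recon_R_eq z_def)
  have ft: "f\<^sub>\<tau> t = R_piece \<tau> F \<lfloor>t / \<tau>\<rfloor> t" for t by (simp add: f\<^sub>\<tau>_def recon_R_eq F_def)
  have wH: "w t \<in> H1 \<Omega>" for t unfolding wt by (rule subspace_L_deriv[OF H1s zH])
  have RH: "recon_R \<tau> U t \<in> H1 \<Omega>" for t
    unfolding Rt R_piece_def Let_def by (intro subspace_add[OF H1s] subspace_diff[OF H1s] subspace_scale[OF H1s] zH)
  have gw: "grad \<Omega> (w t) = L_deriv 0 \<tau> gz \<lfloor>t / \<tau>\<rfloor> t" for t unfolding wt gz_def by (rule G.L_deriv[OF zH])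
  have gR: "grad \<Omega> (recon_R \<tau> U t) = R_piece \<tau> gz \<lfloor>t / \<tau>\<rfloor> t" for t unfolding Rt gz_def by (rule G.R_piece[OF zH])
  have uC: "u \<in> C20_time (L2_on \<Omega>)" and gu_cont: "continuous_on {0..} (\<lambda>t. grad \<Omega> (u t))"
    and wave: "\<And>t v. 0 \<le> t \<Longrightarrow> v \<in> H10 \<Omega> \<Longrightarrow> tderiv 2 u t \<bullet> v + grad \<Omega> (u t) \<bullet> grad \<Omega> v = f t \<bullet> v"
    and uV: "\<And>t. 0 \<le> t \<Longrightarrow> u t \<in> H10 \<Omega>"
    using u by (auto simp: wave_solution_def C0_V_def)
  have u2C: "u \<in> C_time 2 (L2_on \<Omega>)" and u0: "u 0 = 0" using uC by (auto simp: C20_time_def)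
  have f00: "f 0 = 0" using f0 by (auto simp: supported_away_from_zero_def)
  have u2c: "continuous_on {0..} (tderiv 2 u)" using u2C by (simp add: C_time_def)
  have du1: "(tderiv 1 u has_vector_derivative tderiv 2 u t) (at t within {0..})" if "0 \<le> t" for t
    using has_vector_derivative_tderiv[OF u2C, of 1 t] that by (simp add: numeral_2_eq_2)
  have u1c: "continuous_on {0..} (tderiv 1 u)"
    unfolding continuous_on_eq_continuous_within using has_vector_derivative_continuous[OF du1] by simp
  have fc: "continuous_on {0..} f"
    unfolding continuous_on_eq_continuous_within
    using has_vector_derivative_continuous[OF has_vector_derivative_tderiv[OF f, of 0]] by (simp add: tderiv.simps)
  have Qlin: "bounded_linear Q" unfolding Q_def \<pi>_def by (rule projection_error_linear[OF sub fin])
  have Qn: "norm (Q x) \<le> norm x" for x unfolding Q_def \<pi>_def by (rule projection_error_norm[OF sub fin])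
  \<comment> \<open>The integrands of the right-hand side with \<open>e'\<close> expanded and cut off at \<open>t < 0\<close>: in this form they are
     Borel measurable, which additivity of the integral needs, and they differ from the originals at
     most in the nodes.\<close>
  define a where "a t = (if 0 \<le> t then (norm (tderiv 1 u t - L_deriv 1 \<tau> z \<lfloor>t / \<tau>\<rfloor> t))\<^sup>2
      + (norm (grad \<Omega> (u t) - L_deriv 0 \<tau> gz \<lfloor>t / \<tau>\<rfloor> t))\<^sup>2 else 0)" for t
  define d where "d t = (if 0 \<le> t then (norm (R_piece \<tau> gz \<lfloor>t / \<tau>\<rfloor> t - L_deriv 0 \<tau> gz \<lfloor>t / \<tau>\<rfloor> t))\<^sup>2 else 0)" for t
  define \<eta> where "\<eta> t = (if 0 \<le> t then (norm (f t - R_piece \<tau> F \<lfloor>t / \<tau>\<rfloor> t))\<^sup>2 else 0)" for t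
  define q where "q t = (if 0 \<le> t then (norm (Q (tderiv 2 u t)))\<^sup>2 else 0)" for t
  have [measurable]: "a \<in> borel_measurable borel"
    unfolding a_def[abs_def]
    by (rule borel_measurable_time_cells[of "\<lambda>n t. (norm (tderiv 1 u t - L_deriv 1 \<tau> z n t))\<^sup>2
      + (norm (grad \<Omega> (u t) - L_deriv 0 \<tau> gz n t))\<^sup>2"]) (intro continuous_intros u1c gu_cont continuous_on_L_deriv)
  have [measurable]: "d \<in> borel_measurable borel"
    unfolding d_def[abs_def]
    by (rule borel_measurable_time_cells[of "\<lambda>n t. (norm (R_piece \<tau> gz n t - L_deriv 0 \<tau> gz n t))\<^sup>2"])
       (intro continuous_intros continuous_on_L_deriv continuous_on_R_piece tau)
  have [measurable]: "\<eta> \<in> borel_measurable borel"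
    unfolding \<eta>_def[abs_def]
    by (rule borel_measurable_time_cells[of "\<lambda>n t. (norm (f t - R_piece \<tau> F n t))\<^sup>2"])
       (intro continuous_intros continuous_on_R_piece tau fc)
  have [measurable]: "q \<in> borel_measurable borel"
    unfolding q_def[abs_def]
    by (rule borel_measurable_time_cells[of "\<lambda>n t. (norm (Q (tderiv 2 u t)))\<^sup>2" 1])
       (intro continuous_intros bounded_linear.continuous_on[OF Qlin] u2c)
  let ?A = "damped_integral \<rho> (\<lambda>t. ennreal (a t))" and ?D = "damped_integral \<rho> (\<lambda>t. ennreal (d t))"
  let ?E = "damped_integral \<rho> (\<lambda>t. ennreal (\<eta> t))" and ?Q = "damped_integral \<rho> (\<lambda>t. ennreal (q t))"
  let ?F = "ennreal (H ^ (2 * Suc m) / \<rho>\<^sup>2) * damped_norm_sq \<rho> (tderiv (Suc m) f)"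
  have de: "tderiv 1 (\<lambda>t. u t - w t) t = tderiv 1 u t - L_deriv 1 \<tau> z \<lfloor>t / \<tau>\<rfloor> t"
    if n: "0 \<le> n" "of_int n * \<tau> < t" "t < of_int (n + 1) * \<tau>" for n t
  proof -
    have t0: "0 \<le> t" using n(1,2) tau by (smt (verit) mult_nonneg_nonneg of_int_0_le_iff)
    let ?I = "{of_int n * \<tau><..<of_int (n + 1) * \<tau>}"
    have "(w has_vector_derivative L_deriv (Suc 0) \<tau> z n t) (at t)"
    proof (rule has_vector_derivative_transform_within_open[OF L_deriv_has_derivative, of ?I])
      show "L_deriv 0 \<tau> z n x = w x" if "x \<in> ?I" for x
        unfolding wt using floor_cell[OF tau, of n x] that by simp
    qed (use n in auto)
    then have "(w has_vector_derivative L_deriv 1 \<tau> z n t) (at t within {0..})"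
      using has_vector_derivative_at_within by simp
    moreover have "(u has_vector_derivative tderiv 1 u t) (at t within {0..})"
      using has_vector_derivative_tderiv[OF u2C, of 0 t] t0 by (simp add: tderiv.simps)
    ultimately have "((\<lambda>t. u t - w t) has_vector_derivative tderiv 1 u t - L_deriv 1 \<tau> z n t) (at t within {0..})"
      by (intro has_vector_derivative_diff)
    from vector_derivative_within[OF at_half_line_nontrivial[OF t0] this] floor_cell[OF tau n(2,3)]
    show ?thesis by (simp add: tderiv.simps)
  qed
  note cells = AE_time_cells[OF tau]
  have A: "damped_integral \<rho> (\<lambda>t. ennreal ((norm (tderiv 1 (\<lambda>t. u t - w t) t))\<^sup>2 + (norm (grad \<Omega> (u t - w t)))\<^sup>2)) = ?A"
  proof (rule damped_integral_cong_AE)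
    from cells show "AE t in lborel. 0 \<le> t \<longrightarrow> ennreal ((norm (tderiv 1 (\<lambda>t. u t - w t) t))\<^sup>2 + (norm (grad \<Omega> (u t - w t)))\<^sup>2) = ennreal (a t)"
    proof eventually_elim
      case (elim t)
      show ?case
      proof
        assume t: "0 \<le> t"
        then obtain n where "0 \<le> n" "of_int n * \<tau> < t" "t < of_int (n + 1) * \<tau>" using elim by blast
        note de[OF this]
        then show "ennreal ((norm (tderiv 1 (\<lambda>t. u t - w t) t))\<^sup>2 + (norm (grad \<Omega> (u t - w t)))\<^sup>2) = ennreal (a t)"
          using t by (simp add: a_def G.diff[OF uH[OF t] wH] gw)
      qed
    qed
  qed
  have D: "damped_integral \<rho> (\<lambda>t. ennreal ((norm (grad \<Omega> (recon_R \<tau> U t - w t)))\<^sup>2)) = ?D"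
    by (rule damped_integral_cong_AE) (simp add: d_def G.diff[OF RH wH] gw gR)
  have E: "damped_integral \<rho> (\<lambda>t. ennreal ((norm (f t - f\<^sub>\<tau> t))\<^sup>2)) = ?E"
    by (rule damped_integral_cong_AE) (simp add: \<eta>_def ft)
  have Qd: "damped_norm_sq \<rho> (\<lambda>t. Q (tderiv 2 u t)) = ?Q"
    by (rule damped_integral_cong_AE) (simp add: q_def)
  have Qv: "damped_norm_sq \<rho> (\<lambda>t. Q (tderiv 1 u t)) \<le> ?A"
  proof (rule damped_integral_mono_AE, rule AE_I2, rule impI)
    fix t :: real assume t: "0 \<le> t"
    let ?L = "L_deriv 1 \<tau> z \<lfloor>t / \<tau>\<rfloor> t"
    interpret Q: bounded_linear Q by (rule Qlin)
    have "Q ?L = 0" by (simp add: Q_def \<pi>_def projection_id[OF sub fin LW])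
    then have "Q (tderiv 1 u t) = Q (tderiv 1 u t - ?L)" by (simp add: Q.diff)
    then have "(norm (Q (tderiv 1 u t)))\<^sup>2 \<le> (norm (tderiv 1 u t - ?L))\<^sup>2"
      using Qn[of "tderiv 1 u t - ?L"] by (simp add: power_mono)
    also have "\<dots> \<le> a t" using t by (simp add: a_def)
    finally show "ennreal ((norm (Q (tderiv 1 u t)))\<^sup>2) \<le> ennreal (a t)" by (rule ennreal_leI)
  qed
  have "ennreal (H\<^sup>2) * damped_norm_sq \<rho> (\<lambda>t. Q (tderiv 2 u t))
    \<le> ennreal (interp_const m) * damped_norm_sq \<rho> (\<lambda>t. Q (tderiv 1 u t)) + 2 * ?F"
    by (rule projected_acceleration_bound[where p = "\<lambda>t. grad \<Omega> (u t)", OF uC f f0 wave _ rho H Qlin Qn])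
       (simp_all add: uV u0 grad_0[OF op])
  then have interp: "ennreal (H\<^sup>2) * ?Q \<le> ennreal (interp_const m) * ?A + 2 * ?F"
    unfolding Qd using Qv by (meson add_mono mult_left_mono order_refl order_trans zero_le)
  \<comment> \<open>The factor \<open>4\<close> is that of \<open>sum_four_squares\<close>; the bracket dominates the squares of the factors \<open>c\<^sub>1\<close>,
     \<open>c\<^sub>2\<close> and \<open>1 + c\<^sub>2\<close> of the four terms.\<close>
  define K where "K = 4 * (c\<^sub>1\<^sup>2 + (1 + c\<^sub>2)\<^sup>2)"
  have K0: "0 \<le> K" by (simp add: K_def)
  have pt: "(dual_norm \<Omega> (residual \<Omega> f\<^sub>\<tau> w t))\<^sup>2 \<le> ennreal (K * (a t + d t + H\<^sup>2 * \<eta> t + H\<^sup>2 * q t))"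
    if n: "0 \<le> n" "of_int n * \<tau> < t" "t < of_int (n + 1) * \<tau>" and t: "0 \<le> t" for n t
  proof -
    let ?n = "\<lfloor>t / \<tau>\<rfloor>"
    define L2 where "L2 = L_deriv 2 \<tau> z ?n t"
    define S1 where "S1 = norm (grad \<Omega> (recon_R \<tau> U t) - grad \<Omega> (w t))"
    define S2 where "S2 = norm (f t - f\<^sub>\<tau> t)"
    define S3 where "S3 = norm (Q (tderiv 2 u t))"
    define S4 where "S4 = norm (grad \<Omega> (u t) - grad \<Omega> (w t))"
    note S_defs = S1_def S2_def S3_def S4_def
    have S0: "0 \<le> S1" "0 \<le> S2" "0 \<le> S3" "0 \<le> S4" by (simp_all add: S_defs)
    have w2: "tderiv 2 w t = L2" unfolding w_def L2_def z_def by (rule tderiv_recon_L[OF tau n])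
    define S where "S = S1 * c\<^sub>2 + S2 * (c\<^sub>1 * H) + S3 * (c\<^sub>1 * H) + S4 * (1 + c\<^sub>2)"
    have Sn: "0 \<le> S" using S0 c H by (simp add: S_def)
    have "dual_norm \<Omega> (residual \<Omega> f\<^sub>\<tau> w t) \<le> ennreal S"
      unfolding dual_norm_def
    proof (rule SUP_least)
      fix v assume "v \<in> {v \<in> H10 \<Omega>. norm (grad \<Omega> v) = 1}"
      then have v: "v \<in> H10 \<Omega>" "norm (grad \<Omega> v) = 1" by auto
      have pW: "\<pi> v \<in> W" unfolding \<pi>_def by (rule projection_in[OF sub fin])
      have orth: "x \<bullet> (v - \<pi> v) = 0" if "x \<in> W" for x
        using projection_inner[OF sub fin that, of v] by (simp add: \<pi>_def inner_diff_right inner_commute[of x])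
      have n1: "norm (v - \<pi> v) \<le> c\<^sub>1 * H" using pi1[OF v(1)] v(2) by (simp add: \<pi>_def)
      have n2: "norm (grad \<Omega> (\<pi> v)) \<le> c\<^sub>2" using pi2[OF v(1)] v(2) by (simp add: \<pi>_def)
      have "\<bar>f\<^sub>\<tau> t \<bullet> v - L2 \<bullet> v - grad \<Omega> (w t) \<bullet> grad \<Omega> v\<bar>
        \<le> norm (grad \<Omega> (recon_R \<tau> U t) - grad \<Omega> (w t)) * norm (grad \<Omega> (\<pi> v)) + norm (f t - f\<^sub>\<tau> t) * norm (v - \<pi> v)
          + norm (tderiv 2 u t - \<pi> (tderiv 2 u t)) * norm (v - \<pi> v)
          + norm (grad \<Omega> (u t) - grad \<Omega> (w t)) * (norm (grad \<Omega> v) + norm (grad \<Omega> (\<pi> v)))"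
      proof (rule residual_bound)
        show "tderiv 2 u t \<bullet> v + grad \<Omega> (u t) \<bullet> grad \<Omega> v = f t \<bullet> v" by (rule wave[OF t v(1)])
        show "tderiv 2 u t \<bullet> \<pi> v + grad \<Omega> (u t) \<bullet> grad \<Omega> (\<pi> v) = f t \<bullet> \<pi> v" using wave[OF t] pW WH by blast
        show "L2 \<bullet> \<pi> v + grad \<Omega> (recon_R \<tau> U t) \<bullet> grad \<Omega> (\<pi> v) = f\<^sub>\<tau> t \<bullet> \<pi> v"
          unfolding L2_def gR ft z_def F_def gz_def
          using discrete_equation[OF op sub[unfolded W_def] tau U[unfolded W_def] f00 pW[unfolded W_def]] .
        show "L2 \<bullet> (v - \<pi> v) = 0" unfolding L2_def by (rule orth[OF LW])
        show "\<pi> (tderiv 2 u t) \<bullet> (v - \<pi> v) = 0" unfolding \<pi>_def by (rule orth[unfolded \<pi>_def, OF projection_in[OF sub fin]])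
      qed
      also have "\<dots> \<le> S1 * c\<^sub>2 + S2 * (c\<^sub>1 * H) + S3 * (c\<^sub>1 * H) + S4 * (1 + c\<^sub>2)"
        unfolding S_defs Q_def v(2) by (intro add_mono mult_left_mono n1 n2 order_refl norm_ge_zero)
      finally show "ennreal \<bar>residual \<Omega> f\<^sub>\<tau> w t v\<bar> \<le> ennreal S"
        unfolding residual_def w2 S_def by (rule ennreal_leI)
    qed
    then have "(dual_norm \<Omega> (residual \<Omega> f\<^sub>\<tau> w t))\<^sup>2 \<le> (ennreal S)\<^sup>2" by (intro power_mono) auto
    also have "\<dots> = ennreal (S\<^sup>2)" by (rule ennreal_power[OF Sn])
    also have "\<dots> \<le> ennreal (K * (a t + d t + H\<^sup>2 * \<eta> t + H\<^sup>2 * q t))"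
    proof (rule ennreal_leI)
      have "S\<^sup>2 \<le> 4 * ((S1 * c\<^sub>2)\<^sup>2 + (S2 * (c\<^sub>1 * H))\<^sup>2 + (S3 * (c\<^sub>1 * H))\<^sup>2 + (S4 * (1 + c\<^sub>2))\<^sup>2)"
        unfolding S_def by (rule sum_four_squares)
      also have "\<dots> = 4 * (c\<^sub>2\<^sup>2 * S1\<^sup>2 + c\<^sub>1\<^sup>2 * (H\<^sup>2 * S2\<^sup>2) + c\<^sub>1\<^sup>2 * (H\<^sup>2 * S3\<^sup>2) + (1 + c\<^sub>2)\<^sup>2 * S4\<^sup>2)"
        by (simp add: power_mult_distrib mult_ac)
      also have "\<dots> \<le> 4 * ((c\<^sub>1\<^sup>2 + (1 + c\<^sub>2)\<^sup>2) * S1\<^sup>2 + (c\<^sub>1\<^sup>2 + (1 + c\<^sub>2)\<^sup>2) * (H\<^sup>2 * S2\<^sup>2)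
           + (c\<^sub>1\<^sup>2 + (1 + c\<^sub>2)\<^sup>2) * (H\<^sup>2 * S3\<^sup>2) + (c\<^sub>1\<^sup>2 + (1 + c\<^sub>2)\<^sup>2) * S4\<^sup>2)"
      proof -
        have "c\<^sub>2\<^sup>2 \<le> (1 + c\<^sub>2)\<^sup>2" using c(2) by (intro power_mono) auto
        then have "c\<^sub>2\<^sup>2 \<le> c\<^sub>1\<^sup>2 + (1 + c\<^sub>2)\<^sup>2" using zero_le_power2[of c\<^sub>1] by linarith
        then show ?thesis by (intro mult_left_mono add_mono mult_right_mono) auto
      qed
      also have "\<dots> = K * (S4\<^sup>2 + S1\<^sup>2 + H\<^sup>2 * S2\<^sup>2 + H\<^sup>2 * S3\<^sup>2)" unfolding K_def by algebra
      also have "\<dots> \<le> K * (a t + d t + H\<^sup>2 * \<eta> t + H\<^sup>2 * q t)"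
      proof (rule mult_left_mono[OF _ K0])
        have "S4\<^sup>2 \<le> a t" using t by (simp add: S4_def a_def gw)
        moreover have "S1\<^sup>2 = d t" using t by (simp add: S1_def d_def gw gR)
        moreover have "S2\<^sup>2 = \<eta> t" using t by (simp add: S2_def \<eta>_def ft)
        moreover have "S3\<^sup>2 = q t" using t by (simp add: S3_def q_def)
        ultimately show "S4\<^sup>2 + S1\<^sup>2 + H\<^sup>2 * S2\<^sup>2 + H\<^sup>2 * S3\<^sup>2 \<le> a t + d t + H\<^sup>2 * \<eta> t + H\<^sup>2 * q t" by simp
      qed
      finally show "S\<^sup>2 \<le> K * (a t + d t + H\<^sup>2 * \<eta> t + H\<^sup>2 * q t)" .
    qed
    finally show ?thesis .
  qed
  have "damped_integral \<rho> (\<lambda>t. (dual_norm \<Omega> (residual \<Omega> f\<^sub>\<tau> w t))\<^sup>2)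
    \<le> damped_integral \<rho> (\<lambda>t. ennreal K * (ennreal (a t) + ennreal (d t) + ennreal (H\<^sup>2) * ennreal (\<eta> t) + ennreal (H\<^sup>2) * ennreal (q t)))"
  proof (rule damped_integral_mono_AE)
    from cells show "AE t in lborel. 0 \<le> t \<longrightarrow> (dual_norm \<Omega> (residual \<Omega> f\<^sub>\<tau> w t))\<^sup>2
      \<le> ennreal K * (ennreal (a t) + ennreal (d t) + ennreal (H\<^sup>2) * ennreal (\<eta> t) + ennreal (H\<^sup>2) * ennreal (q t))"
    proof eventually_elim
      case (elim t)
      show ?case
      proof
        assume t: "0 \<le> t"
        then obtain n where "0 \<le> n" "of_int n * \<tau> < t" "t < of_int (n + 1) * \<tau>" using elim by blast
        note pt[OF this t]
        also have "ennreal (K * (a t + d t + H\<^sup>2 * \<eta> t + H\<^sup>2 * q t))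
          = ennreal K * (ennreal (a t) + ennreal (d t) + ennreal (H\<^sup>2) * ennreal (\<eta> t) + ennreal (H\<^sup>2) * ennreal (q t))"
          using K0 by (simp add: ennreal_mult ennreal_plus a_def d_def \<eta>_def q_def)
        finally show "(dual_norm \<Omega> (residual \<Omega> f\<^sub>\<tau> w t))\<^sup>2
          \<le> ennreal K * (ennreal (a t) + ennreal (d t) + ennreal (H\<^sup>2) * ennreal (\<eta> t) + ennreal (H\<^sup>2) * ennreal (q t))" .
      qed
    qed
  qed
  also have "\<dots> = ennreal K * (?A + ?D + ennreal (H\<^sup>2) * ?E + ennreal (H\<^sup>2) * ?Q)"
    by (simp add: damped_integral_cmult damped_integral_add)
  also have "\<dots> \<le> ennreal K * (?A + ?D + ennreal (H\<^sup>2) * ?E + (ennreal (interp_const m) * ?A + 2 * ?F))"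
    by (intro mult_left_mono add_mono order_refl interp) simp
  also have "\<dots> \<le> ennreal K * (ennreal (2 + interp_const m) * (?A + ?D + ennreal (H\<^sup>2) * ?E + ?F))"
  proof (rule mult_left_mono)
    have e: "ennreal (2 + interp_const m) = 2 + ennreal (interp_const m)"
      using interp_const_nonneg[of m] by (simp add: ennreal_plus)
    have "?A + ?D + ennreal (H\<^sup>2) * ?E + (ennreal (interp_const m) * ?A + 2 * ?F)
      \<le> 2 * (?A + ?D + ennreal (H\<^sup>2) * ?E + ?F) + ennreal (interp_const m) * (?A + ?D + ennreal (H\<^sup>2) * ?E + ?F)"
    proof -
      let ?x = "?D + ennreal (H\<^sup>2) * ?E"
      have "?A + ?x + (ennreal (interp_const m) * ?A + 2 * ?F) \<le> (?A + ?x + (ennreal (interp_const m) * ?A + 2 * ?F)) + (?A + ?x + ennreal (interp_const m) * (?x + ?F))"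
        by simp
      also have "\<dots> = 2 * (?A + ?x + ?F) + ennreal (interp_const m) * (?A + ?x + ?F)"
        by (simp add: distrib_left mult_2 add_ac)
      finally show ?thesis by (simp only: add.assoc)
    qed
    then show "?A + ?D + ennreal (H\<^sup>2) * ?E + (ennreal (interp_const m) * ?A + 2 * ?F)
      \<le> ennreal (2 + interp_const m) * (?A + ?D + ennreal (H\<^sup>2) * ?E + ?F)"
      unfolding e distrib_right[of 2] .
  qed simp
  also have "\<dots> = ennreal (K * (2 + interp_const m)) * (?A + ?D + ennreal (H\<^sup>2) * ?E + ?F)"
    using K0 interp_const_nonneg[of m] by (simp add: ennreal_mult mult.assoc)
  finally show ?thesis unfolding A D E K_def .
qed

theorem theorem5p1:
  fixes k r :: nat and \<sigma> \<mu>\<^sub>0 c\<^sub>C\<^sub>F\<^sub>L C\<^sub>1 C\<^sub>2 :: real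
  assumes "1 \<le> k" and "2 \<le> r" and "0 < \<mu>\<^sub>0" and "\<mu>\<^sub>0 < 1"
    and "cfl_constant TYPE('a::euclidean_space) k \<sigma> \<mu>\<^sub>0 c\<^sub>C\<^sub>F\<^sub>L"
  shows "\<exists>C>0. \<forall>(\<Omega>::'a set) \<T> f u U \<tau> \<rho>.
    let h = mesh_size \<T>;
        V\<^sub>h = fe_space \<Omega> \<T> k;
        \<pi>\<^sub>h = l2_projection V\<^sub>h;
        u\<^sub>h\<^sub>\<tau> = recon_R \<tau> U;
        w\<^sub>h\<^sub>\<tau> = recon_L \<tau> U;
        f\<^sub>\<tau> = recon_R \<tau> (\<lambda>n. f (real n * \<tau>));
        \<delta>\<^sub>h\<^sub>\<tau> = (\<lambda>t. u\<^sub>h\<^sub>\<tau> t - w\<^sub>h\<^sub>\<tau> t);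
        \<eta>\<^sub>f = (\<lambda>t. f t - f\<^sub>\<tau> t);
        e = (\<lambda>t. u t - w\<^sub>h\<^sub>\<tau> t)
    in
      lipschitz_polyhedron \<Omega> \<and> simplicial_mesh \<Omega> \<T> \<and> shape_regular \<sigma> \<T> \<and>
      f \<in> H1_time (L2_on \<Omega>) \<and> f \<in> Linf_time (L2_on \<Omega>) \<and> supported_away_from_zero f \<and>
      f \<in> Cb_time r (L2_on \<Omega>) \<and>
      wave_solution \<Omega> f u \<and>
      0 < \<tau> \<and> leapfrog_solution \<Omega> V\<^sub>h \<tau> f U \<and>
      u\<^sub>h\<^sub>\<tau> \<in> Linf_V \<Omega> V\<^sub>h \<and> w\<^sub>h\<^sub>\<tau> \<in> Linf_V \<Omega> V\<^sub>h \<and>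
      0 < \<rho> \<and> \<rho> * \<tau> \<le> 1 \<and>
      \<tau> \<le> c\<^sub>C\<^sub>F\<^sub>L * mesh_size_min \<T> \<and>
      (\<forall>\<phi>\<in>H10 \<Omega>. norm (\<phi> - \<pi>\<^sub>h \<phi>) \<le> C\<^sub>1 * h * norm (grad \<Omega> \<phi>) \<and>
                   norm (grad \<Omega> (\<pi>\<^sub>h \<phi>)) \<le> C\<^sub>2 * norm (grad \<Omega> \<phi>))
      \<longrightarrow>
      damped_integral \<rho> (\<lambda>t. (dual_norm \<Omega> (residual \<Omega> f\<^sub>\<tau> w\<^sub>h\<^sub>\<tau> t))\<^sup>2)
      \<le> ennreal C *
         (damped_integral \<rho> (\<lambda>t. ennreal ((norm (tderiv 1 e t))\<^sup>2 + (norm (grad \<Omega> (e t)))\<^sup>2))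
          + damped_integral \<rho> (\<lambda>t. ennreal ((norm (grad \<Omega> (\<delta>\<^sub>h\<^sub>\<tau> t)))\<^sup>2))
          + ennreal (h\<^sup>2) * damped_integral \<rho> (\<lambda>t. ennreal ((norm (\<eta>\<^sub>f t))\<^sup>2))
          + ennreal (h ^ (2 * r) / \<rho>\<^sup>2) * damped_integral \<rho> (\<lambda>t. ennreal ((norm (tderiv r f t))\<^sup>2)))"
proof -
  obtain m where r: "r = Suc m" using \<open>2 \<le> r\<close> by (cases r) auto
  define C where "C = 4 * (\<bar>C\<^sub>1\<bar>\<^sup>2 + (1 + \<bar>C\<^sub>2\<bar>)\<^sup>2) * (2 + interp_const m)"
  have "0 < \<bar>C\<^sub>1\<bar>\<^sup>2 + (1 + \<bar>C\<^sub>2\<bar>)\<^sup>2"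
    by (intro add_nonneg_pos) (auto simp: zero_less_power2)
  then have C0: "0 < C" using interp_const_nonneg[of m] by (simp add: C_def zero_less_mult_iff)
  show ?thesis
    unfolding Let_def
  proof (rule exI[of _ C], rule conjI[OF C0], intro allI impI, elim conjE, goal_cases)
    case (1 \<Omega> \<T> f u U \<tau> \<rho>)
    note a = 1
    let ?h = "mesh_size \<T>" and ?W = "fe_space \<Omega> \<T> k"
    \<comment> \<open>Only even powers of the mesh size occur in the conclusion, so its absolute value may take its place.\<close>
    have even: "?h\<^sup>2 = \<bar>?h\<bar>\<^sup>2" "?h ^ (2 * Suc m) = \<bar>?h\<bar> ^ (2 * Suc m)"
      by (simp_all only: power2_abs power_even_abs even_mult_iff even_numeral simp_thms)
    show ?case
      unfolding even r C_def
    proof (rule residual_estimate)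
      show "f \<in> C_time (Suc m) (L2_on \<Omega>)" using a by (simp add: Cb_time_def r)
      fix \<phi> assume \<phi>: "\<phi> \<in> H10 \<Omega>"
      have "norm (\<phi> - l2_projection ?W \<phi>) \<le> C\<^sub>1 * ?h * norm (grad \<Omega> \<phi>)"
        and grad: "norm (grad \<Omega> (l2_projection ?W \<phi>)) \<le> C\<^sub>2 * norm (grad \<Omega> \<phi>)" using a \<phi> by blast+
      note this(1)
      also have "C\<^sub>1 * ?h * norm (grad \<Omega> \<phi>) \<le> \<bar>C\<^sub>1\<bar> * \<bar>?h\<bar> * norm (grad \<Omega> \<phi>)"
        by (intro mult_right_mono) (simp_all add: abs_mult[symmetric])
      finally show "norm (\<phi> - l2_projection ?W \<phi>) \<le> \<bar>C\<^sub>1\<bar> * \<bar>?h\<bar> * norm (grad \<Omega> \<phi>)" .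
      note grad
      also have "C\<^sub>2 * norm (grad \<Omega> \<phi>) \<le> \<bar>C\<^sub>2\<bar> * norm (grad \<Omega> \<phi>)"
        by (intro mult_right_mono) simp_all
      finally show "norm (grad \<Omega> (l2_projection ?W \<phi>)) \<le> \<bar>C\<^sub>2\<bar> * norm (grad \<Omega> \<phi>)" .
    qed (use a in simp_all)
  qed
qed

end
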